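(* Let $\Omega\subset\mathbb R^n$ be a bounded domain with $C^{1,1}$ boundary and let $u\in\mathcal X^{1,2}_0(\Omega)$, $u\ge0$, satisfy $$\int_{\mathbb R^n}\nabla u\cdot\nabla\varphi\,dx+\int_{\mathbb R^{2n}}\frac{(u(x)-u(y))(\varphi(x)-\varphi(y))}{|x-y|^{n+2s}}dxdy=\int_\Omega\int_\Omega\frac{|u_+(y)|^{2^*_\mu}|u_+(x)|^{2^*_\mu-1}\varphi(x)}{|x-y|^\mu}dydx$$ for every $\varphi\in\mathcal X^{1,2}_0(\Omega)$. Then $u\in L^\infty(\mathbb R^n)$.
   Context: Standing notation: $n\ge3$, $s\in(0,1)$, $0<\mu<n$, $2^*_\mu=\frac{2n-\mu}{n-2}$, $u_+=\max\{u,0\}$, $[u]_s^2=\int_{\mathbb R^{2n}}\frac{|u(x)-u(y)|^2}{|x-y|^{n+2s}}dxdy$. $\mathcal X^{1,2}_0(\Omega)$ is the completion of $C_c^\infty(\Omega)$ with respect to the norm $\eta(u)=(\|\nabla u\|_{L^2(\mathbb R^n)}^2+[u]_s^2)^{1/2}$; its elements vanish a.e. outside $\Omega$. *)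

theory Defs
  imports "HOL-Analysis.Analysis"
begin

fun Ck :: "nat \<Rightarrow> ('a::euclidean_space \<Rightarrow> real) \<Rightarrow> bool" where
  "Ck 0 f = continuous_on UNIV f"
| "Ck (Suc k) f = (f differentiable_on UNIV \<and>
      (\<forall>i\<in>Basis. Ck k (\<lambda>x. frechet_derivative f (at x) i)))"

definition C_inf :: "('a::euclidean_space \<Rightarrow> real) \<Rightarrow> bool" where
  "C_inf f \<longleftrightarrow> (\<forall>k. Ck k f)"

definition grad :: "('a::euclidean_space \<Rightarrow> real) \<Rightarrow> 'a \<Rightarrow> 'a" where
  "grad f x = (\<Sum>i\<in>Basis. frechet_derivative f (at x) i *\<^sub>R i)"

definition test_fun :: "'a::euclidean_space set \<Rightarrow> ('a \<Rightarrow> real) \<Rightarrow> bool" where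
  "test_fun U \<phi> \<longleftrightarrow> C_inf \<phi> \<and> compact (closure {x. \<phi> x \<noteq> 0}) \<and> closure {x. \<phi> x \<noteq> 0} \<subseteq> U"

definition has_weak_gradient :: "('a::euclidean_space \<Rightarrow> real) \<Rightarrow> ('a \<Rightarrow> 'a) \<Rightarrow> bool" where
  "has_weak_gradient u G \<longleftrightarrow>
     (\<forall>\<phi>. test_fun UNIV \<phi> \<longrightarrow> (\<forall>i\<in>Basis.
        integrable lebesgue (\<lambda>x. u x * frechet_derivative \<phi> (at x) i) \<and>
        integrable lebesgue (\<lambda>x. (G x \<bullet> i) * \<phi> x) \<and>
        (LINT x|lebesgue. u x * frechet_derivative \<phi> (at x) i) =
          - (LINT x|lebesgue. (G x \<bullet> i) * \<phi> x)))"

definition wgrad :: "('a::euclidean_space \<Rightarrow> real) \<Rightarrow> 'a \<Rightarrow> 'a" where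
  "wgrad u = (SOME G. has_weak_gradient u G)"

definition gagliardo2 :: "real \<Rightarrow> ('a::euclidean_space \<Rightarrow> real) \<Rightarrow> ennreal" where
  "gagliardo2 s u = (\<integral>\<^sup>+ z. ennreal ((u (fst z) - u (snd z))\<^sup>2 /
       norm (fst z - snd z) powr (real DIM('a) + 2 * s)) \<partial>(lebesgue \<Otimes>\<^sub>M lebesgue))"

definition eta2 :: "real \<Rightarrow> ('a::euclidean_space \<Rightarrow> real) \<Rightarrow> ('a \<Rightarrow> 'a) \<Rightarrow> ennreal" where
  "eta2 s u G = (\<integral>\<^sup>+ x. ennreal ((norm (G x))\<^sup>2) \<partial>lebesgue) + gagliardo2 s u"

text \<open>The space X^{1,2}_0(Omega), realised concretely as the closure of C_c^infty(Omega)
  with respect to eta, inside the measurable functions vanishing a.e. outside Omega.\<close>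
definition X0 :: "real \<Rightarrow> 'a::euclidean_space set \<Rightarrow> ('a \<Rightarrow> real) \<Rightarrow> bool" where
  "X0 s \<Omega> u \<longleftrightarrow>
     u \<in> borel_measurable lebesgue \<and>
     (AE x in lebesgue. x \<notin> \<Omega> \<longrightarrow> u x = 0) \<and>
     integrable lebesgue (\<lambda>x. (u x)\<^sup>2) \<and>
     (\<exists>G. has_weak_gradient u G \<and> eta2 s u G < \<infinity> \<and>
        (\<exists>\<phi>::nat \<Rightarrow> 'a \<Rightarrow> real. (\<forall>k. test_fun \<Omega> (\<phi> k)) \<and>
           ((\<lambda>k. eta2 s (\<lambda>x. u x - \<phi> k x) (\<lambda>x. G x - grad (\<phi> k) x)) \<longlongrightarrow> 0) sequentially))"

text \<open>C^{1,1} boundary: near each boundary point p, after choosing a unit direction e,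
  Omega is the region above the graph of a C^{1,1} function gamma defined on the
  hyperplane orthogonal to e (gamma is extended constantly in direction e).\<close>
definition C11_boundary :: "'a::euclidean_space set \<Rightarrow> bool" where
  "C11_boundary \<Omega> \<longleftrightarrow>
     (\<forall>p\<in>frontier \<Omega>. \<exists>r>0. \<exists>e. norm e = 1 \<and>
        (\<exists>\<gamma> :: 'a \<Rightarrow> real. \<exists>D :: 'a \<Rightarrow> 'a \<Rightarrow> real. \<exists>L.
           (\<forall>x. \<gamma> x = \<gamma> (x - (x \<bullet> e) *\<^sub>R e)) \<and>
           (\<forall>x. (\<gamma> has_derivative D x) (at x)) \<and>
           (\<forall>x y h. \<bar>D x h - D y h\<bar> \<le> L * norm (x - y) * norm h) \<and>
           \<Omega> \<inter> ball p r = {x \<in> ball p r. x \<bullet> e > \<gamma> x}))"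

definition crit_exp :: "nat \<Rightarrow> real \<Rightarrow> real" where
  "crit_exp n \<mu> = (2 * real n - \<mu>) / (real n - 2)"

end

theory Submission
  imports Defs
begin

text \<open>
  Since the problem is critical, De Giorgi's method applies to \<open>a(k)\<close>, the integral of
  \<open>u\<^sup>\<sigma>\<close> over \<open>{u > k}\<close>, where \<open>\<sigma> = 2n/(n-2)\<close>. Test the equation with a smooth truncation
  \<open>w\<close> of \<open>u\<close> at level \<open>k\<close>: the nonlocal term is nonnegative by monotonicity, so the Dirichlet energy
  of \<open>w\<close> is at most the double integral of \<open>u(y)\<^sup>p u(x)\<^sup>p |x-y|\<^sup>-\<^sup>\<mu>\<close> over \<open>u(x) > k\<close>. By symmetry one
  may assume \<open>u(y) \<le> u(x)\<close>, and then the potential of \<open>u\<^sup>p\<close> truncated at height \<open>u(x)\<^sup>p\<close> is bounded by a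
  power of \<open>u(x)\<close> which makes the whole expression at most \<open>C a(k)\<close>. The Sobolev inequality turns this
  into \<open>a(h) \<le> C (h/(h-k))\<^sup>\<sigma> a(k)\<^sup>n\<^sup>/\<^sup>(\<^sup>n\<^sup>-\<^sup>2\<^sup>)\<close>, and since \<open>a(k)\<close> tends to \<open>0\<close>, it vanishes at a finite level.
  The Sobolev inequality itself follows from the Riesz potential bound for test functions and the
  same truncation argument for the Hardy--Littlewood--Sobolev inequality.
\<close>

section \<open>Smooth functions and test functions\<close>

text \<open>Critical growth enters through one identity. With \<open>r = 2n/(2n - \<mu>)\<close> one
  has \<open>p r = \<sigma>\<close>, and the potential of a function bounded by \<open>t\<close>
  with given \<open>L^r\<close> mass is at most a constant times \<open>t^(r-1)\<close>. At height
  \<open>t = u(x)^p\<close> its product with \<open>u(x)^p\<close> is exactly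
  \<open>u(x)^\<sigma>\<close>, so the constant in front of the tail depends on \<open>u\<close>
  only through the total mass of \<open>u^\<sigma>\<close>. The superlinear exponent of the
  recursion comes from the Sobolev inequality alone, and the smallness that starts it from
  integrability of \<open>u^\<sigma>\<close>; no higher integrability of \<open>u\<close> has to be
  proved beforehand. The truncation is smooth, in place of the positive part of
  \<open>u - k\<close>, because the energy space is a closure of test functions: a smooth function
  vanishing at 0, applied to a test function, gives a test function, so no mollification is
  required. Its slope lies in \<open>[0,1]\<close>, which serves both the passage to the closure and
  the comparison of its Dirichlet energy with the tested gradient term.\<close>

lemma Ck_SucI:
  assumes "\<And>x. (f has_derivative D x) (at x)" and "\<And>i. i \<in> Basis \<Longrightarrow> Ck k (\<lambda>x. D x i)"
  shows "Ck (Suc k) f"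
proof -
  have "frechet_derivative f (at x) = D x" for x
    using frechet_derivative_at[OF assms(1)[of x]] by simp
  moreover have "f differentiable_on UNIV"
    using assms(1) unfolding differentiable_on_def differentiable_def by blast
  ultimately show ?thesis
    using assms(2) unfolding Ck.simps(2) by simp
qed

lemma Ck_Suc_has_derivative:
  assumes "Ck (Suc k) f"
  shows "(f has_derivative frechet_derivative f (at x)) (at x)"
proof -
  have "f differentiable (at x)"
    using assms unfolding Ck.simps(2) differentiable_on_def by blast
  then show ?thesis by (simp only: frechet_derivative_works)
qed

lemma Ck_Suc_partial: "Ck (Suc k) f \<Longrightarrow> i \<in> Basis \<Longrightarrow> Ck k (\<lambda>x. frechet_derivative f (at x) i)"
  by simp

lemma Ck_Suc_imp_Ck: "Ck (Suc k) f \<Longrightarrow> Ck k f"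
proof (induction k arbitrary: f)
  case 0
  then show ?case by (simp add: differentiable_imp_continuous_on)
next
  case (Suc k)
  then show ?case
    using Ck.simps(2)[of "Suc k" f] Ck.simps(2)[of k f] by blast
qed

lemma Ck_const: "Ck k (\<lambda>x::'a::euclidean_space. c)"
proof (induction k arbitrary: c)
  case (Suc k)
  show ?case by (rule Ck_SucI[where D = "\<lambda>_ _. 0"]) (auto intro: Suc)
qed simp

lemma Ck_inner: "Ck k (\<lambda>x::'a::euclidean_space. x \<bullet> b)"
proof (cases k)
  case (Suc m)
  show ?thesis unfolding Suc
    by (rule Ck_SucI[where D = "\<lambda>_ h. h \<bullet> b"]) (auto intro!: derivative_eq_intros Ck_const)
qed (auto intro!: continuous_intros)

lemma Ck_add: "Ck k f \<Longrightarrow> Ck k g \<Longrightarrow> Ck k (\<lambda>x. f x + g x)"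
proof (induction k arbitrary: f g)
  case (Suc k)
  show ?case
  proof (rule Ck_SucI)
    show "((\<lambda>x. f x + g x) has_derivative (\<lambda>h. frechet_derivative f (at x) h
           + frechet_derivative g (at x) h)) (at x)" for x
      using Suc.prems by (intro has_derivative_add Ck_Suc_has_derivative)
    show "Ck k (\<lambda>x. frechet_derivative f (at x) i + frechet_derivative g (at x) i)"
      if "i \<in> Basis" for i
      by (intro Suc.IH Ck_Suc_partial[OF _ that] Suc.prems)
  qed
qed (auto intro!: continuous_intros)

lemma Ck_mult: "Ck k f \<Longrightarrow> Ck k g \<Longrightarrow> Ck k (\<lambda>x. f x * g x)"
proof (induction k arbitrary: f g)
  case (Suc k)
  show ?case
  proof (rule Ck_SucI)
    show "((\<lambda>x. f x * g x) has_derivative (\<lambda>h. f x * frechet_derivative g (at x) h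
           + frechet_derivative f (at x) h * g x)) (at x)" for x
      using Suc.prems by (intro has_derivative_mult Ck_Suc_has_derivative)
    show "Ck k (\<lambda>x. f x * frechet_derivative g (at x) i + frechet_derivative f (at x) i * g x)"
      if "i \<in> Basis" for i
      by (intro Ck_add Suc.IH Ck_Suc_partial[OF _ that] Suc.prems Ck_Suc_imp_Ck[OF Suc.prems(1)]
            Ck_Suc_imp_Ck[OF Suc.prems(2)])
  qed
qed (auto intro!: continuous_intros)

lemma Ck_prod: "finite I \<Longrightarrow> (\<And>i. i \<in> I \<Longrightarrow> Ck k (f i)) \<Longrightarrow> Ck k (\<lambda>x. \<Prod>i\<in>I. f i x)"
  by (induction I rule: finite_induct) (auto intro: Ck_const Ck_mult)

text \<open>A set \<open>S\<close> closed under differentiation lets the induction on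
  \<open>k\<close> run over all \<open>h \<in> S\<close> at once: the chain rule leaves
  \<open>h'\<close> composed with \<open>\<phi>\<close>, times a partial derivative of
  \<open>\<phi>\<close>, and \<open>h'\<close> is again in \<open>S\<close>.\<close>

lemma Ck_compose:
  assumes "\<And>h t. h \<in> S \<Longrightarrow> \<exists>h'\<in>S. \<forall>t. (h has_real_derivative h' t) (at t)"
  shows "h \<in> S \<Longrightarrow> Ck k \<phi> \<Longrightarrow> Ck k (\<lambda>x. h (\<phi> x))"
proof (induction k arbitrary: h \<phi>)
  case 0
  obtain h' where "\<And>t. (h has_real_derivative h' t) (at t)" using assms 0(1) by blast
  then have "continuous_on UNIV h" by (meson DERIV_isCont continuous_at_imp_continuous_on)
  then have "continuous_on UNIV (\<lambda>x. h (\<phi> x))"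
    using 0(2) by (auto intro!: continuous_on_compose2[of UNIV h])
  then show ?case by simp
next
  case (Suc k)
  obtain h' where h': "\<And>t. (h has_real_derivative h' t) (at t)" "h' \<in> S"
    using assms Suc(2) by blast
  show ?case
  proof (rule Ck_SucI)
    show "((\<lambda>x. h (\<phi> x)) has_derivative (\<lambda>v. h' (\<phi> x) * frechet_derivative \<phi> (at x) v)) (at x)" for x
      using has_derivative_compose[OF Ck_Suc_has_derivative[OF Suc(3), of x] h'(1)[unfolded has_field_derivative_def]]
      by simp
    show "Ck k (\<lambda>x. h' (\<phi> x) * frechet_derivative \<phi> (at x) i)" if "i \<in> Basis" for i
      by (rule Ck_mult[OF Suc.IH[OF h'(2) Ck_Suc_imp_Ck[OF Suc.prems(2)]] Ck_Suc_partial[OF Suc.prems(2) that]])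
  qed
qed

text \<open>Functions of the form \<open>t P(1/t) exp(-1/t)\<close> are closed under differentiation, so that
  smoothness of all orders follows at once.\<close>

definition flat :: "real poly \<Rightarrow> real \<Rightarrow> real" where
  "flat P t = (if t > 0 then t * poly P (1 / t) * exp (- 1 / t) else 0)"

text \<open>With \<open>s = 1/t\<close> the derivative of \<open>t P(s) exp(-s)\<close> is
  \<open>(P(s) - s P'(s) + s P(s)) exp(-s)\<close>; the extra factor \<open>[:0, 1:]\<close>
  compensates the leading \<open>t\<close> in \<open>flat\<close>.\<close>

definition flat_d :: "real poly \<Rightarrow> real poly" where
  "flat_d P = [:0, 1:] * (P - [:0, 1:] * pderiv P + [:0, 1:] * P)"

lemma poly_exp_decay: "((\<lambda>x::real. poly P x * exp (- x)) \<longlongrightarrow> 0) at_top"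
proof -
  have "((\<lambda>x::real. \<Sum>i\<le>degree P. coeff P i * (x ^ i / exp x)) \<longlongrightarrow> (\<Sum>i\<le>degree P. coeff P i * 0)) at_top"
    by (intro tendsto_intros tendsto_power_div_exp_0)
  then show ?thesis
    by (simp add: poly_altdef sum_distrib_right exp_minus divide_inverse mult.assoc)
qed

lemma flat_has_derivative: "(flat P has_real_derivative flat (flat_d P) t) (at t)"
proof -
  consider "t < 0" | "t = 0" | "t > 0" by linarith
  then show ?thesis
  proof cases
    case 1
    have "(flat P has_real_derivative 0) (at t) = ((\<lambda>_. 0) has_real_derivative 0) (at t)"
      by (intro DERIV_cong_ev refl eventually_mono[OF eventually_nhds_in_open[of "{..<0}"]])
        (use 1 in \<open>auto simp: flat_def\<close>)
    then show ?thesis using 1 by (simp add: flat_def)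
  next
    case 3
    have "((\<lambda>t. t * poly P (1 / t) * exp (- 1 / t)) has_real_derivative flat (flat_d P) t) (at t)"
    proof -
      have i: "((\<lambda>t. 1 / t) has_real_derivative - (1 / t ^ 2)) (at t)"
        using 3 by (auto intro!: derivative_eq_intros simp: power2_eq_square)
      have p: "((\<lambda>t. poly P (1 / t)) has_real_derivative poly (pderiv P) (1 / t) * (- (1 / t ^ 2))) (at t)"
        by (rule DERIV_chain2[OF poly_DERIV i])
      have e: "((\<lambda>t. exp (- 1 / t)) has_real_derivative exp (- 1 / t) * (1 / t ^ 2)) (at t)"
        using 3 by (auto intro!: derivative_eq_intros simp: power2_eq_square)
      show ?thesis
        by (rule DERIV_cong[OF DERIV_mult[OF DERIV_mult[OF DERIV_ident p] e]])
          (use 3 in \<open>simp add: flat_def flat_d_def divide_simps power2_eq_square algebra_simps\<close>)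
    qed
    moreover have "(flat P has_real_derivative D) (at t)
        = ((\<lambda>t. t * poly P (1 / t) * exp (- 1 / t)) has_real_derivative D) (at t)" for D
      by (intro DERIV_cong_ev refl eventually_mono[OF eventually_nhds_in_open[of "{0<..}"]])
        (use 3 in \<open>auto simp: flat_def\<close>)
    ultimately show ?thesis by simp
  next
    case 2
    \<comment> \<open>The leading \<open>t\<close> in \<open>flat\<close> cancels in the difference
      quotient at 0, leaving \<open>P(1/y) exp(-1/y)\<close> on the right and 0 on the left.\<close>
    have "((\<lambda>y. poly P (inverse y) * exp (- inverse y)) \<longlongrightarrow> 0) (at_right (0::real))"
      by (rule filterlim_compose[OF poly_exp_decay filterlim_inverse_at_top_right])
    then have R: "((\<lambda>y. flat P y / y) \<longlongrightarrow> 0) (at_right 0)"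
      by (rule Lim_transform_eventually) (auto simp: eventually_at_filter flat_def field_simps)
    have L: "((\<lambda>y. flat P y / y) \<longlongrightarrow> 0) (at_left 0)"
      by (rule Lim_transform_eventually[of "\<lambda>_. 0"]) (auto simp: eventually_at_filter flat_def)
    show ?thesis using R L 2
      by (simp add: has_field_derivative_iff flat_def filterlim_at_split)
  qed
qed

lemma Ck_flat: "Ck k \<phi> \<Longrightarrow> Ck k (\<lambda>x. flat P (\<phi> x))"
  by (rule Ck_compose[where S = "range flat"]) (auto intro: flat_has_derivative)

section \<open>Test functions: support, products, partial derivatives, integration by parts\<close>

lemma test_funI:
  assumes "C_inf \<phi>" "\<And>x. \<phi> x \<noteq> 0 \<Longrightarrow> x \<in> K" "compact K" "K \<subseteq> U"
  shows "test_fun U \<phi>"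
proof -
  have "closure {x. \<phi> x \<noteq> 0} \<subseteq> K"
    using assms(2,3) by (intro closure_minimal) (auto intro: compact_imp_closed)
  then show ?thesis
    using assms(1,3,4) compact_Int_closed[OF assms(3) closed_closure, of "{x. \<phi> x \<noteq> 0}"]
    by (auto simp: test_fun_def Int_absorb1)
qed

lemma test_fun_zero_outside: "test_fun U \<phi> \<Longrightarrow> x \<notin> U \<Longrightarrow> \<phi> x = 0"
  unfolding test_fun_def using closure_subset[of "{x. \<phi> x \<noteq> 0}"] by blast

lemma test_fun_UNIV: "test_fun U \<phi> \<Longrightarrow> test_fun UNIV \<phi>"
  by (simp add: test_fun_def)

lemma test_fun_Ck: "test_fun U \<phi> \<Longrightarrow> Ck k \<phi>"
  by (simp add: test_fun_def C_inf_def)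

lemma test_fun_continuous: "test_fun U \<phi> \<Longrightarrow> continuous_on A \<phi>"
  using test_fun_Ck[of U \<phi> 0] continuous_on_subset by auto

lemma test_fun_measurable: "test_fun U \<phi> \<Longrightarrow> \<phi> \<in> borel_measurable borel"
  by (intro borel_measurable_continuous_onI test_fun_continuous)

lemma test_fun_has_derivative:
  "test_fun U \<phi> \<Longrightarrow> (\<phi> has_derivative frechet_derivative \<phi> (at x)) (at x)"
  by (rule Ck_Suc_has_derivative[OF test_fun_Ck[of U \<phi> "Suc 0"]])

lemma test_fun_mult:
  assumes "C_inf f" "test_fun U \<phi>"
  shows "test_fun U (\<lambda>x. f x * \<phi> x)"
  using assms closure_subset[of "{x. \<phi> x \<noteq> 0}"]
  by (intro test_funI[where K = "closure {x. \<phi> x \<noteq> 0}"]) (auto simp: test_fun_def C_inf_def intro: Ck_mult)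

lemma test_fun_partial:
  assumes "test_fun U \<phi>" "i \<in> Basis"
  shows "test_fun U (\<lambda>x. frechet_derivative \<phi> (at x) i)"
proof (rule test_funI[where K = "closure {x. \<phi> x \<noteq> 0}"])
  show "C_inf (\<lambda>x. frechet_derivative \<phi> (at x) i)"
    unfolding C_inf_def using Ck_Suc_partial[OF test_fun_Ck[OF assms(1)] assms(2)] by blast
  fix x assume nz: "frechet_derivative \<phi> (at x) i \<noteq> 0"
  show "x \<in> closure {x. \<phi> x \<noteq> 0}"
  proof (rule ccontr)
    assume x: "x \<notin> closure {x. \<phi> x \<noteq> 0}"
    \<comment> \<open>Off its closed support \<open>\<phi>\<close> vanishes on an open
      neighbourhood, so the derivative there is 0.\<close>
    have "(\<phi> has_derivative (\<lambda>_. 0)) (at x)"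
    proof (rule has_derivative_transform_within_open[where f = "\<lambda>_. 0", where s = "- closure {x. \<phi> x \<noteq> 0}"])
      show "0 = \<phi> y" if "y \<in> - closure {x. \<phi> x \<noteq> 0}" for y
        using that closure_subset[of "{x. \<phi> x \<noteq> 0}"] by auto
    qed (use x in auto)
    from frechet_derivative_at[OF this] nz show False by metis
  qed
qed (use assms in \<open>auto simp: test_fun_def\<close>)

lemma test_fun_radius:
  assumes "test_fun U \<phi>"
  obtains R where "R > 0" "\<And>x. \<phi> x \<noteq> 0 \<longrightarrow> norm x < R"
proof -
  have "bounded (closure {x. \<phi> x \<noteq> 0})"
    using assms by (auto simp: test_fun_def compact_imp_bounded)
  then obtain R where "R > 0" "\<And>x. x \<in> closure {x. \<phi> x \<noteq> 0} \<Longrightarrow> norm x < R"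
    by (metis bounded_pos_less)
  then show ?thesis using that closure_subset[of "{x. \<phi> x \<noteq> 0}"] by blast
qed

lemma test_fun_bounded:
  assumes "test_fun U \<phi>"
  obtains B where "B > 0" "\<And>x. \<bar>\<phi> x\<bar> \<le> B"
proof -
  have "bounded (\<phi> ` closure {x. \<phi> x \<noteq> 0})"
    using assms test_fun_continuous[OF assms]
    by (intro compact_imp_bounded compact_continuous_image) (auto simp: test_fun_def)
  then obtain B where B: "B > 0" "\<And>x. x \<in> closure {x. \<phi> x \<noteq> 0} \<Longrightarrow> \<bar>\<phi> x\<bar> \<le> B"
    by (auto simp: bounded_pos)
  have "\<bar>\<phi> x\<bar> \<le> B" for x
    using B closure_subset[of "{x. \<phi> x \<noteq> 0}"] by (cases "\<phi> x = 0") auto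
  then show ?thesis using that B(1) by blast
qed

lemma test_fun_integrable_lborel:
  fixes \<phi> :: "'a::euclidean_space \<Rightarrow> real"
  assumes "test_fun U \<phi>"
  shows "integrable lborel \<phi>"
proof -
  obtain R where R: "R > 0" "\<And>x. \<phi> x \<noteq> 0 \<longrightarrow> norm x < R" using test_fun_radius[OF assms] by metis
  have "integrable lborel (\<lambda>x. indicator (cball 0 R) x *\<^sub>R \<phi> x)"
    by (intro borel_integrable_compact test_fun_continuous[OF assms]) auto
  moreover have "(\<lambda>x. indicator (cball 0 R) x *\<^sub>R \<phi> x) = \<phi>"
    using R(2) by (fastforce simp: indicator_def)
  ultimately show ?thesis by metis
qed

lemma test_fun_integrable: "test_fun U \<phi> \<Longrightarrow> integrable lebesgue \<phi>"
  by (simp add: integrable_completion test_fun_measurable test_fun_integrable_lborel)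

lemma frechet_derivative_eq_grad:
  assumes "(f has_derivative frechet_derivative f (at x)) (at x)"
  shows "frechet_derivative f (at x) v = grad f x \<bullet> v"
proof -
  have "frechet_derivative f (at x) v = frechet_derivative f (at x) (\<Sum>i\<in>Basis. (v \<bullet> i) *\<^sub>R i)"
    by (simp add: euclidean_representation)
  also have "\<dots> = (\<Sum>i\<in>Basis. (v \<bullet> i) * frechet_derivative f (at x) i)"
    using has_derivative_linear[OF assms] by (simp add: linear_sum linear_scale)
  also have "\<dots> = grad f x \<bullet> v"
    by (simp add: grad_def inner_sum_left inner_commute[of v] mult.commute)
  finally show ?thesis .
qed

lemma grad_inner_Basis: "i \<in> Basis \<Longrightarrow> grad f x \<bullet> i = frechet_derivative f (at x) i"
  by (simp add: grad_def inner_sum_left inner_Basis if_distrib cong: if_cong)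

lemma continuous_on_grad: "test_fun U \<phi> \<Longrightarrow> continuous_on A (grad \<phi>)"
  unfolding grad_def by (intro continuous_intros test_fun_continuous[OF test_fun_partial])

lemma grad_measurable: "test_fun U \<phi> \<Longrightarrow> grad \<phi> \<in> borel_measurable borel"
  by (intro borel_measurable_continuous_onI continuous_on_grad)

lemma test_fun_line_derivative:
  assumes "test_fun U \<phi>"
  shows "((\<lambda>t. \<phi> (x + t *\<^sub>R v)) has_real_derivative grad \<phi> (x + t *\<^sub>R v) \<bullet> v) (at t)"
proof -
  have "((\<lambda>t. \<phi> (x + t *\<^sub>R v)) has_derivative
      (\<lambda>h. frechet_derivative \<phi> (at (x + t *\<^sub>R v)) (h *\<^sub>R v))) (at t)"
    by (rule has_derivative_compose[OF _ test_fun_has_derivative[OF assms]])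
      (auto intro!: derivative_eq_intros)
  moreover have "(\<lambda>h. frechet_derivative \<phi> (at (x + t *\<^sub>R v)) (h *\<^sub>R v)) = (*) (grad \<phi> (x + t *\<^sub>R v) \<bullet> v)"
    by (simp add: fun_eq_iff frechet_derivative_eq_grad[OF test_fun_has_derivative[OF assms]])
  ultimately show ?thesis by (simp add: has_field_derivative_def)
qed

text \<open>By translation invariance the difference quotients integrate to zero.\<close>

lemma integral_partial_test_fun:
  fixes \<phi> :: "'a::euclidean_space \<Rightarrow> real"
  assumes \<phi>: "test_fun U \<phi>" and i: "i \<in> Basis"
  shows "(LINT x|lborel. frechet_derivative \<phi> (at x) i) = 0"
proof -
  obtain R where R: "R > 0" "\<And>x. \<phi> x \<noteq> 0 \<longrightarrow> norm x < R" using test_fun_radius[OF \<phi>] by metis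
  obtain L where L: "L > 0" "\<And>x. \<bar>frechet_derivative \<phi> (at x) i\<bar> \<le> L"
    using test_fun_bounded[OF test_fun_partial[OF \<phi> i]] by metis
  have [measurable]: "\<phi> \<in> borel_measurable borel" using test_fun_measurable[OF \<phi>] .
  have [measurable]: "(\<lambda>x. frechet_derivative \<phi> (at x) i) \<in> borel_measurable borel"
    using test_fun_measurable[OF test_fun_partial[OF \<phi> i]] .
  define h where "h m = 1 / real (Suc m)" for m
  have h: "0 < h m" "h m \<le> 1" for m by (auto simp: h_def divide_simps)
  have h0: "h \<longlonglongrightarrow> 0" unfolding h_def by (rule LIMSEQ_Suc[OF lim_1_over_n])
  define q where "q m x = (\<phi> (x + h m *\<^sub>R i) - \<phi> x) / h m" for m x
  have int: "integrable lborel (\<lambda>x. \<phi> (x + c))" "(LINT x|lborel. \<phi> (x + c)) = (LINT x|lborel. \<phi> x)" for c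
  proof -
    have d: "lborel = distr lborel borel (\<lambda>x. c + x)" using lborel_distr_plus[of c] by simp
    show "integrable lborel (\<lambda>x. \<phi> (x + c))"
      using test_fun_integrable_lborel[OF \<phi>]
      by (subst (asm) d, subst (asm) integrable_distr_eq) (auto simp: add.commute)
    show "(LINT x|lborel. \<phi> (x + c)) = (LINT x|lborel. \<phi> x)"
      by (subst (2) d, subst integral_distr) (auto simp: add.commute)
  qed
  have q0: "(LINT x|lborel. q m x) = 0" for m
    unfolding q_def using int test_fun_integrable_lborel[OF \<phi>] by simp
  have "(\<lambda>m. LINT x|lborel. q m x) \<longlonglongrightarrow> (LINT x|lborel. frechet_derivative \<phi> (at x) i)"
  proof (rule integral_dominated_convergence[where w = "\<lambda>x. L * indicator (cball 0 (R + 1)) x"])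
    show "integrable lborel (\<lambda>x::'a. L * indicator (cball 0 (R + 1)) x)"
      by (intro integrable_mult_right integrable_real_indicator emeasure_lborel_cball_finite) auto
    show "AE x in lborel. (\<lambda>m. q m x) \<longlonglongrightarrow> frechet_derivative \<phi> (at x) i"
    proof (intro AE_I2)
      fix x
      have "((\<lambda>t. \<phi> (x + t *\<^sub>R i)) has_real_derivative grad \<phi> x \<bullet> i) (at 0)"
        using test_fun_line_derivative[OF \<phi>, of x i 0] by simp
      then have "(\<lambda>t. (\<phi> (x + t *\<^sub>R i) - \<phi> x) / t) \<midarrow>0\<rightarrow> grad \<phi> x \<bullet> i"
        by (simp add: has_field_derivative_iff)
      moreover have "filterlim h (at 0) sequentially"
        using h0 h(1) by (auto simp: filterlim_at less_imp_neq[symmetric] intro!: always_eventually)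
      ultimately have "(\<lambda>m. (\<phi> (x + h m *\<^sub>R i) - \<phi> x) / h m) \<longlonglongrightarrow> grad \<phi> x \<bullet> i"
        by (rule filterlim_compose)
      then show "(\<lambda>m. q m x) \<longlonglongrightarrow> frechet_derivative \<phi> (at x) i"
        by (simp add: q_def grad_inner_Basis[OF i])
    qed
    \<comment> \<open>By the mean value theorem each quotient is a value of the partial derivative.
      Since \<open>h m \<le> 1\<close> and \<open>i\<close> is a unit vector, it vanishes outside
      the ball of radius \<open>R + 1\<close>, which gives a majorant independent of
      \<open>m\<close>.\<close>
    show "AE x in lborel. norm (q m x) \<le> L * indicator (cball 0 (R + 1)) x" for m
    proof (intro AE_I2)
      fix x
      obtain z where z: "0 < z" "z < h m"
        "\<phi> (x + h m *\<^sub>R i) - \<phi> (x + 0 *\<^sub>R i) = (h m - 0) * (grad \<phi> (x + z *\<^sub>R i) \<bullet> i)"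
        using MVT2[OF h(1)[of m] test_fun_line_derivative[OF \<phi>, of x i]] by blast
      have "q m x = frechet_derivative \<phi> (at (x + z *\<^sub>R i)) i"
        using z h(1)[of m] by (simp add: q_def grad_inner_Basis[OF i])
      then have b: "\<bar>q m x\<bar> \<le> L" using L by simp
      have "q m x = 0" if "norm x > R + 1"
      proof -
        have "norm (x + h m *\<^sub>R i) \<ge> norm x - norm (h m *\<^sub>R i)" by (metis norm_diff_ineq)
        then have "norm (x + h m *\<^sub>R i) \<ge> R" using that h[of m] i by simp
        then show ?thesis using R(2)[of "x + h m *\<^sub>R i"] R(2)[of x] that by (auto simp: q_def)
      qed
      then show "norm (q m x) \<le> L * indicator (cball 0 (R + 1)) x"
        using b by (auto simp: indicator_def not_le)
    qed
  qed (auto simp: q_def)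
  then show ?thesis using q0 by (simp add: LIMSEQ_const_iff)
qed

text \<open>Integration by parts: \<open>\<phi> * \<psi>\<close> is a test function, so the integral
  of its partial derivative is 0, and the product rule splits that integral.\<close>

lemma test_fun_has_weak_gradient:
  fixes \<phi> :: "'a::euclidean_space \<Rightarrow> real"
  assumes \<phi>: "test_fun U \<phi>"
  shows "has_weak_gradient \<phi> (grad \<phi>)"
  unfolding has_weak_gradient_def
proof (intro allI impI ballI conjI)
  fix \<psi> :: "'a \<Rightarrow> real" and i :: 'a assume \<psi>: "test_fun UNIV \<psi>" and i: "i \<in> Basis"
  have C: "C_inf \<phi>" using \<phi> by (simp add: test_fun_def)
  have "C_inf (\<lambda>x. frechet_derivative \<phi> (at x) i)"
    using test_fun_partial[OF \<phi> i] by (simp add: test_fun_def)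
  note t1 = test_fun_mult[OF C test_fun_partial[OF \<psi> i]] and t2 = test_fun_mult[OF this \<psi>]
  show "integrable lebesgue (\<lambda>x. \<phi> x * frechet_derivative \<psi> (at x) i)"
    "integrable lebesgue (\<lambda>x. grad \<phi> x \<bullet> i * \<psi> x)"
    using test_fun_integrable[OF t1] test_fun_integrable[OF t2] by (simp_all add: grad_inner_Basis[OF i])
  have "frechet_derivative (\<lambda>x. \<phi> x * \<psi> x) (at x) = (\<lambda>h. \<phi> x * frechet_derivative \<psi> (at x) h
           + frechet_derivative \<phi> (at x) h * \<psi> x)" for x
    using frechet_derivative_at[OF has_derivative_mult[OF test_fun_has_derivative[OF \<phi>]
          test_fun_has_derivative[OF \<psi>], of x]] by simp
  then have "(LINT x|lborel. \<phi> x * frechet_derivative \<psi> (at x) i + frechet_derivative \<phi> (at x) i * \<psi> x) = 0"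
    using integral_partial_test_fun[OF test_fun_mult[OF C \<psi>] i] by simp
  then show "(LINT x|lebesgue. \<phi> x * frechet_derivative \<psi> (at x) i)
      = - (LINT x|lebesgue. grad \<phi> x \<bullet> i * \<psi> x)"
    using test_fun_integrable_lborel[OF t1] test_fun_integrable_lborel[OF t2]
      test_fun_measurable[OF t1] test_fun_measurable[OF t2]
    by (simp add: integral_completion grad_inner_Basis[OF i])
qed

section \<open>Weak gradients\<close>

text \<open>For Tonelli: \<open>gagliardo2\<close> integrates over the product of two completed
  measures, and exchanging iterated integrals there rests on sigma-finiteness of
  \<open>lebesgue\<close> itself.\<close>

lemma sigma_finite_lebesgue: "sigma_finite_measure (lebesgue :: 'a::euclidean_space measure)"
proof
  let ?A = "range (\<lambda>n::nat. box (- (real n *\<^sub>R One)) (real n *\<^sub>R One) :: 'a set)"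
  show "\<exists>A. countable A \<and> A \<subseteq> sets (lebesgue :: 'a measure) \<and> \<Union> A = space lebesgue \<and> (\<forall>a\<in>A. emeasure lebesgue a \<noteq> \<infinity>)"
    by (rule exI[of _ ?A]) (auto simp: UN_box_eq_UNIV)
qed

interpretation lebesgue: sigma_finite_measure "lebesgue :: 'a::euclidean_space measure"
  by (rule sigma_finite_lebesgue)

interpretation lebesgue_pair: pair_sigma_finite "lebesgue :: 'a::euclidean_space measure" "lebesgue :: 'b::euclidean_space measure" ..

section \<open>Smooth approximation of boxes and the fundamental lemma of the calculus of
  variations\<close>

text \<open>The polynomial \<open>[:0, 1:]\<close> turns \<open>flat\<close> into
  \<open>exp (-1/t)\<close> for \<open>t > 0\<close>. As \<open>m\<close> grows the walls become
  steep and the bumps tend to the indicator of the open box; with \<open>m = 1\<close> the bump is a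
  fixed cutoff, strictly positive inside the box, by which one may divide.\<close>

definition box_bump :: "'a::euclidean_space \<Rightarrow> 'a \<Rightarrow> real \<Rightarrow> 'a \<Rightarrow> real" where
  "box_bump a b m x = (\<Prod>i\<in>Basis. flat [:0, 1:] (m * (x \<bullet> i - a \<bullet> i)) * flat [:0, 1:] (m * (b \<bullet> i - x \<bullet> i)))"

lemma flat_X: "flat [:0, 1:] t = (if t > 0 then exp (- 1 / t) else 0)"
  by (simp add: flat_def)

lemma test_fun_box_bump: "test_fun UNIV (box_bump a b m)" if "m > 0"
proof (rule test_funI[where K = "cbox a b"])
  have "Ck k (\<lambda>x. m * (x \<bullet> i + - (a \<bullet> i)))" "Ck k (\<lambda>x. m * (b \<bullet> i + - 1 * (x \<bullet> i)))" for k i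
    by (intro Ck_mult Ck_add Ck_const Ck_inner)+
  then have "Ck k (\<lambda>x. flat [:0, 1:] (m * (x \<bullet> i - a \<bullet> i)))" "Ck k (\<lambda>x. flat [:0, 1:] (m * (b \<bullet> i - x \<bullet> i)))" for k i
    by (auto intro!: Ck_flat)
  then show "C_inf (box_bump a b m)"
    unfolding C_inf_def box_bump_def by (intro allI Ck_prod[OF finite_Basis] Ck_mult) simp_all
  show "x \<in> cbox a b" if "box_bump a b m x \<noteq> 0" for x
    using that \<open>m > 0\<close> by (force simp: box_bump_def mem_box flat_X zero_less_mult_iff split: if_splits)
qed auto

lemma box_bump_nonneg: "0 \<le> box_bump a b m x"
  unfolding box_bump_def by (intro prod_nonneg) (auto simp: flat_X)

lemma box_bump_le_1: "box_bump a b m x \<le> 1"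
  unfolding box_bump_def by (intro prod_le_1) (auto simp: flat_X mult_le_one)

lemma box_bump_pos: "m > 0 \<Longrightarrow> x \<in> box a b \<Longrightarrow> 0 < box_bump a b m x"
  unfolding box_bump_def by (intro prod_pos) (auto simp: flat_X mem_box)

lemma flat_X_scaled_tendsto: "(\<lambda>m. flat [:0, 1:] (real (Suc m) * t)) \<longlonglongrightarrow> (if t > 0 then 1 else 0)"
proof (cases "t > 0")
  case True
  have "(\<lambda>m. exp (- (1 / t) * (1 / real (Suc m)))) \<longlonglongrightarrow> exp (- (1 / t) * 0)"
    by (intro tendsto_intros LIMSEQ_Suc[OF lim_1_over_n])
  then show ?thesis using True by (simp add: flat_X mult.commute)
next
  case False
  then show ?thesis by (simp add: flat_X zero_less_mult_iff)
qed

lemma box_bump_tendsto: "(\<lambda>m. box_bump a b (real (Suc m)) x) \<longlonglongrightarrow> indicator (box a b) x"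
proof -
  have "(\<lambda>m. box_bump a b (real (Suc m)) x) \<longlonglongrightarrow>
    (\<Prod>i\<in>Basis. (if x \<bullet> i - a \<bullet> i > 0 then 1 else 0) * (if b \<bullet> i - x \<bullet> i > 0 then 1 else 0))"
    unfolding box_bump_def by (intro tendsto_prod tendsto_mult flat_X_scaled_tendsto)
  also have "(\<Prod>i\<in>Basis. (if x \<bullet> i - a \<bullet> i > 0 then 1 else 0) * (if b \<bullet> i - x \<bullet> i > 0 then 1 else (0::real)))
      = indicator (box a b) x"
    by (auto simp: indicator_def mem_box intro!: prod.neutral)
  finally show ?thesis .
qed

lemma eventually_in_box:
  "\<forall>\<^sub>F n in sequentially. (x::'a::euclidean_space) \<in> box (- (real n *\<^sub>R One)) (real n *\<^sub>R One)"
proof -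
  obtain n where n: "x \<in> box (- (real n *\<^sub>R One)) (real n *\<^sub>R One)"
    using UN_box_eq_UNIV[where 'a='a] by blast
  have "x \<in> box (- (real m *\<^sub>R One)) (real m *\<^sub>R One)" if "m \<ge> n" for m
    unfolding mem_box
  proof
    fix i :: 'a assume i: "i \<in> Basis"
    have "- real n < x \<bullet> i \<and> x \<bullet> i < real n" using n i by (simp add: mem_box)
    then show "- (real m *\<^sub>R One) \<bullet> i < x \<bullet> i \<and> x \<bullet> i < real m *\<^sub>R One \<bullet> i"
      using i of_nat_mono[OF that, where 'a = real] by auto
  qed
  then show ?thesis unfolding eventually_sequentially by blast
qed

text \<open>Bumps carry the hypothesis over to indicators of boxes, and a Dynkin argument carries it
  to all Borel sets; a density whose integral over every Borel set is zero vanishes almost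
  everywhere.\<close>

lemma integrable_AE_zeroI:
  fixes f :: "'a::euclidean_space \<Rightarrow> real"
  assumes f: "integrable lebesgue f"
    and z: "\<And>\<phi>. test_fun UNIV \<phi> \<Longrightarrow> (LINT x|lebesgue. f x * \<phi> x) = 0"
  shows "AE x in lebesgue. f x = 0"
proof -
  have fm: "f \<in> borel_measurable lebesgue" using f by auto
  \<comment> \<open>A Borel representative is taken because the boxes generate the Borel sets, not
    their completion.\<close>
  obtain g where g[measurable]: "g \<in> borel_measurable lborel" and fg: "AE x in lborel. f x = g x"
    using completion_ex_borel_measurable_real[OF fm] by blast
  have fg': "AE x in lebesgue. f x = g x" using fg by (rule AE_completion)
  have [measurable]: "g \<in> borel_measurable lebesgue" using g by (rule measurable_completion)
  have gi: "integrable lborel g"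
    using f integrable_cong_AE[OF fm _ fg'] by (simp add: integrable_completion[OF g])
  have zg: "(LINT x|lborel. g x * \<phi> x) = 0" if "test_fun UNIV \<phi>" for \<phi>
  proof -
    have [measurable]: "\<phi> \<in> borel_measurable borel" by (rule test_fun_measurable[OF that])
    have "(LINT x|lborel. g x * \<phi> x) = (LINT x|lebesgue. g x * \<phi> x)"
      by (rule integral_completion[symmetric]) simp
    also have "\<dots> = (LINT x|lebesgue. f x * \<phi> x)"
    proof (rule integral_cong_AE)
      have [measurable]: "\<phi> \<in> borel_measurable lebesgue" by (rule measurable_completion) simp
      note fm [measurable]
      show "(\<lambda>x. g x * \<phi> x) \<in> borel_measurable lebesgue" "(\<lambda>x. f x * \<phi> x) \<in> borel_measurable lebesgue"
        by measurable
      show "AE x in lebesgue. g x * \<phi> x = f x * \<phi> x" using fg' by eventually_elim simp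
    qed
    finally show ?thesis using z[OF that] by simp
  qed
  have boxes: "(LINT x|lborel. g x * indicator (box a b) x) = 0" for a b
  proof -
    have "(\<lambda>m. LINT x|lborel. g x * box_bump a b (real (Suc m)) x) \<longlonglongrightarrow> (LINT x|lborel. g x * indicator (box a b) x)"
    proof (rule integral_dominated_convergence[where w = "\<lambda>x. norm (g x)"])
      show "(\<lambda>x. g x * box_bump a b (real (Suc m)) x) \<in> borel_measurable lborel" for m
        using test_fun_measurable[OF test_fun_box_bump[of "real (Suc m)" a b]] by simp
      show "AE x in lborel. (\<lambda>m. g x * box_bump a b (real (Suc m)) x) \<longlonglongrightarrow> g x * indicator (box a b) x"
        by (intro AE_I2 tendsto_intros box_bump_tendsto)
      show "AE x in lborel. norm (g x * box_bump a b (real (Suc m)) x) \<le> norm (g x)" for m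
        by (intro AE_I2) (simp add: abs_mult abs_of_nonneg[OF box_bump_nonneg] box_bump_le_1 mult_left_le
            del: of_nat_Suc)
    qed (use gi in auto)
    moreover have "(LINT x|lborel. g x * box_bump a b (real (Suc m)) x) = 0" for m
      by (rule zg[OF test_fun_box_bump]) simp
    ultimately show ?thesis by (simp add: LIMSEQ_const_iff)
  qed
  have ind: "integrable lborel (\<lambda>x. g x * indicator A x)" if "A \<in> sets borel" for A
    using integrable_mult_indicator[OF _ gi, of A] that by (simp add: mult.commute)
  let ?B = "\<lambda>n::nat. box (- (real n *\<^sub>R One)) (real n *\<^sub>R One) :: 'a set"
  \<comment> \<open>The complement step of the Dynkin argument subtracts from the integral over the
    whole space, so that integral must be known to vanish; it is the limit over growing
    boxes.\<close>
  have whole: "(LINT x|lborel. g x) = 0"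
  proof -
    have "(\<lambda>n. LINT x|lborel. g x * indicator (?B n) x) \<longlonglongrightarrow> (LINT x|lborel. g x)"
    proof (rule integral_dominated_convergence[where w = "\<lambda>x. norm (g x)"])
      show "AE x in lborel. (\<lambda>n. g x * indicator (?B n) x) \<longlonglongrightarrow> g x"
      proof (intro AE_I2 tendsto_eventually)
        fix x :: 'a
        show "\<forall>\<^sub>F n in sequentially. g x * indicator (?B n) x = g x"
          using eventually_in_box[of x] by eventually_elim simp
      qed
    qed (use gi in \<open>auto simp: indicator_def\<close>)
    then show ?thesis using boxes by (simp add: LIMSEQ_const_iff)
  qed
  have "(LINT x|lborel. g x * indicator A x) = 0" if "A \<in> sigma_sets UNIV (range (\<lambda>(a, b). box a b :: 'a set))" for A
  proof (rule sigma_sets_induct_disjoint[OF _ _ that])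
    show "Int_stable (range (\<lambda>(a, b). box a b :: 'a set))"
      by (auto simp: Int_stable_def box_Int_box)
    fix A assume "A \<in> sigma_sets UNIV (range (\<lambda>(a, b). box a b :: 'a set))"
      and A0: "(LINT x|lborel. g x * indicator A x) = 0"
    then have A: "A \<in> sets borel" by (simp add: borel_eq_box)
    have "(LINT x|lborel. g x * indicator (UNIV - A) x) = (LINT x|lborel. g x - g x * indicator A x)"
      by (intro Bochner_Integration.integral_cong) (auto simp: indicator_def)
    also have "\<dots> = 0" using gi ind[OF A] whole A0 by simp
    finally show "(LINT x|lborel. g x * indicator (UNIV - A) x) = 0" .
  next
    fix A :: "nat \<Rightarrow> 'a set"
    assume d: "disjoint_family A" and r: "range A \<subseteq> sigma_sets UNIV (range (\<lambda>(a, b). box a b :: 'a set))"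
      and A0: "\<And>i. (LINT x|lborel. g x * indicator (A i) x) = 0"
    have A: "A i \<in> sets borel" for i using r by (auto simp: borel_eq_box)
    have "set_lebesgue_integral lborel (\<Union>i. A i) g = (\<Sum>i. set_lebesgue_integral lborel (A i) g)"
      using A d ind[of "\<Union>i. A i"]
      by (intro lebesgue_integral_countable_add)
        (auto simp: disjoint_family_on_def set_integrable_def mult.commute)
    then show "(LINT x|lborel. g x * indicator (\<Union>i. A i) x) = 0"
      using A0 by (simp add: set_lebesgue_integral_def mult.commute)
  qed (use boxes in auto)
  then have "AE x in lborel. g x = 0"
    by (intro sigma_finite_measure.density_zero[OF sigma_finite_lborel gi]) (simp add: borel_eq_box set_lebesgue_integral_def mult.commute)
  then show ?thesis using fg' AE_completion by force
qed

text \<open>Localisation: \<open>H\<close> times a bump is integrable and inherits the hypothesis,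
  because a bump times a test function is a test function. The bumps are positive on boxes that
  exhaust the space.\<close>

lemma AE_zeroI_test_fun:
  fixes H :: "'a::euclidean_space \<Rightarrow> real"
  assumes "\<And>\<phi>. test_fun UNIV \<phi> \<Longrightarrow> integrable lebesgue (\<lambda>x. H x * \<phi> x)"
    and "\<And>\<phi>. test_fun UNIV \<phi> \<Longrightarrow> (LINT x|lebesgue. H x * \<phi> x) = 0"
  shows "AE x in lebesgue. H x = 0"
proof -
  let ?\<theta> = "\<lambda>n::nat. box_bump (- (real n *\<^sub>R One)) (real n *\<^sub>R One) 1 :: 'a \<Rightarrow> real"
  have t: "test_fun UNIV (?\<theta> n)" for n by (rule test_fun_box_bump) simp
  have "AE x in lebesgue. H x * ?\<theta> n x = 0" for n
  proof (rule integrable_AE_zeroI)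
    show "integrable lebesgue (\<lambda>x. H x * ?\<theta> n x)" using assms(1)[OF t] .
    fix \<phi> :: "'a \<Rightarrow> real" assume "test_fun UNIV \<phi>"
    then have "test_fun UNIV (\<lambda>x. ?\<theta> n x * \<phi> x)"
      using t[of n] by (intro test_fun_mult) (auto simp: test_fun_def)
    from assms(2)[OF this] show "(LINT x|lebesgue. H x * ?\<theta> n x * \<phi> x) = 0" by (simp add: mult.assoc)
  qed
  then have "AE x in lebesgue. \<forall>n. H x * ?\<theta> n x = 0" by (simp only: AE_all_countable simp_thms)
  then show ?thesis
  proof eventually_elim
    case (elim x)
    obtain n where "x \<in> box (- (real n *\<^sub>R One)) (real n *\<^sub>R One)"
      using eventually_happens'[OF _ eventually_in_box[of x]] by auto
    then have "?\<theta> n x > 0" by (intro box_bump_pos) simp_all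
    with elim show ?case by (metis mult_eq_0_iff order_less_irrefl)
  qed
qed

text \<open>The definition of \<open>has_weak_gradient\<close> speaks of the gradient only through
  its products with test functions. Measurability is recovered by dividing \<open>H\<close> times a
  bump by that bump on the box where it is positive, and letting the boxes grow.\<close>

lemma measurable_test_funI:
  fixes H :: "'a::euclidean_space \<Rightarrow> real"
  assumes "\<And>\<phi>. test_fun UNIV \<phi> \<Longrightarrow> (\<lambda>x. H x * \<phi> x) \<in> borel_measurable lebesgue"
  shows "H \<in> borel_measurable lebesgue"
proof -
  let ?B = "\<lambda>n::nat. box (- (real n *\<^sub>R One)) (real n *\<^sub>R One) :: 'a set"
  let ?\<theta> = "\<lambda>n::nat. box_bump (- (real n *\<^sub>R One)) (real n *\<^sub>R One) 1 :: 'a \<Rightarrow> real"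
  have t: "test_fun UNIV (?\<theta> n)" for n by (rule test_fun_box_bump) simp
  show ?thesis
  proof (rule borel_measurable_LIMSEQ_real)
    show "(\<lambda>x. indicator (?B n) x * ((H x * ?\<theta> n x) / ?\<theta> n x)) \<in> borel_measurable lebesgue" for n
    proof -
      have [measurable]: "?\<theta> n \<in> borel_measurable lebesgue"
        by (rule measurable_completion) (use test_fun_measurable[OF t] in simp)
      have "(\<lambda>x. (H x * ?\<theta> n x) / ?\<theta> n x) \<in> borel_measurable lebesgue"
        by (intro borel_measurable_divide assms[OF t]) simp
      then show ?thesis by (intro borel_measurable_times borel_measurable_indicator) simp_all
    qed
    show "(\<lambda>n. indicator (?B n) x * ((H x * ?\<theta> n x) / ?\<theta> n x)) \<longlonglongrightarrow> H x" for x
    proof (rule tendsto_eventually)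
      show "\<forall>\<^sub>F n in sequentially. indicator (?B n) x * ((H x * ?\<theta> n x) / ?\<theta> n x) = H x"
        using eventually_in_box[of x]
      proof eventually_elim
        case (elim n)
        then show ?case using box_bump_pos[of 1 x, OF _ elim] by simp
      qed
    qed
  qed
qed

section \<open>Measurability and uniqueness of weak gradients\<close>

lemma has_weak_gradientD:
  assumes "has_weak_gradient u G" "test_fun UNIV \<phi>" "i \<in> Basis"
  shows "integrable lebesgue (\<lambda>x. u x * frechet_derivative \<phi> (at x) i)"
    and "integrable lebesgue (\<lambda>x. (G x \<bullet> i) * \<phi> x)"
    and "(LINT x|lebesgue. u x * frechet_derivative \<phi> (at x) i) = - (LINT x|lebesgue. (G x \<bullet> i) * \<phi> x)"
  using assms unfolding has_weak_gradient_def by blast+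

lemma has_weak_gradient_measurable:
  assumes "has_weak_gradient u G"
  shows "G \<in> borel_measurable lebesgue"
proof -
  have "(\<lambda>x. G x \<bullet> i) \<in> borel_measurable lebesgue" if "i \<in> Basis" for i
    by (rule measurable_test_funI, rule borel_measurable_integrable, rule has_weak_gradientD(2)[OF assms _ that])
  then show ?thesis by (subst borel_measurable_euclidean_space) blast
qed

lemma has_weak_gradient_unique:
  assumes 1: "has_weak_gradient u G" and 2: "has_weak_gradient u H"
  shows "AE x in lebesgue. G x = H x"
proof -
  have "AE x in lebesgue. G x \<bullet> i - H x \<bullet> i = 0" if i: "i \<in> Basis" for i
  proof (rule AE_zeroI_test_fun)
    fix \<phi> :: "'a \<Rightarrow> real" assume \<phi>: "test_fun UNIV \<phi>"
    note D = has_weak_gradientD[OF 1 \<phi> i] has_weak_gradientD[OF 2 \<phi> i]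
    show "integrable lebesgue (\<lambda>x. (G x \<bullet> i - H x \<bullet> i) * \<phi> x)"
      using Bochner_Integration.integrable_diff[OF D(2,5)] by (simp add: left_diff_distrib)
    show "(LINT x|lebesgue. (G x \<bullet> i - H x \<bullet> i) * \<phi> x) = 0"
      using Bochner_Integration.integral_diff[OF D(2,5)] D(3,6) by (simp add: left_diff_distrib)
  qed
  then have "AE x in lebesgue. \<forall>i\<in>Basis. G x \<bullet> i - H x \<bullet> i = 0"
    by (intro AE_finite_allI) auto
  then show ?thesis by eventually_elim (auto intro: euclidean_eqI)
qed

text \<open>\<open>wgrad\<close> is an arbitrary choice; this identification is what allows a
  computed gradient to be inserted into the equation.\<close>

lemma wgrad_AE_eq:
  assumes "has_weak_gradient u G"
  shows "AE x in lebesgue. wgrad u x = G x"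
  using has_weak_gradient_unique[OF _ assms] someI[of "has_weak_gradient u", OF assms]
  by (simp add: wgrad_def)

section \<open>Riesz potentials and the Sobolev inequality\<close>

lemma measurable_ident_lebesgue: "(\<lambda>x. x) \<in> borel_measurable (lebesgue :: 'a::euclidean_space measure)"
  by (rule measurable_completion) simp

lemma measurable_fst_lebesgue [measurable]:
  "fst \<in> borel_measurable (lebesgue \<Otimes>\<^sub>M (lebesgue :: 'b::euclidean_space measure) :: ('a::euclidean_space \<times> 'b) measure)"
  by (rule measurable_compose[OF measurable_fst measurable_ident_lebesgue])

lemma measurable_snd_lebesgue [measurable]:
  "snd \<in> borel_measurable ((lebesgue :: 'a::euclidean_space measure) \<Otimes>\<^sub>M lebesgue :: ('a \<times> 'b::euclidean_space) measure)"
  by (rule measurable_compose[OF measurable_snd measurable_ident_lebesgue])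

section \<open>Kernel integrals over balls and their complements, and potentials of bounded
  functions\<close>

lemma emeasure_lebesgue_ball:
  "r \<ge> 0 \<Longrightarrow> emeasure lebesgue (ball (c::'a::euclidean_space) r) = ennreal (unit_ball_vol DIM('a) * r ^ DIM('a))"
  using emeasure_ball[of r c] by simp

text \<open>One geometric series serves both kernel integrals: \<open>\<rho> = 1/2\<close> shrinks
  the balls towards \<open>x\<close> when \<open>b < n\<close>, and \<open>\<rho> = 2\<close> lets
  them grow when \<open>b > n\<close>. The ball of radius \<open>2 R \<rho>^j\<close> has volume of
  order \<open>(R \<rho>^j)^n\<close>, so the terms have ratio
  \<open>\<rho>^(n-b) < 1\<close>.\<close>

lemma nn_integral_dyadic_balls:
  fixes \<rho> b :: real
  assumes \<rho>: "\<rho> > 0" "\<rho> powr (real DIM('a) - b) < 1"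
  shows "\<exists>C>0. \<forall>(x::'a::euclidean_space) R f. R > 0 \<longrightarrow>
     (\<forall>y. f y \<le> (\<Sum>j. ennreal ((R * \<rho> ^ j) powr (- b)) * indicator (ball x (2 * (R * \<rho> ^ j))) y)) \<longrightarrow>
     (\<integral>\<^sup>+y. f y \<partial>lebesgue) \<le> ennreal (C * R powr (real DIM('a) - b))"
proof -
  let ?n = "DIM('a)" and ?V = "unit_ball_vol DIM('a)"
  let ?q = "\<rho> powr (real DIM('a) - b)"
  define C where "C = ?V * 2 ^ ?n / (1 - ?q)"
  have C: "C > 0" using \<rho> by (simp add: C_def)
  have bound: "(\<integral>\<^sup>+y. f y \<partial>lebesgue) \<le> ennreal (C * R powr (real ?n - b))"
    if R: "R > 0" and f: "\<And>y. f y \<le> (\<Sum>j. ennreal ((R * \<rho> ^ j) powr (- b)) * indicator (ball x (2 * (R * \<rho> ^ j))) y)"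
    for x :: 'a and R f
  proof -
    have "(\<integral>\<^sup>+y. f y \<partial>lebesgue)
       \<le> (\<integral>\<^sup>+y. (\<Sum>j. ennreal ((R * \<rho> ^ j) powr (- b)) * indicator (ball x (2 * (R * \<rho> ^ j))) y) \<partial>lebesgue)"
      by (rule nn_integral_mono) (rule f)
    also have "\<dots> = (\<Sum>j. \<integral>\<^sup>+y. ennreal ((R * \<rho> ^ j) powr (- b)) * indicator (ball x (2 * (R * \<rho> ^ j))) y \<partial>lebesgue)"
      by (rule nn_integral_suminf, rule borel_measurable_times_ennreal, rule borel_measurable_const,
          rule borel_measurable_indicator) simp
    also have "\<dots> = (\<Sum>j. ennreal ((?V * 2 ^ ?n * R powr (real ?n - b)) * ?q ^ j))"
    proof (intro suminf_cong)
      fix j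
      have "(\<integral>\<^sup>+y. ennreal ((R * \<rho> ^ j) powr (- b)) * indicator (ball x (2 * (R * \<rho> ^ j))) y \<partial>lebesgue)
         = ennreal ((R * \<rho> ^ j) powr (- b)) * emeasure lebesgue (ball x (2 * (R * \<rho> ^ j)))"
        by (subst nn_integral_cmult_indicator) simp_all
      also have "\<dots> = ennreal ((R * \<rho> ^ j) powr (- b) * (?V * (2 * (R * \<rho> ^ j)) ^ ?n))"
        using R \<rho> by (subst emeasure_lebesgue_ball) (auto simp: ennreal_mult')
      also have "(R * \<rho> ^ j) powr (- b) * (?V * (2 * (R * \<rho> ^ j)) ^ ?n) = ?V * 2 ^ ?n * ((R * \<rho> ^ j) powr (- b) * (R * \<rho> ^ j) ^ ?n)"
        by (simp add: power_mult_distrib)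
      also have "(R * \<rho> ^ j) powr (- b) * (R * \<rho> ^ j) ^ ?n = (R * \<rho> ^ j) powr (real ?n - b)"
        using R \<rho> by (simp add: powr_realpow[symmetric] powr_add[symmetric])
      also have "\<dots> = R powr (real ?n - b) * ?q ^ j"
        using R \<rho> by (simp add: powr_mult powr_realpow[symmetric] powr_powr mult.commute)
      finally show "(\<integral>\<^sup>+y. ennreal ((R * \<rho> ^ j) powr (- b)) * indicator (ball x (2 * (R * \<rho> ^ j))) y \<partial>lebesgue)
        = ennreal ((?V * 2 ^ ?n * R powr (real ?n - b)) * ?q ^ j)" by (simp add: mult.assoc)
    qed
    also have "\<dots> = ennreal ((?V * 2 ^ ?n * R powr (real ?n - b)) * (1 / (1 - ?q)))"
      using \<rho> by (intro suminf_ennreal_eq sums_mult geometric_sums) auto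
    finally show ?thesis by (simp add: C_def field_simps)
  qed
  show ?thesis using C bound by blast
qed

lemma ennreal_term_le_suminf: "(f i :: ennreal) \<le> (\<Sum>j. f j)"
  using sum_le_suminf[of f "{i}"] by simp

lemma nn_integral_kernel_ball:
  fixes \<mu> :: real
  assumes "0 < \<mu>" "\<mu> < real DIM('a)"
  shows "\<exists>C>0. \<forall>(x::'a::euclidean_space) R. R > 0 \<longrightarrow>
     (\<integral>\<^sup>+y. ennreal (1 / norm (x - y) powr \<mu>) * indicator (ball x R) y \<partial>lebesgue) \<le> ennreal (C * R powr (real DIM('a) - \<mu>))"
proof -
  have "(1 / 2) powr (real DIM('a) - \<mu>) < 1"
    using assms gr_one_powr[of 2 "real DIM('a) - \<mu>"] by (simp add: powr_divide)
  then obtain C where C: "C > 0" and int: "\<forall>(x::'a) R f. R > 0 \<longrightarrow>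
     (\<forall>y. f y \<le> (\<Sum>j. ennreal ((R * (1 / 2) ^ j) powr (- \<mu>)) * indicator (ball x (2 * (R * (1 / 2) ^ j))) y)) \<longrightarrow>
     (\<integral>\<^sup>+y. f y \<partial>lebesgue) \<le> ennreal (C * R powr (real DIM('a) - \<mu>))"
    using nn_integral_dyadic_balls[of "1/2" \<mu>, where 'a = 'a] by auto
  have "(\<integral>\<^sup>+y. ennreal (1 / norm (x - y) powr \<mu>) * indicator (ball x R) y \<partial>lebesgue)
      \<le> ennreal (C * (R / 2) powr (real DIM('a) - \<mu>))" if R: "R > 0" for x :: 'a and R
  proof (rule int[rule_format])
    fix y
    show "ennreal (1 / norm (x - y) powr \<mu>) * indicator (ball x R) y
      \<le> (\<Sum>j. ennreal ((R / 2 * (1 / 2) ^ j) powr (- \<mu>)) * indicator (ball x (2 * (R / 2 * (1 / 2) ^ j))) y)"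
    proof (cases "y \<in> ball x R \<and> y \<noteq> x")
      case True
      define d where "d = norm (x - y)"
      have d: "0 < d" "d < R" using True by (auto simp: d_def dist_norm)
      have "\<exists>j. R / 2 * (1 / 2) ^ j \<le> d"
      proof -
        obtain j where "(1 / 2) ^ j < d / R" using real_arch_pow_inv[of "d / R" "1/2"] d R by auto
        then have "R * (1 / 2) ^ j < d" using R by (simp add: pos_less_divide_eq mult.commute)
        moreover have "0 \<le> R * (1 / 2) ^ j" using R by simp
        ultimately have "R / 2 * (1 / 2) ^ j \<le> d" by linarith
        then show ?thesis ..
      qed
      \<comment> \<open>The least such \<open>j\<close> also gives
        \<open>d < 2 * (R / 2 * (1 / 2) ^ j)\<close>: for \<open>j = 0\<close> this reads
        \<open>d < R\<close>, which is why the radii start at \<open>R / 2\<close>, and otherwise it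
        is minimality at \<open>j - 1\<close>.\<close>
      then obtain j where j: "R / 2 * (1 / 2) ^ j \<le> d" and least: "\<And>i. i < j \<Longrightarrow> \<not> R / 2 * (1 / 2) ^ i \<le> d"
        using exists_least_iff[of "\<lambda>j. R / 2 * (1 / 2) ^ j \<le> d"] by blast
      have up: "d < 2 * (R / 2 * (1 / 2) ^ j)"
      proof (cases j)
        case (Suc i)
        then show ?thesis using least[of i] by simp
      qed (use d in simp)
      have "1 / d powr \<mu> \<le> (R / 2 * (1 / 2) ^ j) powr (- \<mu>)"
        using j R assms(1) d by (auto simp: powr_minus_divide intro!: divide_left_mono powr_mono2 mult_pos_pos)
      then have "ennreal (1 / norm (x - y) powr \<mu>) * indicator (ball x R) y
         \<le> ennreal ((R / 2 * (1 / 2) ^ j) powr (- \<mu>)) * indicator (ball x (2 * (R / 2 * (1 / 2) ^ j))) y"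
        using True up by (simp add: d_def dist_norm ennreal_leI)
      also have "\<dots> \<le> (\<Sum>j. ennreal ((R / 2 * (1 / 2) ^ j) powr (- \<mu>)) * indicator (ball x (2 * (R / 2 * (1 / 2) ^ j))) y)"
        by (rule ennreal_term_le_suminf)
      finally show ?thesis .
    qed (auto simp: indicator_def)
  qed (use R in simp)
  then show ?thesis using C
    by (intro exI[of _ "C * (1 / 2) powr (real DIM('a) - \<mu>)"]) (simp add: powr_divide mult.assoc)
qed

lemma nn_integral_kernel_outside_ball:
  fixes b :: real
  assumes "real DIM('a) < b"
  shows "\<exists>C>0. \<forall>(x::'a::euclidean_space) R. R > 0 \<longrightarrow>
     (\<integral>\<^sup>+y. ennreal (1 / norm (x - y) powr b) * indicator (- ball x R) y \<partial>lebesgue) \<le> ennreal (C * R powr (real DIM('a) - b))"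
proof -
  have "2 powr (real DIM('a) - b) < 1"
    using assms by (simp add: powr_less_one)
  then obtain C where C: "C > 0" and int: "\<forall>(x::'a) R f. R > 0 \<longrightarrow>
     (\<forall>y. f y \<le> (\<Sum>j. ennreal ((R * 2 ^ j) powr (- b)) * indicator (ball x (2 * (R * 2 ^ j))) y)) \<longrightarrow>
     (\<integral>\<^sup>+y. f y \<partial>lebesgue) \<le> ennreal (C * R powr (real DIM('a) - b))"
    using nn_integral_dyadic_balls[of 2 b, where 'a = 'a] by auto
  have b: "b > 0" using assms DIM_positive[where 'a='a] by linarith
  have "(\<integral>\<^sup>+y. ennreal (1 / norm (x - y) powr b) * indicator (- ball x R) y \<partial>lebesgue)
      \<le> ennreal (C * R powr (real DIM('a) - b))" if R: "R > 0" for x :: 'a and R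
  proof (rule int[rule_format])
    fix y
    show "ennreal (1 / norm (x - y) powr b) * indicator (- ball x R) y
      \<le> (\<Sum>j. ennreal ((R * 2 ^ j) powr (- b)) * indicator (ball x (2 * (R * 2 ^ j))) y)"
    proof (cases "y \<in> ball x R")
      case False
      define d where "d = norm (x - y)"
      have d: "R \<le> d" using False by (auto simp: d_def dist_norm)
      have "\<exists>j. d < 2 * (R * 2 ^ j)"
      proof -
        obtain j where "d / R < 2 ^ j" using real_arch_pow[of 2 "d / R"] by auto
        then have "d < R * 2 ^ j" using R by (simp add: pos_divide_less_eq mult.commute)
        moreover have "0 \<le> R * 2 ^ j" using R by simp
        ultimately have "d < 2 * (R * 2 ^ j)" by linarith
        then show ?thesis ..
      qed
      then obtain j where j: "d < 2 * (R * 2 ^ j)" and least: "\<And>i. i < j \<Longrightarrow> \<not> d < 2 * (R * 2 ^ i)"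
        using exists_least_iff[of "\<lambda>j. d < 2 * (R * 2 ^ j)"] by blast
      have low: "R * 2 ^ j \<le> d"
      proof (cases j)
        case (Suc i)
        then show ?thesis using least[of i] by simp
      qed (use d in simp)
      have "1 / d powr b \<le> (R * 2 ^ j) powr (- b)"
        using low R b d by (auto simp: powr_minus_divide intro!: divide_left_mono powr_mono2 mult_pos_pos)
      then have "ennreal (1 / norm (x - y) powr b) * indicator (- ball x R) y
         \<le> ennreal ((R * 2 ^ j) powr (- b)) * indicator (ball x (2 * (R * 2 ^ j))) y"
        using False j by (simp add: d_def dist_norm ennreal_leI)
      also have "\<dots> \<le> (\<Sum>j. ennreal ((R * 2 ^ j) powr (- b)) * indicator (ball x (2 * (R * 2 ^ j))) y)"
        by (rule ennreal_term_le_suminf)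
      finally show ?thesis .
    qed (auto simp: indicator_def)
  qed (use R in simp)
  then show ?thesis using C by blast
qed

text \<open>Outside the ball of radius \<open>R\<close>, \<open>f\<close> is compared with the decaying threshold
  \<open>t (R/d)\<^sup>a\<close>: below it the kernel becomes integrable at infinity, above it \<open>f\<close> is controlled by
  its \<open>p\<close>-th power.\<close>

lemma powr_dominated_outside:
  fixes f d t R p \<mu> :: real
  assumes "0 \<le> f" "0 < t" "0 < R" "R \<le> d" "0 < \<mu>" "1 < p"
  defines "a \<equiv> \<mu> / (p - 1)"
  shows "f / d powr \<mu> \<le> t * R powr a * (1 / d powr (a + \<mu>)) + t powr (1 - p) * R powr (- \<mu>) * f powr p"
proof -
  have d: "d > 0" using assms by linarith
  have a: "a > 0" using assms by (simp add: a_def)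
  define \<tau> where "\<tau> = t * (R / d) powr a"
  have \<tau>: "\<tau> > 0" using assms d by (simp add: \<tau>_def)
  show ?thesis
  proof (cases "f \<le> \<tau>")
    case True
    have "f / d powr \<mu> \<le> \<tau> / d powr \<mu>" using True d by (simp add: divide_right_mono)
    also have "\<dots> = t * R powr a * (1 / d powr (a + \<mu>))"
      using d assms by (simp add: \<tau>_def powr_divide powr_add)
    finally show ?thesis by (simp add: add_increasing2)
  next
    case False
    then have f: "f > 0" using \<tau> by linarith
    have "f = f powr p * f powr (1 - p)" using f by (simp add: powr_add[symmetric])
    also have "\<dots> \<le> f powr p * \<tau> powr (1 - p)"
      using False \<tau> assms by (intro mult_left_mono powr_mono2') auto
    also have "\<tau> powr (1 - p) = t powr (1 - p) * (d / R) powr \<mu>"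
    proof -
      have "(R / d) powr (a * (1 - p)) = (d / R) powr \<mu>"
      proof -
        \<comment> \<open>The exponent \<open>a = \<mu> / (p - 1)\<close> is chosen for this
          identity: the factor \<open>(d / R)^\<mu>\<close> then cancels the kernel and leaves the
          \<open>p\<close>-th power of \<open>f\<close> with no dependence on
          \<open>d\<close>.\<close>
        have "a * (1 - p) = - \<mu>" using assms(6) by (simp add: a_def field_simps)
        then show ?thesis using d assms by (simp add: powr_minus powr_divide)
      qed
      then show ?thesis using assms d by (simp add: \<tau>_def powr_mult powr_powr)
    qed
    finally have "f / d powr \<mu> \<le> f powr p * (t powr (1 - p) * (d / R) powr \<mu>) / d powr \<mu>"
      by (rule divide_right_mono) simp
    also have "\<dots> = t powr (1 - p) * R powr (- \<mu>) * f powr p"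
      using d assms by (simp add: powr_divide powr_minus_divide)
    finally show ?thesis using assms d by (simp add: add_increasing)
  qed
qed

text \<open>Inside radius \<open>R\<close> the bound \<open>f \<le> t\<close> is used, outside it
  \<open>powr_dominated_outside\<close>. The condition \<open>p * (n - \<mu>) < n\<close> says
  exactly that the threshold decays fast enough, \<open>a + \<mu> > n\<close>, for the outer kernel
  to be integrable.\<close>

lemma riesz_potential_le:
  fixes \<mu> p :: real
  assumes \<mu>: "0 < \<mu>" "\<mu> < real DIM('a)" and p: "1 < p" "p * (real DIM('a) - \<mu>) < real DIM('a)"
  shows "\<exists>C>0. \<forall>(f::'a::euclidean_space \<Rightarrow> real) t F x. f \<in> borel_measurable lebesgue \<longrightarrow>
     (\<forall>y. 0 \<le> f y \<and> f y \<le> t) \<longrightarrow> (\<integral>\<^sup>+y. ennreal (f y powr p) \<partial>lebesgue) \<le> ennreal F \<longrightarrow> 0 \<le> F \<longrightarrow>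
     (\<integral>\<^sup>+y. ennreal (f y / norm (x - y) powr \<mu>) \<partial>lebesgue)
       \<le> ennreal ((C + F) * t powr (1 - p * (real DIM('a) - \<mu>) / real DIM('a)))"
proof -
  let ?n = "real DIM('a)"
  let ?\<theta> = "1 - p * (?n - \<mu>) / ?n"
  define a where "a = \<mu> / (p - 1)"
  have n: "?n > 0" by simp
  have a: "a > 0" "?n < a + \<mu>"
  proof -
    show "a > 0" using \<mu> p by (simp add: a_def)
    have "a + \<mu> = \<mu> * p / (p - 1)" using p by (simp add: a_def field_simps)
    moreover have "?n * (p - 1) < \<mu> * p" using p by (simp add: algebra_simps)
    ultimately show "?n < a + \<mu>" using p by (simp add: pos_less_divide_eq)
  qed
  obtain C1 where C1: "C1 > 0" "\<And>(x::'a) R. R > 0 \<Longrightarrow>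
     (\<integral>\<^sup>+y. ennreal (1 / norm (x - y) powr \<mu>) * indicator (ball x R) y \<partial>lebesgue) \<le> ennreal (C1 * R powr (?n - \<mu>))"
    using nn_integral_kernel_ball[OF \<mu>] by metis
  obtain C2 where C2: "C2 > 0" "\<And>(x::'a) R. R > 0 \<Longrightarrow>
     (\<integral>\<^sup>+y. ennreal (1 / norm (x - y) powr (a + \<mu>)) * indicator (- ball x R) y \<partial>lebesgue) \<le> ennreal (C2 * R powr (?n - (a + \<mu>)))"
    using nn_integral_kernel_outside_ball[OF a(2)] by metis
  have main: "(\<integral>\<^sup>+y. ennreal (f y / norm (x - y) powr \<mu>) \<partial>lebesgue) \<le> ennreal ((C1 + C2 + F) * t powr ?\<theta>)"
    if fm: "f \<in> borel_measurable lebesgue" and f: "\<And>y. 0 \<le> f y" "\<And>y. f y \<le> t"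
      and fF: "(\<integral>\<^sup>+y. ennreal (f y powr p) \<partial>lebesgue) \<le> ennreal F" and F: "0 \<le> F" for f :: "'a \<Rightarrow> real" and t F x
  proof (cases "t = 0")
    case True
    then have "f y = 0" for y using f[of y] by simp
    then show ?thesis by simp
  next
    case False
    then have t: "t > 0" using f[of undefined] by linarith
    \<comment> \<open>This radius balances the contributions: \<open>t R^(n-\<mu>)\<close>, from the
      ball and from the threshold, and \<open>t^(1-p) R^(-\<mu>)\<close>, from the
      \<open>p\<close>-th power of \<open>f\<close>, become the same power of
      \<open>t\<close>.\<close>
    define R where "R = t powr (- p / ?n)"
    have R: "R > 0" using t by (simp add: R_def)
    have km: "(\<lambda>y. ennreal (1 / norm (x - y) powr b)) \<in> borel_measurable lebesgue" for b
      by (rule measurable_completion) simp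
    have im: "ball x R \<in> sets lebesgue" "- ball x R \<in> sets lebesgue" by simp_all
    have "(\<integral>\<^sup>+y. ennreal (f y / norm (x - y) powr \<mu>) \<partial>lebesgue)
      \<le> (\<integral>\<^sup>+y. ennreal t * (ennreal (1 / norm (x - y) powr \<mu>) * indicator (ball x R) y)
          + (ennreal (t * R powr a) * (ennreal (1 / norm (x - y) powr (a + \<mu>)) * indicator (- ball x R) y)
             + ennreal (t powr (1 - p) * R powr (- \<mu>)) * ennreal (f y powr p)) \<partial>lebesgue)"
    proof (rule nn_integral_mono)
      fix y
      show "ennreal (f y / norm (x - y) powr \<mu>) \<le> ennreal t * (ennreal (1 / norm (x - y) powr \<mu>) * indicator (ball x R) y)
          + (ennreal (t * R powr a) * (ennreal (1 / norm (x - y) powr (a + \<mu>)) * indicator (- ball x R) y)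
             + ennreal (t powr (1 - p) * R powr (- \<mu>)) * ennreal (f y powr p))"
      proof (cases "y \<in> ball x R")
        case True
        have "ennreal (f y / norm (x - y) powr \<mu>) \<le> ennreal (t * (1 / norm (x - y) powr \<mu>))"
          using f[of y] by (intro ennreal_leI) (simp add: divide_right_mono)
        then show ?thesis using True t by (simp add: ennreal_mult[symmetric] add_increasing2)
      next
        case False
        then have "R \<le> norm (x - y)" by (simp add: dist_norm)
        from powr_dominated_outside[OF f(1) t R this \<mu>(1) p(1), folded a_def]
        show ?thesis using False t R
          by (simp add: ennreal_mult[symmetric] ennreal_plus[symmetric] ennreal_leI del: ennreal_plus)
      qed
    qed
    also have "\<dots> = ennreal t * (\<integral>\<^sup>+y. ennreal (1 / norm (x - y) powr \<mu>) * indicator (ball x R) y \<partial>lebesgue)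
        + (ennreal (t * R powr a) * (\<integral>\<^sup>+y. ennreal (1 / norm (x - y) powr (a + \<mu>)) * indicator (- ball x R) y \<partial>lebesgue)
          + ennreal (t powr (1 - p) * R powr (- \<mu>)) * (\<integral>\<^sup>+y. ennreal (f y powr p) \<partial>lebesgue))"
    proof -
      note m = borel_measurable_times_ennreal[OF km borel_measurable_indicator[OF im(1)]]
        borel_measurable_times_ennreal[OF km borel_measurable_indicator[OF im(2)]]
      have fp: "(\<lambda>y. ennreal (f y powr p)) \<in> borel_measurable lebesgue" using fm by measurable
      show ?thesis
        using m fp by (simp add: nn_integral_add nn_integral_cmult)
    qed
    also have "\<dots> \<le> ennreal t * ennreal (C1 * R powr (?n - \<mu>))
        + (ennreal (t * R powr a) * ennreal (C2 * R powr (?n - (a + \<mu>)))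
          + ennreal (t powr (1 - p) * R powr (- \<mu>)) * ennreal F)"
      by (intro add_mono mult_left_mono C1 C2 fF R) simp_all
    also have "\<dots> = ennreal (t * (C1 * R powr (?n - \<mu>)) + (t * R powr a * (C2 * R powr (?n - (a + \<mu>)))
          + t powr (1 - p) * R powr (- \<mu>) * F))"
      using t R C1(1) C2(1) F
      by (simp add: ennreal_mult[symmetric] ennreal_plus[symmetric] del: ennreal_plus)
    also have "t * (C1 * R powr (?n - \<mu>)) + (t * R powr a * (C2 * R powr (?n - (a + \<mu>)))
          + t powr (1 - p) * R powr (- \<mu>) * F) = (C1 + C2 + F) * t powr ?\<theta>"
    proof -
      have e1: "t * R powr (?n - \<mu>) = t powr ?\<theta>"
        using t n by (simp add: R_def powr_powr powr_add[symmetric] powr_mult_base field_simps)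
      have e2: "R powr a * R powr (?n - (a + \<mu>)) = R powr (?n - \<mu>)"
        by (simp add: powr_add[symmetric])
      have e3: "t powr (1 - p) * R powr (- \<mu>) = t powr ?\<theta>"
      proof -
        have "1 - p + - p / ?n * - \<mu> = ?\<theta>" using n by (simp add: field_simps)
        then show ?thesis by (simp only: R_def powr_powr powr_add[symmetric])
      qed
      have "t * R powr a * (C2 * R powr (?n - (a + \<mu>))) = C2 * (t * (R powr a * R powr (?n - (a + \<mu>))))"
        by simp
      then show ?thesis unfolding e2 e3 e1 by (simp add: algebra_simps e1)
    qed
    finally show ?thesis .
  qed
  show ?thesis
    by (rule exI[of _ "C1 + C2"]) (use main C1(1) C2(1) in auto)
qed

text \<open>For fixed \<open>x\<close> the region bounds \<open>f\<close> by a power of \<open>g x\<close>, so the Hardy--Littlewood--Sobolev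
  inequality reduces to the pointwise bound for potentials of bounded functions.\<close>

lemma HLS_region:
  fixes \<mu> p q :: real
  assumes \<mu>: "0 < \<mu>" "\<mu> < real DIM('a)" and p: "1 < p" and q: "1 < q"
    and crit: "1 / p + 1 / q + \<mu> / real DIM('a) = 2"
  shows "\<exists>C>0. \<forall>(f::'a::euclidean_space \<Rightarrow> real) g F. f \<in> borel_measurable lebesgue \<longrightarrow> g \<in> borel_measurable lebesgue \<longrightarrow>
     (\<forall>y. 0 \<le> f y) \<longrightarrow> (\<forall>y. 0 \<le> g y) \<longrightarrow> (\<integral>\<^sup>+y. ennreal (f y powr p) \<partial>lebesgue) \<le> ennreal F \<longrightarrow> 0 \<le> F \<longrightarrow>
     (\<integral>\<^sup>+x. \<integral>\<^sup>+y. (if f y powr p \<le> g x powr q then ennreal (f y * g x / norm (x - y) powr \<mu>) else 0) \<partial>lebesgue \<partial>lebesgue)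
       \<le> ennreal (C + F) * (\<integral>\<^sup>+x. ennreal (g x powr q) \<partial>lebesgue)"
proof -
  let ?n = "real DIM('a)"
  let ?\<theta> = "1 - p * (?n - \<mu>) / ?n"
  have n: "?n > 0" by simp
  have inv: "(?n - \<mu>) / ?n = 1 / p + 1 / q - 1"
    using crit n by (simp add: diff_divide_distrib)
  have "1 / q < 1" using q by simp
  then have "(?n - \<mu>) / ?n < 1 / p" unfolding inv by linarith
  then have pn: "p * (?n - \<mu>) < ?n" using p n by (simp add: field_simps)
  obtain C where C: "C > 0" and pot: "\<And>(f::'a \<Rightarrow> real) t F x. f \<in> borel_measurable lebesgue \<Longrightarrow>
     (\<And>y. 0 \<le> f y \<and> f y \<le> t) \<Longrightarrow> (\<integral>\<^sup>+y. ennreal (f y powr p) \<partial>lebesgue) \<le> ennreal F \<Longrightarrow> 0 \<le> F \<Longrightarrow>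
     (\<integral>\<^sup>+y. ennreal (f y / norm (x - y) powr \<mu>) \<partial>lebesgue) \<le> ennreal ((C + F) * t powr ?\<theta>)"
    using riesz_potential_le[OF \<mu> p pn] by blast
  have main: "(\<integral>\<^sup>+x. \<integral>\<^sup>+y. (if f y powr p \<le> g x powr q then ennreal (f y * g x / norm (x - y) powr \<mu>) else 0) \<partial>lebesgue \<partial>lebesgue)
       \<le> ennreal (C + F) * (\<integral>\<^sup>+x. ennreal (g x powr q) \<partial>lebesgue)"
    if fm[measurable]: "f \<in> borel_measurable lebesgue" and gm[measurable]: "g \<in> borel_measurable lebesgue"
      and f: "\<And>y. 0 \<le> f y" and g: "\<And>y. 0 \<le> g y"
      and fF: "(\<integral>\<^sup>+y. ennreal (f y powr p) \<partial>lebesgue) \<le> ennreal F" and F: "0 \<le> F" for f g :: "'a \<Rightarrow> real" and F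
  proof -
    have "(\<integral>\<^sup>+y. (if f y powr p \<le> g x powr q then ennreal (f y * g x / norm (x - y) powr \<mu>) else 0) \<partial>lebesgue)
       \<le> ennreal (C + F) * ennreal (g x powr q)" for x
    proof -
      \<comment> \<open>For fixed \<open>x\<close>, cutting \<open>f\<close> off outside the region
        gives a function bounded by \<open>g(x)^(q/p)\<close>, to which the potential bound
        applies.\<close>
      define h where "h y = (if f y powr p \<le> g x powr q then f y else 0)" for y
      have hm[measurable]: "h \<in> borel_measurable lebesgue" unfolding h_def by measurable
      have h: "0 \<le> h y \<and> h y \<le> g x powr (q / p)" for y
      proof -
        have "f y \<le> g x powr (q / p)" if "f y powr p \<le> g x powr q"
        proof -
          have "(f y powr p) powr (1 / p) \<le> (g x powr q) powr (1 / p)"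
            using that p by (intro powr_mono2) auto
          then show ?thesis using f[of y] p by (simp add: powr_powr)
        qed
        then show ?thesis using f[of y] by (simp add: h_def)
      qed
      have "(\<integral>\<^sup>+y. ennreal (h y powr p) \<partial>lebesgue) \<le> (\<integral>\<^sup>+y. ennreal (f y powr p) \<partial>lebesgue)"
        by (rule nn_integral_mono) (simp add: h_def)
      then have hF: "(\<integral>\<^sup>+y. ennreal (h y powr p) \<partial>lebesgue) \<le> ennreal F" using fF by simp
      have km: "(\<lambda>y. ennreal (h y / norm (x - y) powr \<mu>)) \<in> borel_measurable lebesgue"
      proof -
        have "(\<lambda>y. norm (x - y) powr \<mu>) \<in> borel_measurable lebesgue" by (rule measurable_completion) simp
        then show ?thesis using hm by (intro measurable_compose[OF _ measurable_ennreal] borel_measurable_divide)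
      qed
      have "(\<integral>\<^sup>+y. (if f y powr p \<le> g x powr q then ennreal (f y * g x / norm (x - y) powr \<mu>) else 0) \<partial>lebesgue)
        = (\<integral>\<^sup>+y. ennreal (g x) * ennreal (h y / norm (x - y) powr \<mu>) \<partial>lebesgue)"
        using g[of x] f by (intro nn_integral_cong) (simp add: h_def ennreal_mult[symmetric] mult.commute)
      also have "\<dots> = ennreal (g x) * (\<integral>\<^sup>+y. ennreal (h y / norm (x - y) powr \<mu>) \<partial>lebesgue)"
        by (rule nn_integral_cmult[OF km])
      also have "\<dots> \<le> ennreal (g x) * ennreal ((C + F) * (g x powr (q / p)) powr ?\<theta>)"
        by (intro mult_left_mono pot hm h hF F) simp
      also have "\<dots> = ennreal (C + F) * ennreal (g x * (g x powr (q / p)) powr ?\<theta>)"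
        using g[of x] C F by (simp add: ennreal_mult[symmetric] mult_ac del: ennreal_plus)
      also have "g x * (g x powr (q / p)) powr ?\<theta> = g x powr q"
      proof (cases "g x = 0")
        case False
        \<comment> \<open>Here the scaling relation \<open>crit\<close> enters: the exponent of the
          height, multiplied by \<open>q / p\<close>, is \<open>q - 1\<close>, so that the factor
          \<open>g x\<close> completes the power \<open>q\<close>.\<close>
        have "1 + q / p * ?\<theta> = 1 + q / p - q * ((?n - \<mu>) / ?n)" using p n by (simp add: field_simps)
        also have "\<dots> = q" unfolding inv using p q by (simp add: field_simps)
        finally have "q / p * ?\<theta> = q - 1" by simp
        then show ?thesis using g[of x] False by (simp add: powr_powr powr_mult_base)
      qed simp
      finally show ?thesis .
    qed
    then have "(\<integral>\<^sup>+x. \<integral>\<^sup>+y. (if f y powr p \<le> g x powr q then ennreal (f y * g x / norm (x - y) powr \<mu>) else 0) \<partial>lebesgue \<partial>lebesgue)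
      \<le> (\<integral>\<^sup>+x. ennreal (C + F) * ennreal (g x powr q) \<partial>lebesgue)"
      by (intro nn_integral_mono)
    also have "\<dots> = ennreal (C + F) * (\<integral>\<^sup>+x. ennreal (g x powr q) \<partial>lebesgue)"
      by (intro nn_integral_cmult) measurable
    finally show ?thesis .
  qed
  show ?thesis by (rule exI[of _ C]) (use main C in auto)
qed

section \<open>Symmetric splitting of double integrals and the Hardy-Littlewood-Sobolev
  inequality\<close>

text \<open>The second majorant takes its arguments, and is integrated, in exchanged order, so that
  a bound for one region of the product serves the complementary region with the two functions in
  exchanged roles.\<close>

lemma (in pair_sigma_finite) nn_integral_split_swap:
  assumes A: "case_prod A \<in> borel_measurable (M1 \<Otimes>\<^sub>M M2)" and B: "case_prod B \<in> borel_measurable (M2 \<Otimes>\<^sub>M M1)"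
    and le: "\<And>x y. J x y \<le> A x y + B y x"
  shows "(\<integral>\<^sup>+x. \<integral>\<^sup>+y. J x y \<partial>M2 \<partial>M1) \<le> (\<integral>\<^sup>+x. \<integral>\<^sup>+y. A x y \<partial>M2 \<partial>M1) + (\<integral>\<^sup>+y. \<integral>\<^sup>+x. B y x \<partial>M1 \<partial>M2)"
proof -
  have B': "(\<lambda>(x, y). B y x) \<in> borel_measurable (M1 \<Otimes>\<^sub>M M2)"
    using measurable_pair_swap[OF B] by simp
  have "(\<integral>\<^sup>+x. \<integral>\<^sup>+y. J x y \<partial>M2 \<partial>M1) \<le> (\<integral>\<^sup>+x. \<integral>\<^sup>+y. A x y + B y x \<partial>M2 \<partial>M1)"
    by (intro nn_integral_mono le)
  also have "\<dots> = (\<integral>\<^sup>+x. (\<integral>\<^sup>+y. A x y \<partial>M2) + (\<integral>\<^sup>+y. B y x \<partial>M2) \<partial>M1)"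
    using measurable_Pair2[OF A] measurable_Pair2[OF B'] by (intro nn_integral_cong nn_integral_add) auto
  also have "\<dots> = (\<integral>\<^sup>+x. \<integral>\<^sup>+y. A x y \<partial>M2 \<partial>M1) + (\<integral>\<^sup>+x. \<integral>\<^sup>+y. B y x \<partial>M2 \<partial>M1)"
    by (intro nn_integral_add M2.borel_measurable_nn_integral A B')
  also have "(\<integral>\<^sup>+x. \<integral>\<^sup>+y. B y x \<partial>M2 \<partial>M1) = (\<integral>\<^sup>+y. \<integral>\<^sup>+x. B y x \<partial>M1 \<partial>M2)"
    by (rule Fubini'[OF B', symmetric])
  finally show ?thesis .
qed

lemma HLS_integrand_measurable:
  fixes f g :: "'a::euclidean_space \<Rightarrow> real"
  assumes [measurable]: "f \<in> borel_measurable lebesgue" "g \<in> borel_measurable lebesgue"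
  shows "(\<lambda>(x, y). if f y powr p \<le> g x powr q then ennreal (f y * g x / norm (x - y) powr \<mu>) else 0)
    \<in> borel_measurable (lebesgue \<Otimes>\<^sub>M lebesgue)"
proof -
  have f2[measurable]: "(\<lambda>z. f (snd z)) \<in> borel_measurable ((lebesgue :: 'a measure) \<Otimes>\<^sub>M (lebesgue :: 'a measure))"
    by (rule measurable_compose[OF measurable_snd assms(1)])
  have g1[measurable]: "(\<lambda>z. g (fst z)) \<in> borel_measurable ((lebesgue :: 'a measure) \<Otimes>\<^sub>M (lebesgue :: 'a measure))"
    by (rule measurable_compose[OF measurable_fst assms(2)])
  have "(\<lambda>z. if f (snd z) powr p \<le> g (fst z) powr q then ennreal (f (snd z) * g (fst z) / norm (fst z - snd z) powr \<mu>) else 0)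
    \<in> borel_measurable ((lebesgue :: 'a measure) \<Otimes>\<^sub>M (lebesgue :: 'a measure))"
    by measurable
  then show ?thesis by (simp add: case_prod_beta')
qed

text \<open>At every pair of points \<open>f(y)^p \<le> g(x)^q\<close> or the reverse holds, and
  \<open>HLS_region\<close> bounds each part, the second with \<open>p\<close>, \<open>q\<close> and
  \<open>f\<close>, \<open>g\<close> exchanged. Normalising both masses to at most 1 makes the
  inhomogeneous factor \<open>C + F\<close> harmless.\<close>

lemma HLS_inequality:
  fixes \<mu> p q :: real
  assumes \<mu>: "0 < \<mu>" "\<mu> < real DIM('a)" and p: "1 < p" and q: "1 < q"
    and crit: "1 / p + 1 / q + \<mu> / real DIM('a) = 2"
  shows "\<exists>C>0. \<forall>(f::'a::euclidean_space \<Rightarrow> real) g. f \<in> borel_measurable lebesgue \<longrightarrow> g \<in> borel_measurable lebesgue \<longrightarrow>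
     (\<forall>y. 0 \<le> f y) \<longrightarrow> (\<forall>y. 0 \<le> g y) \<longrightarrow> (\<integral>\<^sup>+y. ennreal (f y powr p) \<partial>lebesgue) \<le> 1 \<longrightarrow>
     (\<integral>\<^sup>+y. ennreal (g y powr q) \<partial>lebesgue) \<le> 1 \<longrightarrow>
     (\<integral>\<^sup>+x. \<integral>\<^sup>+y. ennreal (f y * g x / norm (x - y) powr \<mu>) \<partial>lebesgue \<partial>lebesgue) \<le> ennreal C"
proof -
  let ?R = "\<lambda>p q f g x y. if f y powr p \<le> g x powr q then ennreal (f y * g x / norm (x - y) powr \<mu>) else 0"
  obtain C1 where C1: "C1 > 0" "\<And>(f::'a \<Rightarrow> real) g F. f \<in> borel_measurable lebesgue \<Longrightarrow> g \<in> borel_measurable lebesgue \<Longrightarrow>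
     (\<forall>y. 0 \<le> f y) \<Longrightarrow> (\<forall>y. 0 \<le> g y) \<Longrightarrow> (\<integral>\<^sup>+y. ennreal (f y powr p) \<partial>lebesgue) \<le> ennreal F \<Longrightarrow> 0 \<le> F \<Longrightarrow>
     (\<integral>\<^sup>+x. \<integral>\<^sup>+y. ?R p q f g x y \<partial>lebesgue \<partial>lebesgue) \<le> ennreal (C1 + F) * (\<integral>\<^sup>+x. ennreal (g x powr q) \<partial>lebesgue)"
    using HLS_region[OF \<mu> p q crit] by blast
  have crit': "1 / q + 1 / p + \<mu> / real DIM('a) = 2" using crit by simp
  obtain C2 where C2: "C2 > 0" "\<And>(f::'a \<Rightarrow> real) g F. f \<in> borel_measurable lebesgue \<Longrightarrow> g \<in> borel_measurable lebesgue \<Longrightarrow>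
     (\<forall>y. 0 \<le> f y) \<Longrightarrow> (\<forall>y. 0 \<le> g y) \<Longrightarrow> (\<integral>\<^sup>+y. ennreal (f y powr q) \<partial>lebesgue) \<le> ennreal F \<Longrightarrow> 0 \<le> F \<Longrightarrow>
     (\<integral>\<^sup>+x. \<integral>\<^sup>+y. ?R q p f g x y \<partial>lebesgue \<partial>lebesgue) \<le> ennreal (C2 + F) * (\<integral>\<^sup>+x. ennreal (g x powr p) \<partial>lebesgue)"
    using HLS_region[OF \<mu> q p crit'] by blast
  have main: "(\<integral>\<^sup>+x. \<integral>\<^sup>+y. ennreal (f y * g x / norm (x - y) powr \<mu>) \<partial>lebesgue \<partial>lebesgue) \<le> ennreal (C1 + 1 + (C2 + 1))"
    if fm: "f \<in> borel_measurable lebesgue" and gm: "g \<in> borel_measurable lebesgue"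
      and f: "\<forall>y. 0 \<le> f y" and g: "\<forall>y. 0 \<le> g y"
      and f1: "(\<integral>\<^sup>+y. ennreal (f y powr p) \<partial>lebesgue) \<le> 1" and g1: "(\<integral>\<^sup>+y. ennreal (g y powr q) \<partial>lebesgue) \<le> 1"
    for f g :: "'a \<Rightarrow> real"
  proof -
    have "(\<integral>\<^sup>+x. \<integral>\<^sup>+y. ennreal (f y * g x / norm (x - y) powr \<mu>) \<partial>lebesgue \<partial>lebesgue)
       \<le> (\<integral>\<^sup>+x. \<integral>\<^sup>+y. ?R p q f g x y \<partial>lebesgue \<partial>lebesgue) + (\<integral>\<^sup>+y. \<integral>\<^sup>+x. ?R q p g f y x \<partial>lebesgue \<partial>lebesgue)"
      by (rule lebesgue_pair.nn_integral_split_swap[OF HLS_integrand_measurable[OF fm gm] HLS_integrand_measurable[OF gm fm]])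
        (auto simp: norm_minus_commute mult.commute)
    also have "\<dots> \<le> ennreal (C1 + 1) * (\<integral>\<^sup>+x. ennreal (g x powr q) \<partial>lebesgue) + ennreal (C2 + 1) * (\<integral>\<^sup>+x. ennreal (f x powr p) \<partial>lebesgue)"
      by (intro add_mono C1(2)[OF fm gm f g] C2(2)[OF gm fm g f]) (use f1 g1 in auto)
    also have "\<dots> \<le> ennreal (C1 + 1) * 1 + ennreal (C2 + 1) * 1"
      by (intro add_mono mult_left_mono f1 g1) auto
    finally show ?thesis using C1(1) C2(1) by (simp add: ennreal_plus[symmetric] del: ennreal_plus)
  qed
  show ?thesis by (rule exI[of _ "C1 + 1 + (C2 + 1)"]) (use main C1(1) C2(1) in auto)
qed

section \<open>The Sobolev inequality for test functions, by duality with Riesz potentials\<close>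

lemma nn_integral_lborel_scale:
  fixes F :: "'a::euclidean_space \<Rightarrow> ennreal"
  assumes F[measurable]: "F \<in> borel_measurable borel" and t: "t > 0"
  shows "(\<integral>\<^sup>+z. F (t *\<^sub>R z) \<partial>lborel) = ennreal (1 / t ^ DIM('a)) * (\<integral>\<^sup>+y. F y \<partial>lborel)"
proof -
  have "(\<integral>\<^sup>+y. F y \<partial>lborel) = (\<integral>\<^sup>+y. F y \<partial>density (distr lborel borel (\<lambda>x. 0 + t *\<^sub>R x)) (\<lambda>_. ennreal (\<bar>t\<bar> ^ DIM('a))))"
    using lborel_affine[of t "0::'a"] t by simp
  also have "\<dots> = ennreal (t ^ DIM('a)) * (\<integral>\<^sup>+z. F (t *\<^sub>R z) \<partial>lborel)"
    using t by (simp add: nn_integral_density nn_integral_distr nn_integral_cmult)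
  finally have e: "(\<integral>\<^sup>+y. F y \<partial>lborel) = ennreal (t ^ DIM('a)) * (\<integral>\<^sup>+z. F (t *\<^sub>R z) \<partial>lborel)" .
  have "ennreal (1 / t ^ DIM('a)) * (ennreal (t ^ DIM('a)) * I) = I" for I
    using t by (simp add: mult.assoc[symmetric] ennreal_mult[symmetric])
  then show ?thesis unfolding e by simp
qed

text \<open>Fundamental theorem of calculus along the ray from \<open>x\<close> in direction
  \<open>z\<close>. At time \<open>T\<close> the ray has moved by \<open>R + norm x\<close> and has
  therefore left the support.\<close>

lemma test_fun_ray:
  fixes w :: "'a::euclidean_space \<Rightarrow> real"
  assumes w: "test_fun U w" and z: "z \<noteq> 0"
  shows "ennreal \<bar>w x\<bar> \<le> (\<integral>\<^sup>+t. (if t > 0 then ennreal (norm (grad w (x + t *\<^sub>R z)) * norm z) else 0) \<partial>lborel)"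
proof -
  obtain R where R: "R > 0" "\<And>x. w x \<noteq> 0 \<longrightarrow> norm x < R" using test_fun_radius[OF w] by metis
  define T where "T = (R + norm x) / norm z"
  have T: "T > 0" using R z by (simp add: T_def add_pos_nonneg)
  have "norm (T *\<^sub>R z) - norm x \<le> norm (x + T *\<^sub>R z)"
    using norm_diff_ineq[of "T *\<^sub>R z" x] by (simp add: add.commute)
  moreover have "norm (T *\<^sub>R z) = R + norm x" using T z R by (simp add: T_def abs_of_nonneg)
  ultimately have "w (x + T *\<^sub>R z) = 0" using R(2)[of "x + T *\<^sub>R z"] by linarith
  define d where "d t = grad w (x + t *\<^sub>R z) \<bullet> z" for t
  have cont: "continuous_on A d" for A
    unfolding d_def by (intro continuous_intros continuous_on_compose2[OF continuous_on_grad[OF w, of UNIV]]) auto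
  have int: "integrable lborel (\<lambda>t. indicator {0..T} t *\<^sub>R d t)"
    by (rule borel_integrable_compact[OF _ cont]) simp
  have "(LBINT t. indicator {0..T} t *\<^sub>R d t) = w (x + T *\<^sub>R z) - w (x + 0 *\<^sub>R z)"
  proof (rule integral_FTC_atLeastAtMost[OF _ _ cont])
    show "((\<lambda>t. w (x + t *\<^sub>R z)) has_vector_derivative d t) (at t within {0..T})" for t
      using test_fun_line_derivative[OF w, of x z t]
      by (simp add: d_def has_real_derivative_iff_has_vector_derivative has_vector_derivative_at_within)
  qed (use T in simp)
  then have "\<bar>w x\<bar> = \<bar>LBINT t. indicator {0..T} t *\<^sub>R d t\<bar>" using \<open>w (x + T *\<^sub>R z) = 0\<close> by simp
  then have "ennreal \<bar>w x\<bar> \<le> (\<integral>\<^sup>+t. ennreal (norm (indicator {0..T} t *\<^sub>R d t)) \<partial>lborel)"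
    using integral_norm_bound_ennreal[OF int] by simp
  also have "\<dots> \<le> (\<integral>\<^sup>+t. (if t > 0 then ennreal (norm (grad w (x + t *\<^sub>R z)) * norm z) else 0) \<partial>lborel)"
  proof (rule nn_integral_mono_AE)
    show "AE t in lborel. ennreal (norm (indicator {0..T} t *\<^sub>R d t))
       \<le> (if t > 0 then ennreal (norm (grad w (x + t *\<^sub>R z)) * norm z) else 0)"
      using AE_lborel_singleton[of "0::real"]
    proof eventually_elim
      case (elim t)
      then show ?case
        using Cauchy_Schwarz_ineq2[of "grad w (x + t *\<^sub>R z)" z] by (auto simp: indicator_def d_def ennreal_leI)
    qed
  qed
  finally show ?thesis .
qed

text \<open>Averaging the representation of \<open>w x\<close> along rays over the directions in a ball away from the
  origin and substituting \<open>y = t z\<close> turns the ray integrals into the Riesz potential of the gradient.\<close>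

lemma riesz_bound_test_fun:
  "\<exists>C>0. \<forall>(w::'a::euclidean_space \<Rightarrow> real) x. test_fun UNIV w \<longrightarrow>
    ennreal \<bar>w x\<bar> \<le> ennreal C * (\<integral>\<^sup>+y. ennreal (norm (grad w y) / norm (x - y) powr (real DIM('a) - 1)) \<partial>lebesgue)"
proof -
  let ?n = "real DIM('a)"
  obtain e :: 'a where e: "e \<in> Basis" using nonempty_Basis by blast
  \<comment> \<open>A ball of known volume inside the shell \<open>1 \<le> norm z \<le> 2\<close>:
    after \<open>y = t z\<close> the time satisfies \<open>norm y / 2 \<le> t \<le> norm y\<close>.
    A solid set of directions takes the place of the sphere and of polar coordinates.\<close>
  define A where "A = ball ((3 / 2) *\<^sub>R e) (1 / 2)"
  have A: "1 \<le> norm z \<and> norm z \<le> 2" if "z \<in> A" for z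
  proof -
    have "norm ((3 / 2) *\<^sub>R e - z) < 1 / 2" "norm ((3 / 2) *\<^sub>R e) = 3 / 2"
      using that e by (auto simp: A_def dist_norm)
    then show ?thesis
      using norm_triangle_ineq2[of "(3 / 2) *\<^sub>R e" z] norm_triangle_ineq2[of z "(3 / 2) *\<^sub>R e"]
      by (simp add: norm_minus_commute)
  qed
  define v where "v = unit_ball_vol ?n * (1 / 2) ^ DIM('a)"
  have v: "v > 0" by (simp add: v_def)
  have Av: "emeasure lborel A = ennreal v" unfolding A_def v_def by (rule emeasure_ball) simp
  have [measurable]: "A \<in> sets borel" by (simp add: A_def)
  have main: "ennreal \<bar>w x\<bar> \<le> ennreal (2 ^ DIM('a) / v)
      * (\<integral>\<^sup>+y. ennreal (norm (grad w y) / norm (x - y) powr (?n - 1)) \<partial>lborel)"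
    if w: "test_fun UNIV w" for w :: "'a \<Rightarrow> real" and x
  proof -
    have [measurable]: "grad w \<in> borel_measurable borel" by (rule grad_measurable[OF w])
    let ?g = "\<lambda>y. norm (grad w (x + y))"
    have "ennreal \<bar>w x\<bar> * ennreal v = (\<integral>\<^sup>+z. ennreal \<bar>w x\<bar> * indicator A z \<partial>lborel)"
      by (subst nn_integral_cmult_indicator) (simp_all add: Av)
    also have "\<dots> \<le> (\<integral>\<^sup>+z. \<integral>\<^sup>+t. (if t > 0 \<and> z \<in> A then ennreal (?g (t *\<^sub>R z) * norm z) else 0) \<partial>lborel \<partial>lborel)"
    proof (rule nn_integral_mono)
      fix z
      show "ennreal \<bar>w x\<bar> * indicator A z \<le> (\<integral>\<^sup>+t. (if t > 0 \<and> z \<in> A then ennreal (?g (t *\<^sub>R z) * norm z) else 0) \<partial>lborel)"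
      proof (cases "z \<in> A")
        case True
        then have "z \<noteq> 0" using A[of z] by auto
        from test_fun_ray[OF w this, of x] True show ?thesis by simp
      qed simp
    qed
    also have "\<dots> = (\<integral>\<^sup>+t. \<integral>\<^sup>+z. (if t > 0 \<and> z \<in> A then ennreal (?g (t *\<^sub>R z) * norm z) else 0) \<partial>lborel \<partial>lborel)"
      by (rule lborel_pair.Fubini'[symmetric]) measurable
    also have "\<dots> \<le> (\<integral>\<^sup>+t. \<integral>\<^sup>+y. (if norm y / 2 \<le> t \<and> t \<le> norm y then ennreal (?g y * norm y * (norm y / 2) powr (- ?n - 1)) else 0) \<partial>lborel \<partial>lborel)"
    proof (rule nn_integral_mono)
      fix t :: real
      show "(\<integral>\<^sup>+z. (if t > 0 \<and> z \<in> A then ennreal (?g (t *\<^sub>R z) * norm z) else 0) \<partial>lborel)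
        \<le> (\<integral>\<^sup>+y. (if norm y / 2 \<le> t \<and> t \<le> norm y then ennreal (?g y * norm y * (norm y / 2) powr (- ?n - 1)) else 0) \<partial>lborel)"
      proof (cases "t > 0")
        case t: True
        define H where "H y = (if y /\<^sub>R t \<in> A then ennreal (?g y * (norm y / t)) else 0)" for y
        have H[measurable]: "H \<in> borel_measurable borel" unfolding H_def by measurable
        have "(\<integral>\<^sup>+z. (if t > 0 \<and> z \<in> A then ennreal (?g (t *\<^sub>R z) * norm z) else 0) \<partial>lborel) = (\<integral>\<^sup>+z. H (t *\<^sub>R z) \<partial>lborel)"
          using t by (intro nn_integral_cong) (simp add: H_def)
        also have "\<dots> = ennreal (1 / t ^ DIM('a)) * (\<integral>\<^sup>+y. H y \<partial>lborel)"
          by (rule nn_integral_lborel_scale[OF H t])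
        also have "\<dots> = (\<integral>\<^sup>+y. ennreal (1 / t ^ DIM('a)) * H y \<partial>lborel)"
          by (rule nn_integral_cmult[symmetric]) simp
        also have "\<dots> \<le> (\<integral>\<^sup>+y. (if norm y / 2 \<le> t \<and> t \<le> norm y then ennreal (?g y * norm y * (norm y / 2) powr (- ?n - 1)) else 0) \<partial>lborel)"
        proof (rule nn_integral_mono)
          fix y
          show "ennreal (1 / t ^ DIM('a)) * H y
            \<le> (if norm y / 2 \<le> t \<and> t \<le> norm y then ennreal (?g y * norm y * (norm y / 2) powr (- ?n - 1)) else 0)"
          proof (cases "y /\<^sub>R t \<in> A")
            case True
            have ty: "norm y / 2 \<le> t" "t \<le> norm y"
              using A[OF True] t by (simp_all add: field_simps)
            \<comment> \<open>The factor \<open>t^(-n)\<close> is the Jacobian, the further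
              \<open>1/t\<close> comes from \<open>norm z = norm y / t\<close>. Since
              \<open>t \<ge> norm y / 2\<close>, the variable \<open>t\<close> leaves the integrand,
              and the remaining integral over \<open>t\<close> is the length
              \<open>norm y / 2\<close>.\<close>
            have "1 / t ^ DIM('a) / t = t powr (- ?n - 1)"
              using t by (simp add: powr_realpow[symmetric] powr_diff powr_minus_divide)
            also have "\<dots> \<le> (norm y / 2) powr (- ?n - 1)"
              using ty t by (intro powr_mono2') auto
            finally have "?g y * norm y * (1 / t ^ DIM('a) / t) \<le> ?g y * norm y * (norm y / 2) powr (- ?n - 1)"
              by (intro mult_left_mono) auto
            then have "ennreal (1 / t ^ DIM('a) * (?g y * (norm y / t))) \<le> ennreal (?g y * norm y * (norm y / 2) powr (- ?n - 1))"
              by (intro ennreal_leI) (simp add: mult_ac)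
            moreover have "ennreal (1 / t ^ DIM('a)) * H y = ennreal (1 / t ^ DIM('a) * (?g y * (norm y / t)))"
              using True t by (subst ennreal_mult) (simp_all add: H_def)
            ultimately show ?thesis using ty by simp
          qed (simp add: H_def)
        qed
        finally show ?thesis .
      qed simp
    qed
    also have "\<dots> = (\<integral>\<^sup>+y. \<integral>\<^sup>+t. (if norm y / 2 \<le> t \<and> t \<le> norm y then ennreal (?g y * norm y * (norm y / 2) powr (- ?n - 1)) else 0) \<partial>lborel \<partial>lborel)"
      by (rule lborel_pair.Fubini') measurable
    also have "\<dots> = (\<integral>\<^sup>+y. ennreal (2 ^ DIM('a)) * ennreal (?g y / norm y powr (?n - 1)) \<partial>lborel)"
    proof (rule nn_integral_cong)
      fix y :: 'a
      have "(\<integral>\<^sup>+t. (if norm y / 2 \<le> t \<and> t \<le> norm y then ennreal (?g y * norm y * (norm y / 2) powr (- ?n - 1)) else 0) \<partial>lborel)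
         = (\<integral>\<^sup>+t. ennreal (?g y * norm y * (norm y / 2) powr (- ?n - 1)) * indicator {norm y / 2..norm y} t \<partial>lborel)"
        by (intro nn_integral_cong) (simp add: indicator_def)
      also have "\<dots> = ennreal (?g y * norm y * (norm y / 2) powr (- ?n - 1)) * ennreal (norm y / 2)"
        by (subst nn_integral_cmult_indicator) simp_all
      also have "\<dots> = ennreal (?g y * norm y * ((norm y / 2) powr (- ?n - 1) * (norm y / 2)))"
        by (simp add: ennreal_mult[symmetric] mult_ac)
      also have "?g y * norm y * ((norm y / 2) powr (- ?n - 1) * (norm y / 2)) = 2 ^ DIM('a) * (?g y / norm y powr (?n - 1))"
      proof (cases "y = 0")
        case False
        define r where "r = norm y"
        have r: "r > 0" using False by (simp add: r_def)
        have "(r / 2) powr (- ?n - 1) * (r / 2) = (r / 2) powr (- ?n)"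
          using r powr_mult_base[of "r / 2" "- ?n - 1"] by (simp add: mult.commute)
        also have "\<dots> = 2 ^ DIM('a) / r powr ?n"
          using r by (simp add: powr_minus_divide powr_divide powr_realpow)
        finally have "r * ((r / 2) powr (- ?n - 1) * (r / 2)) = 2 ^ DIM('a) / r powr (?n - 1)"
          using r by (simp add: powr_diff)
        then show ?thesis by (simp add: r_def mult.assoc)
      qed simp
      also have "ennreal (2 ^ DIM('a) * (?g y / norm y powr (?n - 1))) = ennreal (2 ^ DIM('a)) * ennreal (?g y / norm y powr (?n - 1))"
        by (rule ennreal_mult) simp_all
      finally show "(\<integral>\<^sup>+t. (if norm y / 2 \<le> t \<and> t \<le> norm y then ennreal (?g y * norm y * (norm y / 2) powr (- ?n - 1)) else 0) \<partial>lborel)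
         = ennreal (2 ^ DIM('a)) * ennreal (?g y / norm y powr (?n - 1))" .
    qed
    also have "\<dots> = ennreal (2 ^ DIM('a)) * (\<integral>\<^sup>+y. ennreal (?g y / norm y powr (?n - 1)) \<partial>lborel)"
      by (rule nn_integral_cmult) measurable
    also have "(\<integral>\<^sup>+y. ennreal (?g y / norm y powr (?n - 1)) \<partial>lborel)
       = (\<integral>\<^sup>+y. ennreal (norm (grad w y) / norm (x - y) powr (?n - 1)) \<partial>lborel)"
      by (subst (2) lborel_distr_plus[of x, symmetric], subst nn_integral_distr) simp_all
    finally have "ennreal (1 / v) * (ennreal \<bar>w x\<bar> * ennreal v) \<le> ennreal (1 / v) * (ennreal (2 ^ DIM('a))
       * (\<integral>\<^sup>+y. ennreal (norm (grad w y) / norm (x - y) powr (?n - 1)) \<partial>lborel))"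
      by (rule mult_left_mono) simp
    also have "ennreal (1 / v) * (ennreal \<bar>w x\<bar> * ennreal v) = ennreal \<bar>w x\<bar>"
      using v by (simp add: ennreal_mult[symmetric])
    finally show ?thesis using v by (simp add: mult.assoc[symmetric] ennreal_mult[symmetric])
  qed
  show ?thesis
    by (rule exI[of _ "2 ^ DIM('a) / v"]) (use main v in \<open>auto simp: nn_integral_completion\<close>)
qed

text \<open>Duality: in \<open>|w|^s = |w| |w|^(s-1)\<close> the first factor is replaced by its
  Riesz bound, and the Hardy-Littlewood-Sobolev inequality is applied to the gradient in
  \<open>L^2\<close> and to \<open>|w|^(s-1)\<close> in \<open>L^q\<close> with
  \<open>q = 2n/(n+2)\<close>. As \<open>(s-1) q = s\<close>, the same integral \<open>B\<close>
  occurs on both sides, and dividing leaves \<open>B^(1/s)\<close>.\<close>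

lemma sobolev_test_fun:
  assumes n3: "DIM('a::euclidean_space) \<ge> 3"
  shows "\<exists>C>0. \<forall>(w::'a \<Rightarrow> real) F. test_fun UNIV w \<longrightarrow> F > 0 \<longrightarrow>
    (\<integral>\<^sup>+x. ennreal ((norm (grad w x))\<^sup>2) \<partial>lebesgue) \<le> ennreal F \<longrightarrow>
    (\<integral>\<^sup>+x. ennreal (\<bar>w x\<bar> powr (2 * real DIM('a) / (real DIM('a) - 2))) \<partial>lebesgue)
      \<le> ennreal ((C * F) powr (real DIM('a) / (real DIM('a) - 2)))"
proof -
  define n where "n = real DIM('a)"
  define s where "s = 2 * n / (n - 2)"
  define q where "q = 2 * n / (n + 2)"
  have n: "n \<ge> 3" using n3 by (simp add: n_def)
  have s: "s > 1" using n by (simp add: s_def field_simps)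
  have q: "q > 1" using n by (simp add: q_def field_simps)
  have "s - 1 = (n + 2) / (n - 2)" using n by (simp add: s_def field_simps)
  then have sq: "(s - 1) * q = s" using n by (simp add: s_def q_def)
  have "0 < n - 1" "n - 1 < real DIM('a)" "1 / 2 + 1 / q + (n - 1) / real DIM('a) = 2"
    using n by (simp_all add: n_def[symmetric] q_def field_simps)
  then obtain C1 where C1: "C1 > 0" and HLS: "\<And>(f::'a \<Rightarrow> real) g. f \<in> borel_measurable lebesgue \<Longrightarrow> g \<in> borel_measurable lebesgue \<Longrightarrow>
     (\<forall>y. 0 \<le> f y) \<Longrightarrow> (\<forall>y. 0 \<le> g y) \<Longrightarrow> (\<integral>\<^sup>+y. ennreal (f y powr 2) \<partial>lebesgue) \<le> 1 \<Longrightarrow>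
     (\<integral>\<^sup>+y. ennreal (g y powr q) \<partial>lebesgue) \<le> 1 \<Longrightarrow>
     (\<integral>\<^sup>+x. \<integral>\<^sup>+y. ennreal (f y * g x / norm (x - y) powr (n - 1)) \<partial>lebesgue \<partial>lebesgue) \<le> ennreal C1"
    using HLS_inequality[of "n - 1" 2 q, where 'a = 'a] q by auto
  obtain C2 where C2: "C2 > 0" and riesz: "\<And>(w::'a \<Rightarrow> real) x. test_fun UNIV w \<Longrightarrow>
    ennreal \<bar>w x\<bar> \<le> ennreal C2 * (\<integral>\<^sup>+y. ennreal (norm (grad w y) / norm (x - y) powr (n - 1)) \<partial>lebesgue)"
    using riesz_bound_test_fun[where 'a = 'a] unfolding n_def by blast
  define D where "D = C2 * C1"
  have D: "D > 0" using C1 C2 by (simp add: D_def)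
  have main: "(\<integral>\<^sup>+x. ennreal (\<bar>w x\<bar> powr s) \<partial>lebesgue) \<le> ennreal ((D\<^sup>2 * F) powr (n / (n - 2)))"
    if w: "test_fun UNIV w" and F: "F > 0" and wF: "(\<integral>\<^sup>+x. ennreal ((norm (grad w x))\<^sup>2) \<partial>lebesgue) \<le> ennreal F" for w :: "'a \<Rightarrow> real" and F
  proof -
    have wm[measurable]: "w \<in> borel_measurable lebesgue" and gm[measurable]: "grad w \<in> borel_measurable lebesgue"
      using test_fun_measurable[OF w] grad_measurable[OF w] by (auto intro: measurable_completion)
    \<comment> \<open>Boundedness and compact support give this a priori finiteness, without which
      \<open>B\<close> could not be divided out.\<close>
    have fin: "(\<integral>\<^sup>+x. ennreal (\<bar>w x\<bar> powr s) \<partial>lebesgue) < \<infinity>"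
    proof -
      obtain R where R: "R > 0" "\<And>x. w x \<noteq> 0 \<longrightarrow> norm x < R" using test_fun_radius[OF w] by metis
      obtain M where M: "M > 0" "\<And>x. \<bar>w x\<bar> \<le> M" using test_fun_bounded[OF w] by metis
      have "(\<integral>\<^sup>+x. ennreal (\<bar>w x\<bar> powr s) \<partial>lebesgue) \<le> (\<integral>\<^sup>+x. ennreal (M powr s) * indicator (ball (0::'a) R) x \<partial>lebesgue)"
      proof (rule nn_integral_mono)
        fix x
        show "ennreal (\<bar>w x\<bar> powr s) \<le> ennreal (M powr s) * indicator (ball (0::'a) R) x"
          using R(2)[of x] powr_mono2[of s "\<bar>w x\<bar>" M] M(2)[of x] s
          by (cases "w x = 0") (auto intro!: ennreal_leI)
      qed
      also have "\<dots> = ennreal (M powr s) * emeasure lebesgue (ball (0::'a) R)"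
        by (subst nn_integral_cmult_indicator) simp_all
      also have "\<dots> < \<infinity>" using emeasure_lborel_ball_finite[of "0::'a" R] by (simp add: ennreal_mult_less_top)
      finally show ?thesis .
    qed
    then obtain B where B: "B \<ge> 0" "(\<integral>\<^sup>+x. ennreal (\<bar>w x\<bar> powr s) \<partial>lebesgue) = ennreal B"
      by (cases "\<integral>\<^sup>+x. ennreal (\<bar>w x\<bar> powr s) \<partial>lebesgue") auto
    show ?thesis
    proof (cases "B = 0")
      case False
      then have Bp: "B > 0" using B by simp
      \<comment> \<open>\<open>f\<close> and \<open>g\<close> are scaled so that both masses are at
        most 1, as \<open>HLS_inequality\<close> requires; the factors \<open>sqrt F\<close> and
        \<open>B powr (1 / q)\<close> return in the final comparison.\<close>
      define f where "f y = norm (grad w y) / sqrt F" for y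
      define g where "g x = \<bar>w x\<bar> powr (s - 1) / B powr (1 / q)" for x
      have fm: "f \<in> borel_measurable lebesgue" and gm': "g \<in> borel_measurable lebesgue"
        unfolding f_def g_def by measurable
      have pos: "\<forall>y. 0 \<le> f y" "\<forall>y. 0 \<le> g y" using F by (auto simp: f_def g_def)
      have "(\<integral>\<^sup>+y. ennreal (f y powr 2) \<partial>lebesgue) = (\<integral>\<^sup>+y. ennreal (1 / F) * ennreal ((norm (grad w y))\<^sup>2) \<partial>lebesgue)"
        using F by (intro nn_integral_cong) (simp add: f_def ennreal_mult[symmetric] power_divide)
      also have "\<dots> = ennreal (1 / F) * (\<integral>\<^sup>+y. ennreal ((norm (grad w y))\<^sup>2) \<partial>lebesgue)"
        by (rule nn_integral_cmult) measurable
      also have "\<dots> \<le> ennreal (1 / F) * ennreal F" by (rule mult_left_mono[OF wF]) simp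
      finally have f1: "(\<integral>\<^sup>+y. ennreal (f y powr 2) \<partial>lebesgue) \<le> 1" using F by (simp add: ennreal_mult[symmetric])
      have "(\<integral>\<^sup>+y. ennreal (g y powr q) \<partial>lebesgue) = (\<integral>\<^sup>+y. ennreal (1 / B) * ennreal (\<bar>w y\<bar> powr s) \<partial>lebesgue)"
        using Bp q by (intro nn_integral_cong) (simp add: g_def ennreal_mult[symmetric] powr_divide powr_powr sq)
      also have "\<dots> = ennreal (1 / B) * ennreal B"
        by (subst nn_integral_cmult) (simp_all add: B(2))
      finally have g1: "(\<integral>\<^sup>+y. ennreal (g y powr q) \<partial>lebesgue) \<le> 1" using Bp by (simp add: ennreal_mult[symmetric])
      have "ennreal (B / B powr (1 / q)) = ennreal (1 / B powr (1 / q)) * ennreal B"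
        using Bp by (simp add: ennreal_mult[symmetric])
      also have "\<dots> = (\<integral>\<^sup>+x. ennreal (1 / B powr (1 / q)) * ennreal (\<bar>w x\<bar> powr s) \<partial>lebesgue)"
        by (subst nn_integral_cmult) (simp_all add: B(2))
      also have "\<dots> = (\<integral>\<^sup>+x. ennreal (g x) * ennreal \<bar>w x\<bar> \<partial>lebesgue)"
      proof (rule nn_integral_cong)
        fix x
        have "\<bar>w x\<bar> powr (s - 1) * \<bar>w x\<bar> = \<bar>w x\<bar> powr s"
          using powr_mult_base[of "\<bar>w x\<bar>" "s - 1"] by (simp add: mult.commute)
        then show "ennreal (1 / B powr (1 / q)) * ennreal (\<bar>w x\<bar> powr s) = ennreal (g x) * ennreal \<bar>w x\<bar>"
          using pos by (simp add: ennreal_mult[symmetric] g_def)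
      qed
      also have "\<dots> \<le> (\<integral>\<^sup>+x. ennreal (C2 * sqrt F) * (\<integral>\<^sup>+y. ennreal (f y * g x / norm (x - y) powr (n - 1)) \<partial>lebesgue) \<partial>lebesgue)"
      proof (rule nn_integral_mono)
        fix x
        have km: "(\<lambda>y. ennreal (norm (grad w y) / norm (x - y) powr (n - 1))) \<in> borel_measurable lebesgue"
          by (rule measurable_completion) (use grad_measurable[OF w] in measurable)
        have km': "(\<lambda>y. ennreal (f y * g x / norm (x - y) powr (n - 1))) \<in> borel_measurable lebesgue"
          by (rule measurable_completion) (use grad_measurable[OF w] in \<open>unfold f_def, measurable\<close>)
        have "ennreal (g x) * ennreal \<bar>w x\<bar> \<le> ennreal (g x) * (ennreal C2 * (\<integral>\<^sup>+y. ennreal (norm (grad w y) / norm (x - y) powr (n - 1)) \<partial>lebesgue))"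
          by (rule mult_left_mono[OF riesz[OF w]]) simp
        also have "\<dots> = (\<integral>\<^sup>+y. ennreal (g x) * ennreal C2 * ennreal (norm (grad w y) / norm (x - y) powr (n - 1)) \<partial>lebesgue)"
          unfolding mult.assoc[symmetric] by (rule nn_integral_cmult[OF km, symmetric])
        also have "\<dots> = (\<integral>\<^sup>+y. ennreal (C2 * sqrt F) * ennreal (f y * g x / norm (x - y) powr (n - 1)) \<partial>lebesgue)"
          using C2 F pos
          by (intro nn_integral_cong) (simp add: ennreal_mult[symmetric] f_def)
        also have "\<dots> = ennreal (C2 * sqrt F) * (\<integral>\<^sup>+y. ennreal (f y * g x / norm (x - y) powr (n - 1)) \<partial>lebesgue)"
          by (rule nn_integral_cmult[OF km'])
        finally show "ennreal (g x) * ennreal \<bar>w x\<bar> \<le> ennreal (C2 * sqrt F) * (\<integral>\<^sup>+y. ennreal (f y * g x / norm (x - y) powr (n - 1)) \<partial>lebesgue)" .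
      qed
      also have "\<dots> = ennreal (C2 * sqrt F) * (\<integral>\<^sup>+x. \<integral>\<^sup>+y. ennreal (f y * g x / norm (x - y) powr (n - 1)) \<partial>lebesgue \<partial>lebesgue)"
      proof (rule nn_integral_cmult)
        have f2[measurable]: "(\<lambda>z. f (snd z)) \<in> borel_measurable ((lebesgue :: 'a measure) \<Otimes>\<^sub>M (lebesgue :: 'a measure))"
          by (rule measurable_compose[OF measurable_snd fm])
        have g1[measurable]: "(\<lambda>z. g (fst z)) \<in> borel_measurable ((lebesgue :: 'a measure) \<Otimes>\<^sub>M (lebesgue :: 'a measure))"
          by (rule measurable_compose[OF measurable_fst gm'])
        have "(\<lambda>z. ennreal (f (snd z) * g (fst z) / norm (fst z - snd z) powr (n - 1)))
           \<in> borel_measurable ((lebesgue :: 'a measure) \<Otimes>\<^sub>M (lebesgue :: 'a measure))" by measurable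
        then show "(\<lambda>x. \<integral>\<^sup>+y. ennreal (f y * g x / norm (x - y) powr (n - 1)) \<partial>lebesgue) \<in> borel_measurable lebesgue"
          by (intro lebesgue.borel_measurable_nn_integral) (simp add: case_prod_beta')
      qed
      also have "\<dots> \<le> ennreal (C2 * sqrt F) * ennreal C1"
        by (intro mult_left_mono HLS fm gm' pos f1 g1) simp
      finally have "B / B powr (1 / q) \<le> D * sqrt F"
        using C1 C2 F by (simp add: ennreal_mult[symmetric] D_def mult_ac)
      moreover have "B / B powr (1 / q) = B powr (1 / s)"
      proof -
        have "1 - 1 / q = 1 / s" using n by (simp add: q_def s_def field_simps)
        then show ?thesis using Bp powr_diff[of B 1 "1 / q"] by simp
      qed
      ultimately have "(B powr (1 / s)) powr s \<le> (D * sqrt F) powr s"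
        using s by (intro powr_mono2) auto
      also have "(B powr (1 / s)) powr s = B" using Bp s by (simp add: powr_powr)
      also have "(D * sqrt F) powr s = (D\<^sup>2 * F) powr (n / (n - 2))"
      proof -
        have "(D * sqrt F) powr s = ((D * sqrt F) powr 2) powr (n / (n - 2))"
          by (simp add: powr_powr s_def)
        also have "(D * sqrt F) powr 2 = D\<^sup>2 * F"
          using D F by (simp add: power_mult_distrib)
        finally show ?thesis .
      qed
      finally show ?thesis by (simp add: B(2) ennreal_leI)
    qed (use B in simp)
  qed
  show ?thesis
    by (rule exI[of _ "D\<^sup>2"]) (use main D in \<open>auto simp: n_def s_def\<close>)
qed

section \<open>The energy space\<close>

abbreviation (input) lebesgue2 :: "('a::euclidean_space \<times> 'a) measure" where
  "lebesgue2 \<equiv> lebesgue \<Otimes>\<^sub>M lebesgue"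

section \<open>The nonlocal seminorm, a Poincare inequality, and pairings of square-integrable
  functions\<close>

lemma measurable_comp_fst_snd:
  assumes "u \<in> borel_measurable lebesgue"
  shows "(\<lambda>z. u (fst z)) \<in> borel_measurable lebesgue2" "(\<lambda>z. u (snd z)) \<in> borel_measurable lebesgue2"
  by (rule measurable_compose[OF measurable_fst assms], rule measurable_compose[OF measurable_snd assms])

lemma gagliardo_integrand_measurable:
  fixes u :: "'a::euclidean_space \<Rightarrow> real"
  assumes "u \<in> borel_measurable lebesgue"
  shows "(\<lambda>z. ennreal ((u (fst z) - u (snd z))\<^sup>2 / norm (fst z - snd z) powr b)) \<in> borel_measurable lebesgue2"
proof -
  note [measurable] = measurable_comp_fst_snd[OF assms]
  show ?thesis by measurable
qed

text \<open>Approximation in \<open>X0\<close> is measured by \<open>eta2\<close> alone; this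
  inequality turns it into \<open>L^2\<close> convergence. The unit ball \<open>A\<close> lies
  outside the ball of radius \<open>R\<close> that contains \<open>\<Omega>\<close>, so
  \<open>w\<close> vanishes on it, and points of \<open>A\<close> and \<open>\<Omega>\<close> are at
  most \<open>2 R + 2\<close> apart. Hence the difference quotient integrated over
  \<open>y \<in> A\<close> alone dominates a multiple of \<open>(w x)\<^sup>2\<close>.\<close>

lemma gagliardo_poincare:
  fixes \<Omega> :: "'a::euclidean_space set" and s :: real
  assumes s: "s > 0" and b: "bounded \<Omega>"
  shows "\<exists>C>0. \<forall>w. w \<in> borel_measurable lebesgue \<longrightarrow> (AE x in lebesgue. x \<notin> \<Omega> \<longrightarrow> w x = 0) \<longrightarrow>
    (\<integral>\<^sup>+x. ennreal ((w x)\<^sup>2) \<partial>lebesgue) \<le> ennreal C * gagliardo2 s w"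
proof -
  obtain R where R: "R > 0" "\<And>x. x \<in> \<Omega> \<Longrightarrow> norm x \<le> R" using b by (auto simp: bounded_pos)
  obtain e :: 'a where e: "e \<in> Basis" using nonempty_Basis by blast
  define A where "A = ball ((R + 1) *\<^sub>R e) 1"
  define b where "b = real DIM('a) + 2 * s"
  define D where "D = (2 * R + 2) powr b"
  have D: "D > 0" using R by (simp add: D_def)
  have Am: "A \<in> sets lebesgue" by (simp add: A_def)
  have A: "R < norm y \<and> norm y < R + 2" if "y \<in> A" for y
  proof -
    have "norm ((R + 1) *\<^sub>R e - y) < 1" "norm ((R + 1) *\<^sub>R e) = R + 1"
      using that e R by (auto simp: A_def dist_norm)
    then show ?thesis
      using norm_triangle_ineq2[of "(R + 1) *\<^sub>R e" y] norm_triangle_ineq2[of y "(R + 1) *\<^sub>R e"]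
      by (simp add: norm_minus_commute)
  qed
  define v where "v = unit_ball_vol (real DIM('a))"
  have v: "v > 0" by (simp add: v_def)
  have Av: "emeasure lebesgue A = ennreal v" using emeasure_lebesgue_ball[of 1] by (simp add: A_def v_def)
  have main: "(\<integral>\<^sup>+x. ennreal ((w x)\<^sup>2) \<partial>lebesgue) \<le> ennreal (D / v) * gagliardo2 s w"
    if wm: "w \<in> borel_measurable lebesgue" and w0: "AE x in lebesgue. x \<notin> \<Omega> \<longrightarrow> w x = 0" for w
  proof -
    note [measurable] = wm
    have "ennreal (v / D) * (\<integral>\<^sup>+x. ennreal ((w x)\<^sup>2) \<partial>lebesgue) = (\<integral>\<^sup>+x. ennreal (v / D) * ennreal ((w x)\<^sup>2) \<partial>lebesgue)"
      by (rule nn_integral_cmult[symmetric]) measurable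
    also have "\<dots> \<le> (\<integral>\<^sup>+x. \<integral>\<^sup>+y. ennreal ((w x - w y)\<^sup>2 / norm (x - y) powr b) \<partial>lebesgue \<partial>lebesgue)"
    proof (rule nn_integral_mono_AE)
      show "AE x in lebesgue. ennreal (v / D) * ennreal ((w x)\<^sup>2) \<le> (\<integral>\<^sup>+y. ennreal ((w x - w y)\<^sup>2 / norm (x - y) powr b) \<partial>lebesgue)"
        using w0
      proof eventually_elim
        case x: (elim x)
        show ?case
        proof (cases "x \<in> \<Omega>")
          case True
          have "ennreal (v / D) * ennreal ((w x)\<^sup>2) = ennreal ((w x)\<^sup>2 / D) * emeasure lebesgue A"
            using D v by (simp add: Av ennreal_mult[symmetric])
          also have "\<dots> = (\<integral>\<^sup>+y. ennreal ((w x)\<^sup>2 / D) * indicator A y \<partial>lebesgue)"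
            by (rule nn_integral_cmult_indicator[OF Am, symmetric])
          also have "\<dots> \<le> (\<integral>\<^sup>+y. ennreal ((w x - w y)\<^sup>2 / norm (x - y) powr b) \<partial>lebesgue)"
          proof (rule nn_integral_mono_AE)
            show "AE y in lebesgue. ennreal ((w x)\<^sup>2 / D) * indicator A y \<le> ennreal ((w x - w y)\<^sup>2 / norm (x - y) powr b)"
              using w0
            proof eventually_elim
              case (elim y)
              show ?case
              proof (cases "y \<in> A")
                case y: True
                then have "y \<notin> \<Omega>" using A[of y] R(2)[of y] by auto
                then have wy: "w y = 0" using elim by blast
                have "0 < norm (x - y)" using True \<open>y \<notin> \<Omega>\<close> by auto
                moreover have "norm (x - y) \<le> 2 * R + 2"
                  using norm_triangle_ineq4[of x y] A[OF y] R(2)[OF True] by linarith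
                ultimately have "norm (x - y) powr b \<le> D" "0 < norm (x - y) powr b"
                  using s by (auto simp: D_def b_def intro!: powr_mono2)
                then have "(w x)\<^sup>2 / D \<le> (w x - w y)\<^sup>2 / norm (x - y) powr b"
                  using D by (simp add: wy frac_le)
                then show ?thesis using y by (simp add: ennreal_leI)
              qed simp
            qed
          qed
          finally show ?thesis .
        qed (use x in simp)
      qed
    qed
    also have "\<dots> = gagliardo2 s w"
      using lebesgue.nn_integral_fst[OF gagliardo_integrand_measurable[OF wm, of b]]
      by (simp add: gagliardo2_def b_def)
    finally have "ennreal (D / v) * (ennreal (v / D) * (\<integral>\<^sup>+x. ennreal ((w x)\<^sup>2) \<partial>lebesgue)) \<le> ennreal (D / v) * gagliardo2 s w"
      by (rule mult_left_mono) simp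
    then show ?thesis using D v by (simp add: mult.assoc[symmetric] ennreal_mult[symmetric])
  qed
  show ?thesis by (rule exI[of _ "D / v"]) (use main D v in auto)
qed

lemma integrable_mult_L2:
  fixes f a :: "'b \<Rightarrow> real"
  assumes [measurable]: "f \<in> borel_measurable M" "a \<in> borel_measurable M"
    and f: "(\<integral>\<^sup>+x. ennreal ((f x)\<^sup>2) \<partial>M) < \<infinity>" and a: "(\<integral>\<^sup>+x. ennreal ((a x)\<^sup>2) \<partial>M) < \<infinity>"
  shows "integrable M (\<lambda>x. f x * a x)"
proof (rule integrableI_bounded)
  have "(\<integral>\<^sup>+x. ennreal (norm (f x * a x)) \<partial>M) \<le> (\<integral>\<^sup>+x. ennreal ((f x)\<^sup>2) + ennreal ((a x)\<^sup>2) \<partial>M)"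
  proof (rule nn_integral_mono)
    fix x
    have "2 * (\<bar>f x\<bar> * \<bar>a x\<bar>) \<le> (f x)\<^sup>2 + (a x)\<^sup>2"
      using sum_squares_bound[of "\<bar>f x\<bar>" "\<bar>a x\<bar>"] by (simp add: mult.assoc)
    then have "\<bar>f x\<bar> * \<bar>a x\<bar> \<le> (f x)\<^sup>2 + (a x)\<^sup>2"
      using mult_nonneg_nonneg[of "\<bar>f x\<bar>" "\<bar>a x\<bar>"] by linarith
    then show "ennreal (norm (f x * a x)) \<le> ennreal ((f x)\<^sup>2) + ennreal ((a x)\<^sup>2)"
      by (simp add: abs_mult ennreal_plus[symmetric] ennreal_leI del: ennreal_plus)
  qed
  also have "\<dots> < \<infinity>" using f a by (simp add: nn_integral_add)
  finally show "(\<integral>\<^sup>+x. ennreal (norm (f x * a x)) \<partial>M) < \<infinity>" .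
qed simp

text \<open>Cauchy-Schwarz, kept in squared form so that no square roots of extended reals
  occur.\<close>

lemma tendsto_integral_mult_L2:
  fixes f a :: "'b \<Rightarrow> real" and g :: "nat \<Rightarrow> 'b \<Rightarrow> real"
  assumes fm[measurable]: "f \<in> borel_measurable M" and gm[measurable]: "\<And>k. g k \<in> borel_measurable M"
    and am[measurable]: "a \<in> borel_measurable M" and a: "(\<integral>\<^sup>+x. ennreal ((a x)\<^sup>2) \<partial>M) < \<infinity>"
    and fi: "integrable M (\<lambda>x. f x * a x)" and gi: "\<And>k. integrable M (\<lambda>x. g k x * a x)"
    and lim: "(\<lambda>k. \<integral>\<^sup>+x. ennreal ((f x - g k x)\<^sup>2) \<partial>M) \<longlonglongrightarrow> 0"
  shows "(\<lambda>k. LINT x|M. g k x * a x) \<longlonglongrightarrow> (LINT x|M. f x * a x)"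
proof -
  define d where "d k = (LINT x|M. f x * a x) - (LINT x|M. g k x * a x)" for k
  have le: "ennreal ((d k)\<^sup>2) \<le> (\<integral>\<^sup>+x. ennreal ((a x)\<^sup>2) \<partial>M) * (\<integral>\<^sup>+x. ennreal ((f x - g k x)\<^sup>2) \<partial>M)" for k
  proof -
    have i: "integrable M (\<lambda>x. (f x - g k x) * a x)"
      using Bochner_Integration.integrable_diff[OF fi gi[of k]] by (simp add: left_diff_distrib)
    have "d k = (LINT x|M. (f x - g k x) * a x)"
      using Bochner_Integration.integral_diff[OF fi gi[of k]] by (simp add: d_def left_diff_distrib)
    then have "ennreal \<bar>d k\<bar> \<le> (\<integral>\<^sup>+x. ennreal \<bar>f x - g k x\<bar> * ennreal \<bar>a x\<bar> \<partial>M)"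
      using integral_norm_bound_ennreal[OF i] by (simp add: abs_mult ennreal_mult)
    then have "(ennreal \<bar>d k\<bar>)\<^sup>2 \<le> (\<integral>\<^sup>+x. ennreal \<bar>f x - g k x\<bar> * ennreal \<bar>a x\<bar> \<partial>M)\<^sup>2"
      by (rule power_mono) simp
    also have "\<dots> \<le> (\<integral>\<^sup>+x. (ennreal \<bar>f x - g k x\<bar>)\<^sup>2 \<partial>M) * (\<integral>\<^sup>+x. (ennreal \<bar>a x\<bar>)\<^sup>2 \<partial>M)"
      by (rule Cauchy_Schwarz_nn_integral) measurable
    finally show ?thesis by (simp add: ennreal_power mult.commute)
  qed
  have "(\<lambda>k. (\<integral>\<^sup>+x. ennreal ((a x)\<^sup>2) \<partial>M) * (\<integral>\<^sup>+x. ennreal ((f x - g k x)\<^sup>2) \<partial>M)) \<longlonglongrightarrow> (\<integral>\<^sup>+x. ennreal ((a x)\<^sup>2) \<partial>M) * 0"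
    by (rule ennreal_tendsto_cmult[OF _ lim]) (use a in simp)
  then have lim': "(\<lambda>k. (\<integral>\<^sup>+x. ennreal ((a x)\<^sup>2) \<partial>M) * (\<integral>\<^sup>+x. ennreal ((f x - g k x)\<^sup>2) \<partial>M)) \<longlonglongrightarrow> 0" by simp
  have "(\<lambda>k. ennreal ((d k)\<^sup>2)) \<longlonglongrightarrow> ennreal 0"
    unfolding ennreal_0
    by (rule tendsto_sandwich[OF _ _ tendsto_const lim']) (use le in simp_all)
  then have "(\<lambda>k. (d k)\<^sup>2) \<longlonglongrightarrow> 0"
    by (subst (asm) tendsto_ennreal_iff) auto
  from tendsto_real_sqrt[OF this] have "d \<longlonglongrightarrow> 0"
    by (simp add: tendsto_rabs_zero_iff)
  then have "(\<lambda>k. (LINT x|M. f x * a x) - d k) \<longlonglongrightarrow> (LINT x|M. f x * a x) - 0"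
    by (intro tendsto_intros)
  then show ?thesis by (simp add: d_def)
qed

lemma test_fun_square_finite:
  assumes "test_fun U \<phi>"
  shows "(\<integral>\<^sup>+x. ennreal ((\<phi> x)\<^sup>2) \<partial>lebesgue) < \<infinity>"
proof -
  have "test_fun U (\<lambda>x. \<phi> x * \<phi> x)" using assms by (intro test_fun_mult) (auto simp: test_fun_def)
  from test_fun_integrable[OF this] show ?thesis by (simp add: integrable_iff_bounded power2_eq_square)
qed

section \<open>Approximation by test functions and the Sobolev inequality on the energy
  space\<close>

text \<open>Against a fixed test function both sides of the integration-by-parts identity are
  \<open>L^2\<close> pairings, hence continuous along the sequence.\<close>

lemma has_weak_gradient_closed:
  fixes f :: "'a::euclidean_space \<Rightarrow> real" and g :: "nat \<Rightarrow> 'a \<Rightarrow> real"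
  assumes g: "\<And>k. g k \<in> borel_measurable lebesgue" "\<And>k. has_weak_gradient (g k) (K k)"
    and fm: "f \<in> borel_measurable lebesgue" and Hm: "H \<in> borel_measurable lebesgue"
    and f: "(\<integral>\<^sup>+x. ennreal ((f x)\<^sup>2) \<partial>lebesgue) < \<infinity>" and H: "(\<integral>\<^sup>+x. ennreal ((norm (H x))\<^sup>2) \<partial>lebesgue) < \<infinity>"
    and fg: "(\<lambda>k. \<integral>\<^sup>+x. ennreal ((f x - g k x)\<^sup>2) \<partial>lebesgue) \<longlonglongrightarrow> 0"
    and HK: "(\<lambda>k. \<integral>\<^sup>+x. ennreal ((norm (H x - K k x))\<^sup>2) \<partial>lebesgue) \<longlonglongrightarrow> 0"
  shows "has_weak_gradient f H"
  unfolding has_weak_gradient_def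
proof (intro allI impI ballI)
  fix \<psi> :: "'a \<Rightarrow> real" and i :: 'a assume \<psi>: "test_fun UNIV \<psi>" and i: "i \<in> Basis"
  have \<psi>m: "\<psi> \<in> borel_measurable lebesgue" "(\<lambda>x. frechet_derivative \<psi> (at x) i) \<in> borel_measurable lebesgue"
    using test_fun_measurable[OF \<psi>] test_fun_measurable[OF test_fun_partial[OF \<psi> i]]
    by (auto intro: measurable_completion)
  have Him: "(\<lambda>x. H x \<bullet> i) \<in> borel_measurable lebesgue" using Hm by measurable
  have Kim: "(\<lambda>x. K k x \<bullet> i) \<in> borel_measurable lebesgue" for k
    using has_weak_gradient_measurable[OF g(2)[of k]] by measurable
  have le: "ennreal ((v \<bullet> i)\<^sup>2) \<le> ennreal ((norm v)\<^sup>2)" for v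
    using Basis_le_norm[OF i, of v] by (intro ennreal_leI) (simp add: abs_le_square_iff[symmetric])
  have Hi: "(\<integral>\<^sup>+x. ennreal ((H x \<bullet> i)\<^sup>2) \<partial>lebesgue) < \<infinity>"
    by (rule le_less_trans[OF nn_integral_mono H]) (rule le)
  have HKi: "(\<lambda>k. \<integral>\<^sup>+x. ennreal ((H x \<bullet> i - K k x \<bullet> i)\<^sup>2) \<partial>lebesgue) \<longlonglongrightarrow> 0"
  proof (rule tendsto_sandwich[OF _ _ tendsto_const HK])
    show "\<forall>\<^sub>F k in sequentially. (\<integral>\<^sup>+x. ennreal ((H x \<bullet> i - K k x \<bullet> i)\<^sup>2) \<partial>lebesgue) \<le> (\<integral>\<^sup>+x. ennreal ((norm (H x - K k x))\<^sup>2) \<partial>lebesgue)"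
      unfolding inner_diff_left[symmetric] by (intro always_eventually allI nn_integral_mono le)
  qed simp
  note D = has_weak_gradientD[OF g(2) \<psi> i]
  note i1 = integrable_mult_L2[OF fm \<psi>m(2) f test_fun_square_finite[OF test_fun_partial[OF \<psi> i]]]
  note i2 = integrable_mult_L2[OF Him \<psi>m(1) Hi test_fun_square_finite[OF \<psi>]]
  have "(\<lambda>k. LINT x|lebesgue. g k x * frechet_derivative \<psi> (at x) i) \<longlonglongrightarrow> (LINT x|lebesgue. f x * frechet_derivative \<psi> (at x) i)"
    by (rule tendsto_integral_mult_L2[OF fm g(1) \<psi>m(2) test_fun_square_finite[OF test_fun_partial[OF \<psi> i]] i1 D(1) fg])
  moreover have "(\<lambda>k. - (LINT x|lebesgue. K k x \<bullet> i * \<psi> x)) \<longlonglongrightarrow> - (LINT x|lebesgue. H x \<bullet> i * \<psi> x)"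
    by (intro tendsto_minus tendsto_integral_mult_L2[OF Him Kim \<psi>m(1) test_fun_square_finite[OF \<psi>] i2 D(2) HKi])
  ultimately have "(LINT x|lebesgue. f x * frechet_derivative \<psi> (at x) i) = - (LINT x|lebesgue. H x \<bullet> i * \<psi> x)"
    unfolding D(3) by (rule LIMSEQ_unique)
  then show "integrable lebesgue (\<lambda>x. f x * frechet_derivative \<psi> (at x) i) \<and>
       integrable lebesgue (\<lambda>x. H x \<bullet> i * \<psi> x) \<and>
       (LINT x|lebesgue. f x * frechet_derivative \<psi> (at x) i) = - (LINT x|lebesgue. H x \<bullet> i * \<psi> x)"
    using i1 i2 by blast
qed

text \<open>The two summands of \<open>eta2\<close> are listed separately, and \<open>L^2\<close>
  and almost-everywhere convergence are added: Fatou's lemma and the composition with a nonlinear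
  function work pointwise.\<close>

definition X0_approx :: "real \<Rightarrow> 'a::euclidean_space set \<Rightarrow> ('a \<Rightarrow> real) \<Rightarrow> ('a \<Rightarrow> 'a) \<Rightarrow> (nat \<Rightarrow> 'a \<Rightarrow> real) \<Rightarrow> bool" where
  "X0_approx s \<Omega> u G \<phi> \<longleftrightarrow>
     has_weak_gradient u G \<and> eta2 s u G < \<infinity> \<and> (\<forall>k. test_fun \<Omega> (\<phi> k)) \<and>
     (\<lambda>k. \<integral>\<^sup>+x. ennreal ((norm (G x - grad (\<phi> k) x))\<^sup>2) \<partial>lebesgue) \<longlonglongrightarrow> 0 \<and>
     (\<lambda>k. gagliardo2 s (\<lambda>x. u x - \<phi> k x)) \<longlonglongrightarrow> 0 \<and>
     (\<lambda>k. \<integral>\<^sup>+x. ennreal ((u x - \<phi> k x)\<^sup>2) \<partial>lebesgue) \<longlonglongrightarrow> 0 \<and>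
     (AE x in lebesgue. (\<lambda>k. \<phi> k x) \<longlonglongrightarrow> u x)"

lemma test_fun_measurable_lebesgue: "test_fun U \<phi> \<Longrightarrow> \<phi> \<in> borel_measurable lebesgue"
  by (rule measurable_completion) (simp add: test_fun_measurable)

lemma grad_measurable_lebesgue: "test_fun U \<phi> \<Longrightarrow> grad \<phi> \<in> borel_measurable lebesgue"
  by (rule measurable_completion) (simp add: grad_measurable)

lemma ennreal_tendsto_0_mono:
  fixes f g :: "nat \<Rightarrow> ennreal"
  assumes "g \<longlonglongrightarrow> 0" "\<And>k. f k \<le> g k"
  shows "f \<longlonglongrightarrow> 0"
  by (rule tendsto_sandwich[OF _ _ tendsto_const assms(1)]) (use assms(2) in simp_all)

lemma ennreal_tendsto_0_cmult:
  fixes f :: "nat \<Rightarrow> ennreal"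
  assumes "f \<longlonglongrightarrow> 0"
  shows "(\<lambda>k. ennreal c * f k) \<longlonglongrightarrow> 0"
  using ennreal_tendsto_cmult[OF _ assms, of "ennreal c"] by simp

lemma ennreal_square_add_le: "ennreal ((a + b)\<^sup>2) \<le> ennreal 2 * ennreal (a\<^sup>2) + ennreal 2 * ennreal (b\<^sup>2)" for a b :: real
proof -
  have "(a + b)\<^sup>2 \<le> 2 * a\<^sup>2 + 2 * b\<^sup>2" using sum_squares_bound[of a b] by (simp add: power2_sum)
  then show ?thesis
    by (simp only: ennreal_mult'[symmetric] zero_le_power2 ennreal_plus[symmetric] mult_nonneg_nonneg zero_le_numeral ennreal_leI)
qed

lemma X0_obtain_approx:
  fixes u :: "'a::euclidean_space \<Rightarrow> real"
  assumes s: "s > 0" and b: "bounded \<Omega>" and u: "X0 s \<Omega> u"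
  shows "\<exists>G \<phi>. X0_approx s \<Omega> u G \<phi>"
proof -
  from u have um: "u \<in> borel_measurable lebesgue" and u0: "AE x in lebesgue. x \<notin> \<Omega> \<longrightarrow> u x = 0"
    and u2: "integrable lebesgue (\<lambda>x. (u x)\<^sup>2)" by (simp_all add: X0_def)
  from u obtain G \<phi> where G: "has_weak_gradient u G" "eta2 s u G < \<infinity>" and \<phi>: "\<And>k. test_fun \<Omega> (\<phi> k)"
    and lim: "(\<lambda>k. eta2 s (\<lambda>x. u x - \<phi> k x) (\<lambda>x. G x - grad (\<phi> k) x)) \<longlonglongrightarrow> 0"
    unfolding X0_def by blast
  have \<phi>m: "\<phi> k \<in> borel_measurable lebesgue" for k by (rule test_fun_measurable_lebesgue[OF \<phi>])
  have L1: "(\<lambda>k. \<integral>\<^sup>+x. ennreal ((norm (G x - grad (\<phi> k) x))\<^sup>2) \<partial>lebesgue) \<longlonglongrightarrow> 0"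
    by (rule ennreal_tendsto_0_mono[OF lim]) (simp add: eta2_def)
  have L2: "(\<lambda>k. gagliardo2 s (\<lambda>x. u x - \<phi> k x)) \<longlonglongrightarrow> 0"
    by (rule ennreal_tendsto_0_mono[OF lim]) (simp add: eta2_def)
  have dm: "(\<lambda>x. u x - \<phi> k x) \<in> borel_measurable lebesgue" for k using um \<phi>m by measurable
  have d0: "AE x in lebesgue. x \<notin> \<Omega> \<longrightarrow> u x - \<phi> k x = 0" for k
    using u0 by eventually_elim (simp add: test_fun_zero_outside[OF \<phi>])
  obtain C where C: "C > 0" "\<And>w. w \<in> borel_measurable lebesgue \<Longrightarrow> (AE x in lebesgue. x \<notin> \<Omega> \<longrightarrow> w x = 0) \<Longrightarrow>
    (\<integral>\<^sup>+x. ennreal ((w x)\<^sup>2) \<partial>lebesgue) \<le> ennreal C * gagliardo2 s w"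
    using gagliardo_poincare[OF s b] by blast
  have L3: "(\<lambda>k. \<integral>\<^sup>+x. ennreal ((u x - \<phi> k x)\<^sup>2) \<partial>lebesgue) \<longlonglongrightarrow> 0"
    by (rule ennreal_tendsto_0_mono[OF ennreal_tendsto_0_cmult[OF L2, of C]]) (rule C(2)[OF dm d0])
  have d2: "integrable lebesgue (\<lambda>x. (u x - \<phi> k x)\<^sup>2)" for k
  proof (rule integrableI_bounded)
    show "(\<lambda>x. (u x - \<phi> k x)\<^sup>2) \<in> borel_measurable lebesgue" using dm[of k] by measurable
    have "(\<integral>\<^sup>+x. ennreal ((u x - \<phi> k x)\<^sup>2) \<partial>lebesgue) \<le> (\<integral>\<^sup>+x. ennreal 2 * ennreal ((u x)\<^sup>2) + ennreal 2 * ennreal ((\<phi> k x)\<^sup>2) \<partial>lebesgue)"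
      using ennreal_square_add_le[of "u _" "- \<phi> k _"] by (intro nn_integral_mono) simp
    also have "\<dots> = ennreal 2 * (\<integral>\<^sup>+x. ennreal ((u x)\<^sup>2) \<partial>lebesgue) + ennreal 2 * (\<integral>\<^sup>+x. ennreal ((\<phi> k x)\<^sup>2) \<partial>lebesgue)"
    proof -
      have "(\<lambda>x. ennreal ((u x)\<^sup>2)) \<in> borel_measurable lebesgue" "(\<lambda>x. ennreal ((\<phi> k x)\<^sup>2)) \<in> borel_measurable lebesgue"
        using um \<phi>m[of k] by measurable
      then show ?thesis by (simp add: nn_integral_add nn_integral_cmult)
    qed
    also have "\<dots> < \<infinity>"
      using u2 test_fun_square_finite[OF \<phi>[of k]] by (simp add: integrable_iff_bounded ennreal_mult_less_top)
    finally show "(\<integral>\<^sup>+x. ennreal (norm ((u x - \<phi> k x)\<^sup>2)) \<partial>lebesgue) < \<infinity>" by simp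
  qed
  have "ennreal (LINT x|lebesgue. norm ((u x - \<phi> k x)\<^sup>2)) = (\<integral>\<^sup>+x. ennreal ((u x - \<phi> k x)\<^sup>2) \<partial>lebesgue)" for k
    using nn_integral_eq_integral[OF d2[of k]] by simp
  then have "(\<lambda>k. ennreal (LINT x|lebesgue. norm ((u x - \<phi> k x)\<^sup>2))) \<longlonglongrightarrow> ennreal 0" using L3 by simp
  then have "(\<lambda>k. LINT x|lebesgue. norm ((u x - \<phi> k x)\<^sup>2)) \<longlonglongrightarrow> 0"
    by (subst (asm) tendsto_ennreal_iff) auto
  \<comment> \<open>Almost-everywhere convergence holds along a subsequence, which inherits the
    other limits.\<close>
  from tendsto_L1_AE_subseq[OF d2 this] obtain r where r: "strict_mono r"
    and ae: "AE x in lebesgue. (\<lambda>k. (u x - \<phi> (r k) x)\<^sup>2) \<longlonglongrightarrow> 0" by blast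
  have "AE x in lebesgue. (\<lambda>k. \<phi> (r k) x) \<longlonglongrightarrow> u x"
    using ae
  proof eventually_elim
    case (elim x)
    from tendsto_real_sqrt[OF this] have "(\<lambda>k. u x - \<phi> (r k) x) \<longlonglongrightarrow> 0" by (simp add: tendsto_rabs_zero_iff)
    from tendsto_diff[OF tendsto_const[of "u x"] this] show ?case by simp
  qed
  then have "X0_approx s \<Omega> u G (\<lambda>k. \<phi> (r k))"
    unfolding X0_approx_def
    using G \<phi> LIMSEQ_subseq_LIMSEQ[OF L1 r] LIMSEQ_subseq_LIMSEQ[OF L2 r] LIMSEQ_subseq_LIMSEQ[OF L3 r]
    by (simp add: o_def)
  then show ?thesis by blast
qed

text \<open>Fatou's lemma along the approximating test functions. Uniqueness of weak gradients
  transfers the bound from the given \<open>G\<close> to the \<open>H\<close> that comes with the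
  approximation.\<close>

lemma X0_sobolev:
  assumes n3: "DIM('a::euclidean_space) \<ge> 3" and s: "s > 0"
  shows "\<exists>C>0. \<forall>\<Omega> (u::'a \<Rightarrow> real) G F. bounded \<Omega> \<longrightarrow> X0 s \<Omega> u \<longrightarrow> has_weak_gradient u G \<longrightarrow> F > 0 \<longrightarrow>
    (\<integral>\<^sup>+x. ennreal ((norm (G x))\<^sup>2) \<partial>lebesgue) \<le> ennreal F \<longrightarrow>
    (\<integral>\<^sup>+x. ennreal (\<bar>u x\<bar> powr (2 * real DIM('a) / (real DIM('a) - 2))) \<partial>lebesgue)
      \<le> ennreal ((C * F) powr (real DIM('a) / (real DIM('a) - 2)))"
proof -
  let ?s = "2 * real DIM('a) / (real DIM('a) - 2)"
  let ?r = "real DIM('a) / (real DIM('a) - 2)"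
  have pos: "?s > 0" using n3 by simp
  obtain C where C: "C > 0" "\<And>(w::'a \<Rightarrow> real) F. test_fun UNIV w \<Longrightarrow> F > 0 \<Longrightarrow>
    (\<integral>\<^sup>+x. ennreal ((norm (grad w x))\<^sup>2) \<partial>lebesgue) \<le> ennreal F \<Longrightarrow>
    (\<integral>\<^sup>+x. ennreal (\<bar>w x\<bar> powr ?s) \<partial>lebesgue) \<le> ennreal ((C * F) powr ?r)"
    using sobolev_test_fun[OF n3] by blast
  have main: "(\<integral>\<^sup>+x. ennreal (\<bar>u x\<bar> powr ?s) \<partial>lebesgue) \<le> ennreal ((4 * C * F) powr ?r)"
    if b: "bounded \<Omega>" and u: "X0 s \<Omega> u" and G: "has_weak_gradient u G" and F: "F > 0"
      and GF: "(\<integral>\<^sup>+x. ennreal ((norm (G x))\<^sup>2) \<partial>lebesgue) \<le> ennreal F" for \<Omega> and u :: "'a \<Rightarrow> real" and G F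
  proof -
    obtain H \<phi> where X: "X0_approx s \<Omega> u H \<phi>" using X0_obtain_approx[OF s b u] by blast
    then have H: "has_weak_gradient u H" and \<phi>: "\<And>k. test_fun \<Omega> (\<phi> k)"
      and lim: "(\<lambda>k. \<integral>\<^sup>+x. ennreal ((norm (H x - grad (\<phi> k) x))\<^sup>2) \<partial>lebesgue) \<longlonglongrightarrow> 0"
      and ae: "AE x in lebesgue. (\<lambda>k. \<phi> k x) \<longlonglongrightarrow> u x"
      by (auto simp: X0_approx_def)
    note Hm = has_weak_gradient_measurable[OF H]
    have HF: "(\<integral>\<^sup>+x. ennreal ((norm (H x))\<^sup>2) \<partial>lebesgue) \<le> ennreal F"
    proof -
      have "(\<integral>\<^sup>+x. ennreal ((norm (H x))\<^sup>2) \<partial>lebesgue) = (\<integral>\<^sup>+x. ennreal ((norm (G x))\<^sup>2) \<partial>lebesgue)"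
        by (rule nn_integral_cong_AE, rule eventually_mono[OF has_weak_gradient_unique[OF H G]]) simp
      then show ?thesis using GF by simp
    qed
    have "\<forall>\<^sub>F k in sequentially. (\<integral>\<^sup>+x. ennreal ((norm (H x - grad (\<phi> k) x))\<^sup>2) \<partial>lebesgue) < ennreal F"
      using order_tendstoD(2)[OF lim, of "ennreal F"] F by simp
    \<comment> \<open>Since \<open>F > 0\<close>, the error is eventually below \<open>F\<close>; by
      \<open>(a+b)^2 \<le> 2 a^2 + 2 b^2\<close> the approximants have energy at most
      \<open>4 F\<close>, hence the constant \<open>4 * C\<close>.\<close>
    then have ev: "\<forall>\<^sub>F k in sequentially. (\<integral>\<^sup>+x. ennreal (\<bar>\<phi> k x\<bar> powr ?s) \<partial>lebesgue) \<le> ennreal ((4 * C * F) powr ?r)"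
    proof eventually_elim
      case (elim k)
      note gm = grad_measurable_lebesgue[OF \<phi>[of k]]
      have "(\<integral>\<^sup>+x. ennreal ((norm (grad (\<phi> k) x))\<^sup>2) \<partial>lebesgue)
        \<le> (\<integral>\<^sup>+x. ennreal 2 * ennreal ((norm (H x))\<^sup>2) + ennreal 2 * ennreal ((norm (H x - grad (\<phi> k) x))\<^sup>2) \<partial>lebesgue)"
      proof (rule nn_integral_mono)
        fix x
        have "norm (grad (\<phi> k) x) \<le> norm (H x) + norm (H x - grad (\<phi> k) x)"
          using norm_triangle_ineq4[of "H x" "H x - grad (\<phi> k) x"] by simp
        then have "ennreal ((norm (grad (\<phi> k) x))\<^sup>2) \<le> ennreal ((norm (H x) + norm (H x - grad (\<phi> k) x))\<^sup>2)"
          by (intro ennreal_leI power_mono) auto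
        then show "ennreal ((norm (grad (\<phi> k) x))\<^sup>2) \<le> ennreal 2 * ennreal ((norm (H x))\<^sup>2) + ennreal 2 * ennreal ((norm (H x - grad (\<phi> k) x))\<^sup>2)"
          using ennreal_square_add_le order_trans by blast
      qed
      also have "\<dots> = ennreal 2 * (\<integral>\<^sup>+x. ennreal ((norm (H x))\<^sup>2) \<partial>lebesgue) + ennreal 2 * (\<integral>\<^sup>+x. ennreal ((norm (H x - grad (\<phi> k) x))\<^sup>2) \<partial>lebesgue)"
      proof -
        have "(\<lambda>x. ennreal ((norm (H x))\<^sup>2)) \<in> borel_measurable lebesgue" "(\<lambda>x. ennreal ((norm (H x - grad (\<phi> k) x))\<^sup>2)) \<in> borel_measurable lebesgue"
          using Hm gm by measurable
        then show ?thesis by (simp add: nn_integral_add nn_integral_cmult)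
      qed
      also have "\<dots> \<le> ennreal 2 * ennreal F + ennreal 2 * ennreal F"
        using elim HF by (intro add_mono mult_left_mono) auto
      also have "\<dots> = ennreal (2 * F) + ennreal (2 * F)" by (simp only: ennreal_mult' zero_le_numeral)
      also have "\<dots> = ennreal (2 * F + 2 * F)" by (rule ennreal_plus[symmetric]) (use F in auto)
      also have "2 * F + 2 * F = 4 * F" by simp
      finally have "(\<integral>\<^sup>+x. ennreal (\<bar>\<phi> k x\<bar> powr ?s) \<partial>lebesgue) \<le> ennreal ((C * (4 * F)) powr ?r)"
        using C(2)[OF test_fun_UNIV[OF \<phi>[of k]], of "4 * F"] F by simp
      then show ?case by (simp add: mult_ac)
    qed
    have pm: "(\<lambda>x. ennreal (\<bar>\<phi> k x\<bar> powr ?s)) \<in> borel_measurable lebesgue" for k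
      using test_fun_measurable_lebesgue[OF \<phi>[of k]] by measurable
    have "(\<integral>\<^sup>+x. ennreal (\<bar>u x\<bar> powr ?s) \<partial>lebesgue) = (\<integral>\<^sup>+x. liminf (\<lambda>k. ennreal (\<bar>\<phi> k x\<bar> powr ?s)) \<partial>lebesgue)"
    proof (rule nn_integral_cong_AE)
      show "AE x in lebesgue. ennreal (\<bar>u x\<bar> powr ?s) = liminf (\<lambda>k. ennreal (\<bar>\<phi> k x\<bar> powr ?s))"
        using ae
      proof eventually_elim
        case (elim x)
        have "(\<lambda>k. \<bar>\<phi> k x\<bar> powr ?s) \<longlonglongrightarrow> \<bar>u x\<bar> powr ?s"
          by (rule tendsto_powr'[OF tendsto_rabs[OF elim] tendsto_const]) (use pos in auto)
        from lim_imp_Liminf[OF _ tendsto_ennrealI[OF this]] show ?case by simp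
      qed
    qed
    also have "\<dots> \<le> liminf (\<lambda>k. \<integral>\<^sup>+x. ennreal (\<bar>\<phi> k x\<bar> powr ?s) \<partial>lebesgue)"
      by (rule nn_integral_liminf[OF pm])
    also have "\<dots> \<le> limsup (\<lambda>k. \<integral>\<^sup>+x. ennreal (\<bar>\<phi> k x\<bar> powr ?s) \<partial>lebesgue)"
      by (rule Liminf_le_Limsup) simp
    also have "\<dots> \<le> ennreal ((4 * C * F) powr ?r)"
      by (rule Limsup_bounded[OF ev])
    finally show ?thesis .
  qed
  show ?thesis by (rule exI[of _ "4 * C"]) (use main C(1) in auto)
qed

section \<open>Closure of the energy space under composition with smooth contractions\<close>

lemma AE_lebesgue2I:
  assumes "AE x in lebesgue. P x"
  shows "AE z in lebesgue2. P (fst z) \<and> P (snd z)"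
proof -
  obtain N where N: "{x. \<not> P x} \<subseteq> N" "N \<in> null_sets lebesgue"
    using assms unfolding eventually_ae_filter by auto
  have Ns: "N \<in> sets lebesgue" using N(2) by auto
  have notin: "AE x in lebesgue. x \<notin> N" by (rule AE_not_in[OF N(2)])
  have "AE z in lebesgue2. fst z \<notin> N \<and> snd z \<notin> N"
  proof (rule lebesgue_pair.AE_pair_measure)
    have "UNIV - N \<in> sets lebesgue" using sets.compl_sets[OF Ns] by simp
    from pair_measureI[OF this this] have "(UNIV - N) \<times> (UNIV - N) \<in> sets lebesgue2" .
    moreover have "{z \<in> space lebesgue2. fst z \<notin> N \<and> snd z \<notin> N} = (UNIV - N) \<times> (UNIV - N)"
      by (auto simp: space_pair_measure)
    ultimately show "{z \<in> space lebesgue2. fst z \<notin> N \<and> snd z \<notin> N} \<in> sets lebesgue2" by simp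
    show "AE x in lebesgue. AE y in lebesgue. fst (x, y) \<notin> N \<and> snd (x, y) \<notin> N"
      using notin
    proof eventually_elim
      case (elim x)
      from notin show ?case by eventually_elim (use elim in simp)
    qed
  qed
  then show ?thesis by eventually_elim (use N(1) in auto)
qed

text \<open>Dominated convergence with majorant \<open>4 U\<close>. Convergence is asked only where
  \<open>U \<noteq> 0\<close>, because the factor will also be a difference quotient
  \<open>(h a - h c) / (a - c)\<close>, whose limit is out of control at \<open>a = c\<close>,
  exactly where the weight vanishes.\<close>

lemma nn_integral_tendsto_0_factor:
  fixes M :: "nat \<Rightarrow> 'b \<Rightarrow> real" and U :: "'b \<Rightarrow> ennreal"
  assumes m[measurable]: "\<And>k. M k \<in> borel_measurable N" "L \<in> borel_measurable N" "U \<in> borel_measurable N"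
    and b: "\<And>k z. \<bar>M k z\<bar> \<le> 1" "\<And>z. \<bar>L z\<bar> \<le> 1" and U: "(\<integral>\<^sup>+z. U z \<partial>N) < \<infinity>"
    and lim: "AE z in N. U z \<noteq> 0 \<longrightarrow> (\<lambda>k. M k z) \<longlonglongrightarrow> L z"
  shows "(\<lambda>k. \<integral>\<^sup>+z. ennreal ((L z - M k z)\<^sup>2) * U z \<partial>N) \<longlonglongrightarrow> 0"
proof -
  have Ufin: "AE z in N. U z \<noteq> \<infinity>" using U by (intro nn_integral_PInf_AE) auto
  have "(\<lambda>k. \<integral>\<^sup>+z. ennreal ((L z - M k z)\<^sup>2) * U z \<partial>N) \<longlonglongrightarrow> (\<integral>\<^sup>+z. 0 \<partial>N)"
  proof (rule nn_integral_dominated_convergence)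
    show "AE z in N. ennreal ((L z - M k z)\<^sup>2) * U z \<le> ennreal 4 * U z" for k
    proof (intro AE_I2 mult_right_mono ennreal_leI)
      fix z
      have "\<bar>L z - M k z\<bar> \<le> 2" using b(1)[of k z] b(2)[of z] by linarith
      then have "(L z - M k z)\<^sup>2 \<le> 2\<^sup>2" using abs_le_square_iff[of "L z - M k z" 2] by simp
      then show "(L z - M k z)\<^sup>2 \<le> 4" by simp
    qed simp
    show "(\<integral>\<^sup>+z. ennreal 4 * U z \<partial>N) < \<infinity>" using U by (simp add: nn_integral_cmult ennreal_mult_less_top)
    show "AE z in N. (\<lambda>k. ennreal ((L z - M k z)\<^sup>2) * U z) \<longlonglongrightarrow> 0"
      using lim Ufin
    proof eventually_elim
      case (elim z)
      show ?case
      proof (cases "U z = 0")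
        case False
        with elim have "(\<lambda>k. M k z) \<longlonglongrightarrow> L z" by simp
        from tendsto_power[OF tendsto_diff[OF tendsto_const[of "L z"] this], of 2]
        have "(\<lambda>k. ennreal ((L z - M k z)\<^sup>2)) \<longlonglongrightarrow> ennreal 0" by (intro tendsto_ennrealI) simp
        from ennreal_tendsto_cmult[OF _ this, of "U z"] elim(2) show ?thesis
          by (simp add: mult.commute less_top)
      qed simp
    qed
  qed (use m in measurable)
  then show ?thesis by simp
qed

lemma lipschitz_1_of_deriv:
  fixes h h' :: "real \<Rightarrow> real"
  assumes "\<And>t. (h has_real_derivative h' t) (at t)" "\<And>t. \<bar>h' t\<bar> \<le> 1"
  shows "\<bar>h a - h b\<bar> \<le> \<bar>a - b\<bar>"
proof -
  have "\<bar>h d - h c\<bar> \<le> \<bar>d - c\<bar>" if cd: "c < d" for c d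
  proof -
    obtain z where "h d - h c = (d - c) * h' z" using MVT2[OF cd assms(1)] by blast
    then show ?thesis using assms(2)[of z] mult_left_le[of "\<bar>h' z\<bar>" "\<bar>d - c\<bar>"] by (simp add: abs_mult)
  qed
  from this[of a b] this[of b a] show ?thesis
    by (cases a b rule: linorder_cases) (auto simp: abs_minus_commute)
qed

lemma test_fun_compose:
  assumes \<phi>: "test_fun U \<phi>" and h: "\<And>t. (h has_real_derivative h' t) (at t)" and h0: "h 0 = 0"
    and Ck: "\<And>k. Ck k (\<lambda>x. h (\<phi> x))"
  shows "test_fun U (\<lambda>x. h (\<phi> x))" and "grad (\<lambda>x. h (\<phi> x)) x = h' (\<phi> x) *\<^sub>R grad \<phi> x"
proof -
  show "test_fun U (\<lambda>x. h (\<phi> x))"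
  proof (rule test_funI[where K = "closure {x. \<phi> x \<noteq> 0}"])
    show "x \<in> closure {x. \<phi> x \<noteq> 0}" if "h (\<phi> x) \<noteq> 0" for x
      using that h0 closure_subset[of "{x. \<phi> x \<noteq> 0}"] by (cases "\<phi> x = 0") auto
  qed (use \<phi> Ck in \<open>auto simp: test_fun_def C_inf_def\<close>)
  have "((\<lambda>x. h (\<phi> x)) has_derivative (\<lambda>v. h' (\<phi> x) * frechet_derivative \<phi> (at x) v)) (at x)"
    using has_derivative_compose[OF test_fun_has_derivative[OF \<phi>, of x] h[unfolded has_field_derivative_def]] by simp
  from frechet_derivative_at[OF this, symmetric]
  show "grad (\<lambda>x. h (\<phi> x)) x = h' (\<phi> x) *\<^sub>R grad \<phi> x"
    by (simp add: grad_def scaleR_sum_right)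
qed

text \<open>Chain rule in the energy space: since \<open>h\<close> is smooth and
  \<open>h 0 = 0\<close>, the compositions of \<open>h\<close> with the approximants of
  \<open>u\<close> are test functions, and they converge in both parts of \<open>eta2\<close>. The
  assumption \<open>Ck\<close> expresses smoothness of \<open>h\<close> by its effect on
  compositions.\<close>

lemma X0_compose:
  fixes u :: "'a::euclidean_space \<Rightarrow> real" and h h' :: "real \<Rightarrow> real"
  assumes s: "s > 0" and b: "bounded \<Omega>" and u: "X0 s \<Omega> u"
    and h: "\<And>t. (h has_real_derivative h' t) (at t)" and h'c: "continuous_on UNIV h'"
    and h'1: "\<And>t. \<bar>h' t\<bar> \<le> 1" and h0: "h 0 = 0"
    and Ck: "\<And>k (\<phi> :: 'a \<Rightarrow> real). Ck k \<phi> \<Longrightarrow> Ck k (\<lambda>x. h (\<phi> x))"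
  shows "X0 s \<Omega> (\<lambda>x. h (u x))" and "AE x in lebesgue. wgrad (\<lambda>x. h (u x)) x = h' (u x) *\<^sub>R wgrad u x"
proof -
  have um: "u \<in> borel_measurable lebesgue" and u0: "AE x in lebesgue. x \<notin> \<Omega> \<longrightarrow> u x = 0"
    and u2: "integrable lebesgue (\<lambda>x. (u x)\<^sup>2)" using u by (simp_all add: X0_def)
  obtain H \<phi> where "X0_approx s \<Omega> u H \<phi>" using X0_obtain_approx[OF s b u] by blast
  then have H: "has_weak_gradient u H" and eta: "eta2 s u H < \<infinity>" and \<phi>: "\<And>k. test_fun \<Omega> (\<phi> k)"
    and L1: "(\<lambda>k. \<integral>\<^sup>+x. ennreal ((norm (H x - grad (\<phi> k) x))\<^sup>2) \<partial>lebesgue) \<longlonglongrightarrow> 0"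
    and L2: "(\<lambda>k. gagliardo2 s (\<lambda>x. u x - \<phi> k x)) \<longlonglongrightarrow> 0"
    and L3: "(\<lambda>k. \<integral>\<^sup>+x. ennreal ((u x - \<phi> k x)\<^sup>2) \<partial>lebesgue) \<longlonglongrightarrow> 0"
    and ae: "AE x in lebesgue. (\<lambda>k. \<phi> k x) \<longlonglongrightarrow> u x"
    by (auto simp: X0_approx_def)
  define b where "b = real DIM('a) + 2 * s"
  have hc: "continuous_on UNIV h" using h by (intro continuous_at_imp_continuous_on) (auto intro: DERIV_isCont)
  have hm[measurable]: "h \<in> borel_measurable borel" "h' \<in> borel_measurable borel"
    by (intro borel_measurable_continuous_onI hc h'c)+
  have h_isCont: "isCont h t" "isCont h' t" for t
    using hc h'c by (auto simp: continuous_on_eq_continuous_at)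
  note lip = lipschitz_1_of_deriv[OF h h'1]
  have \<phi>m: "\<phi> k \<in> borel_measurable lebesgue" and gm: "grad (\<phi> k) \<in> borel_measurable lebesgue" for k
    using test_fun_measurable_lebesgue[OF \<phi>] grad_measurable_lebesgue[OF \<phi>] by auto
  note Hm = has_weak_gradient_measurable[OF H]
  have hum: "(\<lambda>x. h (u x)) \<in> borel_measurable lebesgue" "(\<lambda>x. h' (u x)) \<in> borel_measurable lebesgue"
    using um by measurable
  have h\<phi>m: "(\<lambda>x. h (\<phi> k x)) \<in> borel_measurable lebesgue" "(\<lambda>x. h' (\<phi> k x)) \<in> borel_measurable lebesgue" for k
    using \<phi>m[of k] by measurable
  let ?K = "\<lambda>x. h' (u x) *\<^sub>R H x"
  have Km: "?K \<in> borel_measurable lebesgue" using hum(2) Hm by measurable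
  note th = test_fun_compose[OF \<phi> h h0 Ck[OF test_fun_Ck[OF \<phi>]]]
  have Hfin: "(\<integral>\<^sup>+x. ennreal ((norm (H x))\<^sup>2) \<partial>lebesgue) < \<infinity>" and ufin: "gagliardo2 s u < \<infinity>"
    using eta by (auto simp: eta2_def)

  have G1: "(\<lambda>k. \<integral>\<^sup>+x. ennreal ((norm (?K x - grad (\<lambda>x. h (\<phi> k x)) x))\<^sup>2) \<partial>lebesgue) \<longlonglongrightarrow> 0"
  proof -
    \<comment> \<open>The gradient error splits into \<open>h'(\<phi>) (H - grad \<phi>)\<close> and
      \<open>(h'(u) - h'(\<phi>)) H\<close>. The first is small because \<open>|h'| \<le> 1\<close>;
      the energy of the second is \<open>A\<close>, which tends to 0 by dominated convergence with
      weight \<open>|H|^2\<close>.\<close>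
    define A where "A k = (\<integral>\<^sup>+x. ennreal ((h' (u x) - h' (\<phi> k x))\<^sup>2) * ennreal ((norm (H x))\<^sup>2) \<partial>lebesgue)" for k
    have A0: "A \<longlonglongrightarrow> 0"
      unfolding A_def
    proof (rule nn_integral_tendsto_0_factor[OF h\<phi>m(2) hum(2)])
      show "(\<lambda>x. ennreal ((norm (H x))\<^sup>2)) \<in> borel_measurable lebesgue" using Hm by measurable
      show "AE x in lebesgue. ennreal ((norm (H x))\<^sup>2) \<noteq> 0 \<longrightarrow> (\<lambda>k. h' (\<phi> k x)) \<longlonglongrightarrow> h' (u x)"
        using ae by eventually_elim (intro impI isCont_tendsto_compose[OF h_isCont(2)])
    qed (use h'1 Hfin in auto)
    have le: "(\<integral>\<^sup>+x. ennreal ((norm (?K x - grad (\<lambda>x. h (\<phi> k x)) x))\<^sup>2) \<partial>lebesgue)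
       \<le> ennreal 2 * (\<integral>\<^sup>+x. ennreal ((norm (H x - grad (\<phi> k) x))\<^sup>2) \<partial>lebesgue) + ennreal 2 * A k" for k
    proof -
      have "(\<integral>\<^sup>+x. ennreal ((norm (?K x - grad (\<lambda>x. h (\<phi> k x)) x))\<^sup>2) \<partial>lebesgue)
        \<le> (\<integral>\<^sup>+x. ennreal 2 * ennreal ((norm (H x - grad (\<phi> k) x))\<^sup>2)
            + ennreal 2 * (ennreal ((h' (u x) - h' (\<phi> k x))\<^sup>2) * ennreal ((norm (H x))\<^sup>2)) \<partial>lebesgue)"
      proof (rule nn_integral_mono)
        fix x
        have "?K x - grad (\<lambda>x. h (\<phi> k x)) x = h' (\<phi> k x) *\<^sub>R (H x - grad (\<phi> k) x) + (h' (u x) - h' (\<phi> k x)) *\<^sub>R H x"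
          by (simp add: th(2) algebra_simps)
        then have "norm (?K x - grad (\<lambda>x. h (\<phi> k x)) x)
            \<le> \<bar>h' (\<phi> k x)\<bar> * norm (H x - grad (\<phi> k) x) + \<bar>h' (u x) - h' (\<phi> k x)\<bar> * norm (H x)"
          using norm_triangle_ineq[of "h' (\<phi> k x) *\<^sub>R (H x - grad (\<phi> k) x)" "(h' (u x) - h' (\<phi> k x)) *\<^sub>R H x"] by simp
        also have "\<dots> \<le> norm (H x - grad (\<phi> k) x) + \<bar>h' (u x) - h' (\<phi> k x)\<bar> * norm (H x)"
          using h'1[of "\<phi> k x"] by (intro add_right_mono mult_left_le_one_le) auto
        finally have "ennreal ((norm (?K x - grad (\<lambda>x. h (\<phi> k x)) x))\<^sup>2)
            \<le> ennreal ((norm (H x - grad (\<phi> k) x) + \<bar>h' (u x) - h' (\<phi> k x)\<bar> * norm (H x))\<^sup>2)"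
          by (intro ennreal_leI power_mono) auto
        also have "\<dots> \<le> ennreal 2 * ennreal ((norm (H x - grad (\<phi> k) x))\<^sup>2) + ennreal 2 * ennreal ((\<bar>h' (u x) - h' (\<phi> k x)\<bar> * norm (H x))\<^sup>2)"
          by (rule ennreal_square_add_le)
        finally show "ennreal ((norm (?K x - grad (\<lambda>x. h (\<phi> k x)) x))\<^sup>2) \<le> ennreal 2 * ennreal ((norm (H x - grad (\<phi> k) x))\<^sup>2)
            + ennreal 2 * (ennreal ((h' (u x) - h' (\<phi> k x))\<^sup>2) * ennreal ((norm (H x))\<^sup>2))"
          by (simp add: power_mult_distrib ennreal_mult)
      qed
      also have "\<dots> = ennreal 2 * (\<integral>\<^sup>+x. ennreal ((norm (H x - grad (\<phi> k) x))\<^sup>2) \<partial>lebesgue) + ennreal 2 * A k"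
      proof -
        have m: "(\<lambda>x. ennreal ((norm (H x - grad (\<phi> k) x))\<^sup>2)) \<in> borel_measurable lebesgue"
          "(\<lambda>x. ennreal ((h' (u x) - h' (\<phi> k x))\<^sup>2) * ennreal ((norm (H x))\<^sup>2)) \<in> borel_measurable lebesgue"
          using Hm gm[of k] hum(2) h\<phi>m(2)[of k] by measurable
        show ?thesis
          unfolding A_def nn_integral_cmult[OF m(1), symmetric] nn_integral_cmult[OF m(2), symmetric]
          by (rule nn_integral_add; rule borel_measurable_times_ennreal; (rule borel_measurable_const m)?)
      qed
      finally show ?thesis .
    qed
    have "(\<lambda>k. ennreal 2 * (\<integral>\<^sup>+x. ennreal ((norm (H x - grad (\<phi> k) x))\<^sup>2) \<partial>lebesgue) + ennreal 2 * A k) \<longlonglongrightarrow> 0 + 0"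
      by (intro tendsto_add ennreal_tendsto_0_cmult L1 A0)
    from ennreal_tendsto_0_mono[OF this[unfolded add_0_right] le] show ?thesis .
  qed

  have G2: "(\<lambda>k. gagliardo2 s (\<lambda>x. h (u x) - h (\<phi> k x))) \<longlonglongrightarrow> 0"
  proof -
    \<comment> \<open>The divided difference plays the part of \<open>h'\<close> in the nonlocal
      term and allows the same splitting. For \<open>a = c\<close> division by zero gives
      \<open>m a c = 0\<close>, and \<open>h a - h c = m a c * (a - c)\<close> still holds.\<close>
    define m where "m a c = (h a - h c) / (a - c)" for a c
    have m: "h a - h c = m a c * (a - c)" for a c by (simp add: m_def)
    have m1: "\<bar>m a c\<bar> \<le> 1" for a c
    proof (cases "a = c")
      case False
      then show ?thesis using lip[of a c] by (simp add: m_def abs_divide divide_le_eq)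
    qed (simp add: m_def)
    define U where "U z = ennreal ((u (fst z) - u (snd z))\<^sup>2 / norm (fst z - snd z) powr b)" for z
    define W where "W k z = ennreal (((u (fst z) - \<phi> k (fst z)) - (u (snd z) - \<phi> k (snd z)))\<^sup>2 / norm (fst z - snd z) powr b)" for k z
    define A where "A k = (\<integral>\<^sup>+z. ennreal ((m (u (fst z)) (u (snd z)) - m (\<phi> k (fst z)) (\<phi> k (snd z)))\<^sup>2) * U z \<partial>lebesgue2)" for k
    note [measurable] = measurable_comp_fst_snd[OF um] measurable_comp_fst_snd[OF \<phi>m]
    have mm: "(\<lambda>z. m (u (fst z)) (u (snd z))) \<in> borel_measurable lebesgue2"
      "\<And>k. (\<lambda>z. m (\<phi> k (fst z)) (\<phi> k (snd z))) \<in> borel_measurable lebesgue2"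
      unfolding m_def by measurable
    have Um: "U \<in> borel_measurable lebesgue2" unfolding U_def by (rule gagliardo_integrand_measurable[OF um])
    have dm: "(\<lambda>x. u x - \<phi> k x) \<in> borel_measurable lebesgue" for k using um \<phi>m[of k] by measurable
    have Wm: "W k \<in> borel_measurable lebesgue2" for k
      unfolding W_def using gagliardo_integrand_measurable[OF dm] .
    have A0: "A \<longlonglongrightarrow> 0"
      unfolding A_def
    proof (rule nn_integral_tendsto_0_factor[OF mm(2) mm(1) Um m1 m1])
      show "(\<integral>\<^sup>+z. U z \<partial>lebesgue2) < \<infinity>" using ufin by (simp add: U_def gagliardo2_def b_def)
      show "AE z in lebesgue2. U z \<noteq> 0 \<longrightarrow> (\<lambda>k. m (\<phi> k (fst z)) (\<phi> k (snd z))) \<longlonglongrightarrow> m (u (fst z)) (u (snd z))"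
        using AE_lebesgue2I[OF ae]
      proof eventually_elim
        case (elim z)
        show ?case
        proof
          assume "U z \<noteq> 0"
          then have "u (fst z) - u (snd z) \<noteq> 0" by (auto simp: U_def)
          then show "(\<lambda>k. m (\<phi> k (fst z)) (\<phi> k (snd z))) \<longlonglongrightarrow> m (u (fst z)) (u (snd z))"
            unfolding m_def using elim
            by (intro tendsto_divide tendsto_diff isCont_tendsto_compose[OF h_isCont(1)]) auto
        qed
      qed
    qed
    have le: "gagliardo2 s (\<lambda>x. h (u x) - h (\<phi> k x)) \<le> ennreal 2 * gagliardo2 s (\<lambda>x. u x - \<phi> k x) + ennreal 2 * A k" for k
    proof -
      have "gagliardo2 s (\<lambda>x. h (u x) - h (\<phi> k x)) \<le> (\<integral>\<^sup>+z. ennreal 2 * W k z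
          + ennreal 2 * (ennreal ((m (u (fst z)) (u (snd z)) - m (\<phi> k (fst z)) (\<phi> k (snd z)))\<^sup>2) * U z) \<partial>lebesgue2)"
        unfolding gagliardo2_def b_def[symmetric]
      proof (rule nn_integral_mono)
        fix z :: "'a \<times> 'a"
        define N where "N = norm (fst z - snd z) powr b"
        have N: "N \<ge> 0" by (simp add: N_def)
        define p q where "p = m (u (fst z)) (u (snd z))" and "q = m (\<phi> k (fst z)) (\<phi> k (snd z))"
        define w d where "w = (u (fst z) - \<phi> k (fst z)) - (u (snd z) - \<phi> k (snd z))" and "d = u (fst z) - u (snd z)"
        have "(h (u (fst z)) - h (\<phi> k (fst z))) - (h (u (snd z)) - h (\<phi> k (snd z)))
          = (h (u (fst z)) - h (u (snd z))) - (h (\<phi> k (fst z)) - h (\<phi> k (snd z)))" by simp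
        also have "\<dots> = q * w + (p - q) * d"
          unfolding m by (simp add: p_def q_def w_def d_def algebra_simps)
        finally have "((h (u (fst z)) - h (\<phi> k (fst z))) - (h (u (snd z)) - h (\<phi> k (snd z))))\<^sup>2 / N = (q * w + (p - q) * d)\<^sup>2 / N" by simp
        also have "\<dots> \<le> (2 * w\<^sup>2 + 2 * ((p - q)\<^sup>2 * d\<^sup>2)) / N"
        proof (rule divide_right_mono[OF _ N])
          have "(q * w + (p - q) * d)\<^sup>2 \<le> 2 * (q * w)\<^sup>2 + 2 * ((p - q) * d)\<^sup>2"
            using sum_squares_bound[of "q * w" "(p - q) * d"] by (simp add: power2_sum)
          moreover have "q\<^sup>2 \<le> 1" using m1[of "\<phi> k (fst z)" "\<phi> k (snd z)"] by (simp add: q_def abs_square_le_1)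
          then have "(q * w)\<^sup>2 \<le> w\<^sup>2" by (simp add: power_mult_distrib mult_left_le_one_le)
          ultimately show "(q * w + (p - q) * d)\<^sup>2 \<le> 2 * w\<^sup>2 + 2 * ((p - q)\<^sup>2 * d\<^sup>2)"
            by (simp add: power_mult_distrib)
        qed
        also have "\<dots> = 2 * (w\<^sup>2 / N) + 2 * ((p - q)\<^sup>2 * (d\<^sup>2 / N))" by (simp add: add_divide_distrib)
        finally have "ennreal (((h (u (fst z)) - h (\<phi> k (fst z))) - (h (u (snd z)) - h (\<phi> k (snd z))))\<^sup>2 / N)
          \<le> ennreal (2 * (w\<^sup>2 / N) + 2 * ((p - q)\<^sup>2 * (d\<^sup>2 / N)))" by (rule ennreal_leI)
        also have "\<dots> = ennreal (2 * (w\<^sup>2 / N)) + ennreal (2 * ((p - q)\<^sup>2 * (d\<^sup>2 / N)))"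
          by (rule ennreal_plus) (use N in auto)
        also have "\<dots> = ennreal 2 * ennreal (w\<^sup>2 / N) + ennreal 2 * (ennreal ((p - q)\<^sup>2) * ennreal (d\<^sup>2 / N))"
          by (simp only: ennreal_mult' zero_le_numeral zero_le_power2)
        finally show "ennreal (((h (u (fst z)) - h (\<phi> k (fst z))) - (h (u (snd z)) - h (\<phi> k (snd z))))\<^sup>2 / norm (fst z - snd z) powr b)
          \<le> ennreal 2 * W k z + ennreal 2 * (ennreal ((m (u (fst z)) (u (snd z)) - m (\<phi> k (fst z)) (\<phi> k (snd z)))\<^sup>2) * U z)"
          by (simp only: W_def U_def N_def p_def q_def w_def d_def)
      qed
      also have "\<dots> = ennreal 2 * (\<integral>\<^sup>+z. W k z \<partial>lebesgue2) + ennreal 2 * A k"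
      proof -
        have mA: "(\<lambda>z. ennreal ((m (u (fst z)) (u (snd z)) - m (\<phi> k (fst z)) (\<phi> k (snd z)))\<^sup>2) * U z) \<in> borel_measurable lebesgue2"
          using mm Um by measurable
        show ?thesis
          unfolding A_def nn_integral_cmult[OF mA, symmetric] nn_integral_cmult[OF Wm, symmetric]
          by (rule nn_integral_add; rule borel_measurable_times_ennreal; (rule borel_measurable_const Wm mA)?)
      qed
      also have "(\<integral>\<^sup>+z. W k z \<partial>lebesgue2) = gagliardo2 s (\<lambda>x. u x - \<phi> k x)"
        by (simp add: gagliardo2_def W_def b_def)
      finally show ?thesis .
    qed
    have "(\<lambda>k. ennreal 2 * gagliardo2 s (\<lambda>x. u x - \<phi> k x) + ennreal 2 * A k) \<longlonglongrightarrow> 0 + 0"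
      by (intro tendsto_add ennreal_tendsto_0_cmult L2 A0)
    from ennreal_tendsto_0_mono[OF this[unfolded add_0_right] le] show ?thesis .
  qed

  have le_u: "\<bar>h t\<bar> \<le> \<bar>t\<bar>" for t using lip[of t 0] h0 by simp
  have sq_le: "ennreal ((h t)\<^sup>2) \<le> ennreal (t\<^sup>2)" for t
    using le_u[of t] by (intro ennreal_leI) (simp add: abs_le_square_iff[symmetric])
  have K_le: "norm (?K x) \<le> norm (H x)" for x
    using h'1[of "u x"] by (simp add: mult_left_le_one_le)
  have Kfin: "(\<integral>\<^sup>+x. ennreal ((norm (?K x))\<^sup>2) \<partial>lebesgue) < \<infinity>"
    by (rule le_less_trans[OF nn_integral_mono Hfin]) (intro ennreal_leI power_mono K_le norm_ge_zero)
  have u2fin: "(\<integral>\<^sup>+x. ennreal ((u x)\<^sup>2) \<partial>lebesgue) < \<infinity>" using u2 by (simp add: integrable_iff_bounded)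
  have hu2fin: "(\<integral>\<^sup>+x. ennreal ((h (u x))\<^sup>2) \<partial>lebesgue) < \<infinity>"
    by (rule le_less_trans[OF nn_integral_mono u2fin]) (rule sq_le)
  have wg: "has_weak_gradient (\<lambda>x. h (u x)) ?K"
  proof (rule has_weak_gradient_closed[OF h\<phi>m(1) test_fun_has_weak_gradient[OF th(1)] hum(1) Km hu2fin Kfin _ G1])
    show "(\<lambda>k. \<integral>\<^sup>+x. ennreal ((h (u x) - h (\<phi> k x))\<^sup>2) \<partial>lebesgue) \<longlonglongrightarrow> 0"
    proof (rule ennreal_tendsto_0_mono[OF L3], rule nn_integral_mono, rule ennreal_leI)
      show "(h (u x) - h (\<phi> k x))\<^sup>2 \<le> (u x - \<phi> k x)\<^sup>2" for k x
        using lip[of "u x" "\<phi> k x"] by (simp add: abs_le_square_iff)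
    qed
  qed
  have gag: "gagliardo2 s (\<lambda>x. h (u x)) \<le> gagliardo2 s u"
    unfolding gagliardo2_def
  proof (rule nn_integral_mono, rule ennreal_leI, rule divide_right_mono)
    show "(h (u (fst z)) - h (u (snd z)))\<^sup>2 \<le> (u (fst z) - u (snd z))\<^sup>2" for z
      using lip[of "u (fst z)" "u (snd z)"] by (simp add: abs_le_square_iff)
  qed simp
  show "X0 s \<Omega> (\<lambda>x. h (u x))"
    unfolding X0_def
  proof (intro conjI exI[of _ ?K] exI[of _ "\<lambda>k x. h (\<phi> k x)"] allI)
    show "AE x in lebesgue. x \<notin> \<Omega> \<longrightarrow> h (u x) = 0" using u0 by eventually_elim (use h0 in auto)
    show "integrable lebesgue (\<lambda>x. (h (u x))\<^sup>2)"
      using hu2fin hum(1) by (intro integrableI_bounded) auto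
    show "eta2 s (\<lambda>x. h (u x)) ?K < \<infinity>"
      unfolding eta2_def using Kfin le_less_trans[OF gag ufin] by simp
    show "(\<lambda>k. eta2 s (\<lambda>x. h (u x) - h (\<phi> k x)) (\<lambda>x. ?K x - grad (\<lambda>x. h (\<phi> k x)) x)) \<longlonglongrightarrow> 0"
      unfolding eta2_def using tendsto_add[OF G1 G2] by simp
  qed (use hum(1) wg th(1) in auto)
  show "AE x in lebesgue. wgrad (\<lambda>x. h (u x)) x = h' (u x) *\<^sub>R wgrad u x"
    using wgrad_AE_eq[OF wg] wgrad_AE_eq[OF H] by eventually_elim simp
qed

section \<open>Truncation and iteration\<close>

text \<open>A smooth substitute for the positive part of \<open>t - k\<close>: composing it with a test function gives a
  test function again.\<close>

definition smooth_trunc :: "real \<Rightarrow> real \<Rightarrow> real \<Rightarrow> real" where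
  "smooth_trunc k \<delta> t = \<delta> * flat [:1:] ((t - k) / \<delta>)"

definition smooth_trunc_deriv :: "real \<Rightarrow> real \<Rightarrow> real \<Rightarrow> real" where
  "smooth_trunc_deriv k \<delta> t = flat (flat_d [:1:]) ((t - k) / \<delta>)"

lemma smooth_trunc_has_derivative:
  assumes "\<delta> > 0"
  shows "(smooth_trunc k \<delta> has_real_derivative smooth_trunc_deriv k \<delta> t) (at t)"
proof -
  have "((\<lambda>t. (t - k) / \<delta>) has_real_derivative 1 / \<delta>) (at t)"
    using assms by (auto intro!: derivative_eq_intros)
  from DERIV_cmult[OF DERIV_chain2[OF flat_has_derivative this], of \<delta>]
  show ?thesis using assms by (simp add: smooth_trunc_def[abs_def] smooth_trunc_deriv_def)
qed

lemma continuous_on_smooth_trunc_deriv: "continuous_on UNIV (smooth_trunc_deriv k \<delta>)"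
proof -
  have "continuous_on UNIV (flat (flat_d [:1:]))"
    using DERIV_isCont[OF flat_has_derivative] by (simp add: continuous_on_eq_continuous_at)
  moreover have "continuous_on UNIV (\<lambda>t. (t - k) * inverse \<delta>)" by (intro continuous_intros)
  ultimately show ?thesis unfolding smooth_trunc_deriv_def[abs_def] divide_inverse
    by (rule continuous_on_compose2) simp
qed

text \<open>For \<open>x > 0\<close> the slope is \<open>(1 + 1/x) exp (-1/x)\<close>, at most 1 by
  \<open>1 + y \<le> exp y\<close>. This is the reason for building the truncation on
  \<open>t exp (-1/t)\<close>: composition with it does not increase the energy.\<close>

lemma smooth_trunc_deriv_bounds: "0 \<le> smooth_trunc_deriv k \<delta> t" "smooth_trunc_deriv k \<delta> t \<le> 1"
proof -
  have "0 \<le> flat (flat_d [:1:]) x \<and> flat (flat_d [:1:]) x \<le> 1" for x :: real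
  proof (cases "x > 0")
    case True
    have e: "flat (flat_d [:1:]) x = (1 + 1 / x) * exp (- (1 / x))"
      using True by (simp add: flat_def flat_d_def)
    have "1 + 1 / x \<le> exp (1 / x)" by (rule exp_ge_add_one_self)
    then have "(1 + 1 / x) * exp (- (1 / x)) \<le> exp (1 / x) * exp (- (1 / x))"
      by (rule mult_right_mono) simp
    then show ?thesis unfolding e using True by (simp add: exp_minus_inverse)
  qed (simp add: flat_def)
  then show "0 \<le> smooth_trunc_deriv k \<delta> t" "smooth_trunc_deriv k \<delta> t \<le> 1"
    by (auto simp: smooth_trunc_deriv_def)
qed

lemma smooth_trunc_eq_0: "t \<le> k \<Longrightarrow> \<delta> > 0 \<Longrightarrow> smooth_trunc k \<delta> t = 0"
  by (auto simp: smooth_trunc_def flat_def zero_less_divide_iff)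

lemma smooth_trunc_nonneg: "\<delta> > 0 \<Longrightarrow> 0 \<le> smooth_trunc k \<delta> t"
  by (auto simp: smooth_trunc_def flat_def zero_less_divide_iff)

lemma smooth_trunc_le: "t > k \<Longrightarrow> \<delta> > 0 \<Longrightarrow> smooth_trunc k \<delta> t \<le> t - k"
proof -
  assume a: "t > k" "\<delta> > 0"
  then have "smooth_trunc k \<delta> t = (t - k) * exp (- 1 / ((t - k) / \<delta>))" by (simp add: smooth_trunc_def flat_def)
  also have "\<dots> \<le> t - k" using a by (intro mult_left_le) auto
  finally show ?thesis .
qed

text \<open>From \<open>t \<ge> k + \<delta>\<close> on, the damping factor
  \<open>exp (- \<delta> / (t - k))\<close> is at least \<open>exp (-1)\<close>; so the gap
  \<open>\<delta>\<close> between two levels can serve as the width of the smoothing.\<close>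

lemma smooth_trunc_ge:
  assumes "t \<ge> k + \<delta>" "\<delta> > 0"
  shows "(t - k) * exp (-1) \<le> smooth_trunc k \<delta> t"
proof -
  have "smooth_trunc k \<delta> t = (t - k) * exp (- 1 / ((t - k) / \<delta>))" using assms by (simp add: smooth_trunc_def flat_def)
  moreover have "- 1 \<le> - 1 / ((t - k) / \<delta>)" using assms by (simp add: field_simps)
  ultimately show ?thesis using assms by (simp add: mult_left_mono)
qed

lemma Ck_smooth_trunc: "Ck m \<phi> \<Longrightarrow> Ck m (\<lambda>x. smooth_trunc k \<delta> (\<phi> x))"
proof -
  assume "Ck m \<phi>"
  then have "Ck m (\<lambda>x. (1 / \<delta>) * (\<phi> x + - k))" by (intro Ck_mult Ck_add Ck_const)
  from Ck_mult[OF Ck_const[of m \<delta>] Ck_flat[OF this, of "[:1:]"]]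
  show ?thesis by (simp add: smooth_trunc_def)
qed

lemma smooth_trunc_monotone:
  assumes "\<delta> > 0"
  shows "0 \<le> (a - c) * (smooth_trunc k \<delta> a - smooth_trunc k \<delta> c)"
proof -
  have mono: "smooth_trunc k \<delta> x \<le> smooth_trunc k \<delta> y" if "x \<le> y" for x y
    using DERIV_nonneg_imp_nondecreasing[OF that] smooth_trunc_has_derivative[OF assms] smooth_trunc_deriv_bounds(1) by blast
  show ?thesis using mono[of a c] mono[of c a] by (cases "a \<le> c") (auto simp: mult_nonpos_nonpos)
qed

section \<open>Decay of the tails: abstract iteration and estimate of the nonlinear term\<close>

text \<open>The Bochner integral of a non-integrable function is 0, so the bound holds in every
  case; the right-hand side of the equation can thus be estimated before anything is known about its
  integrability.\<close>

lemma ennreal_integral_le_nn_integral: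
  assumes "\<And>x. 0 \<le> f x"
  shows "ennreal (integral\<^sup>L M f) \<le> (\<integral>\<^sup>+x. ennreal (f x) \<partial>M)"
proof (cases "integrable M f")
  case True
  then show ?thesis using nn_integral_eq_integral[OF True] assms by simp
qed (simp add: not_integrable_integral_eq)

text \<open>The rate \<open>\<rho>\<close> with \<open>\<Lambda> \<rho>\<^sup>q\<^sup>-\<^sup>1 = 1\<close> absorbs the constants \<open>\<Lambda>\<^sup>j\<close> that grow along the levels
  \<open>K (2 - 2\<^sup>-\<^sup>j)\<close>.\<close>

lemma de_giorgi_iteration:
  fixes a :: "real \<Rightarrow> real" and q \<sigma> A :: real
  assumes a0: "\<And>k. 0 \<le> a k" and anti: "\<And>k l. k \<le> l \<Longrightarrow> a l \<le> a k"
    and q: "q > 1" and \<sigma>: "\<sigma> > 0" and A: "A > 0"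
    and step: "\<And>k \<delta>. k > 0 \<Longrightarrow> \<delta> > 0 \<Longrightarrow> a (k + \<delta>) \<le> A * ((k + \<delta>) / \<delta>) powr \<sigma> * a k powr q"
    and small: "\<And>\<epsilon>. \<epsilon> > 0 \<Longrightarrow> \<exists>K>0. a K < \<epsilon>"
  shows "\<exists>K>0. a K = 0"
proof -
  define \<Lambda> where "\<Lambda> = 2 powr \<sigma>"
  define \<rho> where "\<rho> = \<Lambda> powr (- 1 / (q - 1))"
  define D where "D = A * 4 powr \<sigma>"
  have \<Lambda>: "\<Lambda> > 1" using \<sigma> by (simp add: \<Lambda>_def gr_one_powr)
  have \<rho>: "0 < \<rho>" "\<rho> < 1" using \<Lambda> q by (auto simp: \<rho>_def intro!: powr_less_one divide_neg_pos)
  have "\<rho> powr (q - 1) = \<Lambda> powr (- 1)" unfolding \<rho>_def powr_powr using q by simp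
  then have \<Lambda>\<rho>: "\<Lambda> * \<rho> powr (q - 1) = 1" using \<Lambda> by (simp add: powr_minus)
  have D: "D > 0" using A by (simp add: D_def)
  \<comment> \<open>\<open>D\<close> is \<open>A\<close> times the factor
    \<open>4 powr \<sigma>\<close> due to the level gaps. The starting level is so high that
    \<open>D * a K powr (q - 1) \<le> \<rho>\<close>, which yields the one factor
    \<open>\<rho>\<close> gained in each induction step.\<close>
  obtain K where K: "K > 0" "a K < (\<rho> / D) powr (1 / (q - 1))"
    using small[of "(\<rho> / D) powr (1 / (q - 1))"] \<rho> D by auto
  have DK: "D * a K powr (q - 1) \<le> \<rho>"
  proof -
    have "a K powr (q - 1) \<le> ((\<rho> / D) powr (1 / (q - 1))) powr (q - 1)"
      using K a0 q by (intro powr_mono2) auto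
    also have "\<dots> = \<rho> / D" using q \<rho> D by (simp add: powr_powr)
    finally show ?thesis using D by (simp add: field_simps)
  qed
  define l where "l j = K * (2 - (1 / 2) ^ j)" for j :: nat
  have l_pos: "l j > 0" for j
  proof -
    have "(1 / 2 :: real) ^ j \<le> 1" by (rule power_le_one) auto
    then show ?thesis using K(1) unfolding l_def by (intro mult_pos_pos) linarith+
  qed
  have le: "a (l j) \<le> a K * \<rho> ^ j" for j
  proof (induction j)
    case (Suc j)
    define \<delta> where "\<delta> = K * (1 / 2) ^ Suc j"
    have \<delta>: "\<delta> > 0" using K(1) by (simp add: \<delta>_def)
    have ls: "l (Suc j) = l j + \<delta>" by (simp add: l_def \<delta>_def algebra_simps)
    \<comment> \<open>All levels stay below \<open>2 K\<close> while the gap is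
      \<open>K / 2^(j+1)\<close>; the quotient of the two is \<open>4 * 2 ^ j\<close>.\<close>
    have "(l j + \<delta>) / \<delta> \<le> 4 * 2 ^ j"
    proof -
      have "l j + \<delta> \<le> 2 * K" unfolding ls[symmetric] using K(1) by (simp add: l_def algebra_simps)
      also have "2 * K = 4 * 2 ^ j * \<delta>" by (simp add: \<delta>_def power_divide)
      finally show ?thesis using \<delta> by (simp add: pos_divide_le_eq)
    qed
    then have "((l j + \<delta>) / \<delta>) powr \<sigma> \<le> (4 * 2 ^ j) powr \<sigma>"
      using \<sigma> \<delta> l_pos[of j] by (intro powr_mono2) auto
    also have "\<dots> = 4 powr \<sigma> * \<Lambda> ^ j"
      by (simp add: powr_mult \<Lambda>_def powr_realpow[symmetric] powr_powr mult.commute)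
    finally have r: "((l j + \<delta>) / \<delta>) powr \<sigma> \<le> 4 powr \<sigma> * \<Lambda> ^ j" .
    have "a (l (Suc j)) \<le> A * ((l j + \<delta>) / \<delta>) powr \<sigma> * a (l j) powr q"
      unfolding ls by (rule step[OF l_pos \<delta>])
    also have "\<dots> \<le> A * (4 powr \<sigma> * \<Lambda> ^ j) * (a K * \<rho> ^ j) powr q"
      using r Suc A a0 q \<Lambda> by (intro mult_mono powr_mono2) auto
    also have "\<dots> = D * \<Lambda> ^ j * (a K powr q * (\<rho> ^ j) powr q)"
      using a0[of K] \<rho> by (simp add: D_def powr_mult mult_ac)
    also have "a K powr q = a K powr (q - 1) * a K"
      using a0[of K] powr_mult_base[of "a K" "q - 1"] by (simp add: mult.commute)
    also have "(\<rho> ^ j) powr q = \<rho> ^ j * (\<rho> powr (q - 1)) ^ j"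
    proof -
      have "(\<rho> ^ j) powr q = (\<rho> powr q) ^ j"
        using \<rho> by (simp add: powr_realpow[symmetric] powr_powr mult.commute)
      also have "\<rho> powr q = \<rho> * \<rho> powr (q - 1)" using \<rho> powr_mult_base[of \<rho> "q - 1"] by simp
      finally show ?thesis by (simp add: power_mult_distrib)
    qed
    also have "D * \<Lambda> ^ j * (a K powr (q - 1) * a K * (\<rho> ^ j * (\<rho> powr (q - 1)) ^ j))
       = (D * a K powr (q - 1)) * (a K * \<rho> ^ j) * (\<Lambda> * \<rho> powr (q - 1)) ^ j"
      by (simp add: power_mult_distrib)
    also have "\<dots> \<le> \<rho> * (a K * \<rho> ^ j) * 1 ^ j"
      unfolding \<Lambda>\<rho> using DK a0 \<rho> by (intro mult_right_mono) auto
    finally show ?case by (simp add: mult_ac)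
  qed (simp add: l_def)
  have "a (2 * K) \<le> a K * \<rho> ^ j" for j
    using anti[of "l j" "2 * K"] le[of j] K(1) by (simp add: l_def algebra_simps)
  moreover have "(\<lambda>j. a K * \<rho> ^ j) \<longlonglongrightarrow> a K * 0"
    using \<rho> by (intro tendsto_intros LIMSEQ_realpow_zero) auto
  ultimately have "a (2 * K) \<le> a K * 0" by (intro LIMSEQ_le_const) auto
  then show ?thesis using a0[of "2 * K"] K(1) by (intro exI[of _ "2 * K"]) auto
qed

text \<open>With \<open>r = 2n/(2n - \<mu>)\<close> one has \<open>p r = \<sigma>\<close>. For
  \<open>v x > k\<close> and \<open>v y \<le> v x\<close> the one-sided bound applies directly. If
  instead \<open>v y > v x > k\<close>, then \<open>y\<close> lies in the superlevel set too, and
  the one-sided bound with exchanged roles again has the tail on its right-hand side. So the bound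
  is linear in the tail although \<open>v y\<close> is not truncated.\<close>

lemma choquard_tail:
  fixes \<mu> :: real
  assumes n3: "DIM('a::euclidean_space) \<ge> 3" and \<mu>: "0 < \<mu>" "\<mu> < real DIM('a)"
  defines "p \<equiv> crit_exp DIM('a) \<mu>" and "\<sigma> \<equiv> 2 * real DIM('a) / (real DIM('a) - 2)"
  shows "\<exists>C>0. \<forall>(v::'a \<Rightarrow> real) M k. v \<in> borel_measurable lebesgue \<longrightarrow> (\<forall>x. 0 \<le> v x) \<longrightarrow> 0 \<le> M \<longrightarrow> 0 \<le> k \<longrightarrow>
    (\<integral>\<^sup>+x. ennreal (v x powr \<sigma>) \<partial>lebesgue) \<le> ennreal M \<longrightarrow>
    (\<integral>\<^sup>+x. \<integral>\<^sup>+y. ennreal (v y powr p * (if v x > k then v x powr p else 0) / norm (x - y) powr \<mu>) \<partial>lebesgue \<partial>lebesgue)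
      \<le> ennreal (2 * (C + M)) * (\<integral>\<^sup>+x. (if v x > k then ennreal (v x powr \<sigma>) else 0) \<partial>lebesgue)"
proof -
  define n where "n = real DIM('a)"
  define r where "r = 2 * n / (2 * n - \<mu>)"
  have n: "n \<ge> 3" "\<mu> < n" using n3 \<mu> by (auto simp: n_def)
  have r: "r > 1" using n \<mu> by (simp add: r_def field_simps)
  have p: "p > 0" using n \<mu> by (simp add: p_def crit_exp_def n_def[symmetric])
  have pr: "p * r = \<sigma>" using n \<mu> by (simp add: p_def crit_exp_def r_def \<sigma>_def n_def[symmetric])
  have "1 / r + 1 / r + \<mu> / real DIM('a) = 2" using n \<mu> by (simp add: r_def n_def[symmetric] field_simps)
  then obtain C where C: "C > 0" "\<And>(f::'a \<Rightarrow> real) g F. f \<in> borel_measurable lebesgue \<Longrightarrow> g \<in> borel_measurable lebesgue \<Longrightarrow>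
     (\<forall>y. 0 \<le> f y) \<Longrightarrow> (\<forall>y. 0 \<le> g y) \<Longrightarrow> (\<integral>\<^sup>+y. ennreal (f y powr r) \<partial>lebesgue) \<le> ennreal F \<Longrightarrow> 0 \<le> F \<Longrightarrow>
     (\<integral>\<^sup>+x. \<integral>\<^sup>+y. (if f y powr r \<le> g x powr r then ennreal (f y * g x / norm (x - y) powr \<mu>) else 0) \<partial>lebesgue \<partial>lebesgue)
       \<le> ennreal (C + F) * (\<integral>\<^sup>+x. ennreal (g x powr r) \<partial>lebesgue)"
    using HLS_region[OF \<mu> r r] by blast
  have main: "(\<integral>\<^sup>+x. \<integral>\<^sup>+y. ennreal (v y powr p * (if v x > k then v x powr p else 0) / norm (x - y) powr \<mu>) \<partial>lebesgue \<partial>lebesgue)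
      \<le> ennreal (2 * (C + M)) * (\<integral>\<^sup>+x. (if v x > k then ennreal (v x powr \<sigma>) else 0) \<partial>lebesgue)"
    if vm[measurable]: "v \<in> borel_measurable lebesgue" and v: "\<forall>x. 0 \<le> v x" and M: "0 \<le> M" and k: "0 \<le> k"
      and vM: "(\<integral>\<^sup>+x. ennreal (v x powr \<sigma>) \<partial>lebesgue) \<le> ennreal M" for v :: "'a \<Rightarrow> real" and M k
  proof -
    define f where "f x = v x powr p" for x
    define g where "g x = (if v x > k then v x powr p else 0)" for x
    have fm: "f \<in> borel_measurable lebesgue" and gm: "g \<in> borel_measurable lebesgue"
      unfolding f_def g_def by measurable
    have fg: "\<forall>x. 0 \<le> f x" "\<forall>x. 0 \<le> g x" by (auto simp: f_def g_def)
    have fr: "f x powr r = v x powr \<sigma>" for x by (simp add: f_def powr_powr pr)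
    have gr: "ennreal (g x powr r) = (if v x > k then ennreal (v x powr \<sigma>) else 0)" for x
      by (simp add: g_def powr_powr pr)
    have fM: "(\<integral>\<^sup>+x. ennreal (f x powr r) \<partial>lebesgue) \<le> ennreal M" using vM by (simp add: fr)
    have gM: "(\<integral>\<^sup>+x. ennreal (g x powr r) \<partial>lebesgue) \<le> ennreal M"
      by (rule order_trans[OF nn_integral_mono vM]) (simp add: gr)
    let ?R = "\<lambda>f g x y. if f y powr r \<le> g x powr r then ennreal (f y * g x / norm (x - y) powr \<mu>) else 0"
    have "(\<integral>\<^sup>+x. \<integral>\<^sup>+y. ennreal (f y * g x / norm (x - y) powr \<mu>) \<partial>lebesgue \<partial>lebesgue)
      \<le> (\<integral>\<^sup>+x. \<integral>\<^sup>+y. ?R f g x y \<partial>lebesgue \<partial>lebesgue) + (\<integral>\<^sup>+y. \<integral>\<^sup>+x. ?R g g y x \<partial>lebesgue \<partial>lebesgue)"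
    proof (rule lebesgue_pair.nn_integral_split_swap[OF HLS_integrand_measurable[OF fm gm] HLS_integrand_measurable[OF gm gm]])
      fix x y
      show "ennreal (f y * g x / norm (x - y) powr \<mu>) \<le> ?R f g x y + ?R g g y x"
      proof (cases "f y powr r \<le> g x powr r \<or> g x = 0")
        case False
        then have gx: "g x = v x powr p" "v x > k" by (auto simp: g_def split: if_splits)
        have "g x powr r < f y powr r" using False by simp
        then have "v x powr \<sigma> < v y powr \<sigma>" by (simp add: fr gx powr_powr pr)
        then have "v x < v y" using v n powr_mono2[of \<sigma> "v y" "v x"] by (force simp: \<sigma>_def n_def[symmetric])
        then have "g y = f y" using gx(2) by (simp add: g_def f_def)
        then show ?thesis using False by (simp add: norm_minus_commute mult.commute)
      qed auto
    qed
    also have "\<dots> \<le> ennreal (C + M) * (\<integral>\<^sup>+x. ennreal (g x powr r) \<partial>lebesgue) + ennreal (C + M) * (\<integral>\<^sup>+x. ennreal (g x powr r) \<partial>lebesgue)"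
      by (intro add_mono C(2) fm gm fg fM gM M)
    also have "\<dots> = ennreal (2 * (C + M)) * (\<integral>\<^sup>+x. ennreal (g x powr r) \<partial>lebesgue)"
    proof -
      have "ennreal (2 * (C + M)) = ennreal (C + M) + ennreal (C + M)"
        using C(1) M by (subst ennreal_plus[symmetric]) auto
      then show ?thesis by (simp add: distrib_right)
    qed
    finally show ?thesis unfolding gr by (simp add: f_def g_def)
  qed
  show ?thesis by (rule exI[of _ C]) (use main C(1) in auto)
qed

theorem theorem1p3:
  fixes \<Omega> :: "'a::euclidean_space set" and u :: "'a \<Rightarrow> real" and s \<mu> :: real
  assumes n3: "DIM('a) \<ge> 3"
    and s: "0 < s" "s < 1"
    and mu: "0 < \<mu>" "\<mu> < real DIM('a)"
    and dom: "open \<Omega>" "connected \<Omega>" "bounded \<Omega>" "\<Omega> \<noteq> {}"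
    and bdry: "C11_boundary \<Omega>"
    and uX: "X0 s \<Omega> u"
    and upos: "AE x in lebesgue. u x \<ge> 0"
    and eq: "\<And>\<phi>. X0 s \<Omega> \<phi> \<Longrightarrow>
       (LINT x|lebesgue. wgrad u x \<bullet> wgrad \<phi> x)
       + (LINT z|(lebesgue \<Otimes>\<^sub>M lebesgue).
            (u (fst z) - u (snd z)) * (\<phi> (fst z) - \<phi> (snd z))
            / norm (fst z - snd z) powr (real DIM('a) + 2 * s))
       = (LINT x|lebesgue. indicator \<Omega> x *
            (LINT y|lebesgue. indicator \<Omega> y *
               (max (u y) 0 powr crit_exp DIM('a) \<mu> * max (u x) 0 powr (crit_exp DIM('a) \<mu> - 1) * \<phi> x
                / norm (x - y) powr \<mu>)))"
  shows "\<exists>C. AE x in lebesgue. \<bar>u x\<bar> \<le> C"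
proof -
  define n where "n = real DIM('a)"
  define p where "p = crit_exp DIM('a) \<mu>"
  define \<sigma> where "\<sigma> = 2 * n / (n - 2)"
  define q where "q = n / (n - 2)"
  \<comment> \<open>\<open>u\<close> is nonnegative only almost everywhere; \<open>v\<close> is so
    everywhere and is the function that stands on the right-hand side of the equation.\<close>
  define v where "v x = max (u x) 0" for x
  have n: "n \<ge> 3" "\<mu> < n" using n3 mu by (auto simp: n_def)
  have \<sigma>: "\<sigma> > 0" and q: "q > 1" using n by (auto simp: \<sigma>_def q_def field_simps)
  have um[measurable]: "u \<in> borel_measurable lebesgue" using uX by (simp add: X0_def)
  have vm[measurable]: "v \<in> borel_measurable lebesgue" unfolding v_def[abs_def] by measurable
  have v0: "\<forall>x. 0 \<le> v x" by (simp add: v_def)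
  have vu: "AE x in lebesgue. v x = u x" using upos by eventually_elim (simp add: v_def)
  obtain H where H: "has_weak_gradient u H" and eta: "eta2 s u H < \<infinity>"
    using uX unfolding X0_def by blast
  define g where "g = wgrad u"
  \<comment> \<open>\<open>X0\<close> provides some weak gradient, so the one chosen by
    \<open>wgrad\<close> is genuine.\<close>
  have g: "has_weak_gradient u g" unfolding g_def wgrad_def by (rule someI[of "has_weak_gradient u", OF H])
  have gm[measurable]: "g \<in> borel_measurable lebesgue" by (rule has_weak_gradient_measurable[OF g])
  have gfin: "(\<integral>\<^sup>+x. ennreal ((norm (g x))\<^sup>2) \<partial>lebesgue) < \<infinity>"
  proof -
    have "(\<integral>\<^sup>+x. ennreal ((norm (g x))\<^sup>2) \<partial>lebesgue) = (\<integral>\<^sup>+x. ennreal ((norm (H x))\<^sup>2) \<partial>lebesgue)"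
      by (rule nn_integral_cong_AE, rule eventually_mono[OF has_weak_gradient_unique[OF g H]]) simp
    then show ?thesis using eta by (simp add: eta2_def)
  qed

  obtain S where S: "S > 0" "\<And>\<Omega> (w::'a \<Rightarrow> real) G F. bounded \<Omega> \<Longrightarrow> X0 s \<Omega> w \<Longrightarrow> has_weak_gradient w G \<Longrightarrow> F > 0 \<Longrightarrow>
    (\<integral>\<^sup>+x. ennreal ((norm (G x))\<^sup>2) \<partial>lebesgue) \<le> ennreal F \<Longrightarrow>
    (\<integral>\<^sup>+x. ennreal (\<bar>w x\<bar> powr \<sigma>) \<partial>lebesgue) \<le> ennreal ((S * F) powr q)"
    using X0_sobolev[OF n3 s(1)] unfolding \<sigma>_def q_def n_def by blast

  obtain M where M: "0 \<le> M" "(\<integral>\<^sup>+x. ennreal (v x powr \<sigma>) \<partial>lebesgue) \<le> ennreal M"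
  proof -
    obtain B where B: "B \<ge> 0" "(\<integral>\<^sup>+x. ennreal ((norm (g x))\<^sup>2) \<partial>lebesgue) = ennreal B"
      using gfin by (cases "\<integral>\<^sup>+x. ennreal ((norm (g x))\<^sup>2) \<partial>lebesgue") auto
    have "(\<integral>\<^sup>+x. ennreal (v x powr \<sigma>) \<partial>lebesgue) = (\<integral>\<^sup>+x. ennreal (\<bar>u x\<bar> powr \<sigma>) \<partial>lebesgue)"
    proof (rule nn_integral_cong_AE)
      show "AE x in lebesgue. ennreal (v x powr \<sigma>) = ennreal (\<bar>u x\<bar> powr \<sigma>)"
        using vu upos by eventually_elim simp
    qed
    also have "\<dots> \<le> ennreal ((S * (B + 1)) powr q)"
      by (rule S(2)[OF dom(3) uX g]) (use B in \<open>auto intro: ennreal_leI\<close>)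
    finally show ?thesis using that[of "(S * (B + 1)) powr q"] by simp
  qed

  obtain C where C: "C > 0" and tail: "\<And>k. 0 \<le> k \<Longrightarrow>
    (\<integral>\<^sup>+x. \<integral>\<^sup>+y. ennreal (v y powr p * (if v x > k then v x powr p else 0) / norm (x - y) powr \<mu>) \<partial>lebesgue \<partial>lebesgue)
      \<le> ennreal C * (\<integral>\<^sup>+x. (if v x > k then ennreal (v x powr \<sigma>) else 0) \<partial>lebesgue)"
  proof -
    obtain C0 where C0: "C0 > 0" "\<And>(w::'a \<Rightarrow> real) M k. w \<in> borel_measurable lebesgue \<Longrightarrow> (\<forall>x. 0 \<le> w x) \<Longrightarrow> 0 \<le> M \<Longrightarrow> 0 \<le> k \<Longrightarrow>
      (\<integral>\<^sup>+x. ennreal (w x powr \<sigma>) \<partial>lebesgue) \<le> ennreal M \<Longrightarrow>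
      (\<integral>\<^sup>+x. \<integral>\<^sup>+y. ennreal (w y powr p * (if w x > k then w x powr p else 0) / norm (x - y) powr \<mu>) \<partial>lebesgue \<partial>lebesgue)
        \<le> ennreal (2 * (C0 + M)) * (\<integral>\<^sup>+x. (if w x > k then ennreal (w x powr \<sigma>) else 0) \<partial>lebesgue)"
      using choquard_tail[OF n3 mu] unfolding \<sigma>_def p_def n_def by blast
    show ?thesis
      by (rule that[of "2 * (C0 + M)"], use C0(1) M(1) in simp, rule C0(2)[OF vm v0 M(1) _ M(2)])
  qed

  define \<tau> where "\<tau> k x = (if v x > k then v x powr \<sigma> else 0)" for k x
  define a where "a k = (LINT x|lebesgue. \<tau> k x)" for k
  have \<tau>m[measurable]: "\<tau> k \<in> borel_measurable lebesgue" for k unfolding \<tau>_def[abs_def] by measurable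
  have \<tau>0: "0 \<le> \<tau> k x" "\<tau> k x \<le> v x powr \<sigma>" for k x by (auto simp: \<tau>_def)
  have vi: "integrable lebesgue (\<lambda>x. v x powr \<sigma>)"
    using M(2) by (intro integrableI_bounded) (auto simp: le_less_trans)
  have \<tau>i: "integrable lebesgue (\<tau> k)" for k
    by (rule Bochner_Integration.integrable_bound[OF vi]) (use \<tau>0 in auto)
  have a_nn: "(\<integral>\<^sup>+x. (if v x > k then ennreal (v x powr \<sigma>) else 0) \<partial>lebesgue) = ennreal (a k)" for k
  proof -
    have "(\<integral>\<^sup>+x. (if v x > k then ennreal (v x powr \<sigma>) else 0) \<partial>lebesgue) = (\<integral>\<^sup>+x. ennreal (\<tau> k x) \<partial>lebesgue)"
      by (intro nn_integral_cong) (simp add: \<tau>_def)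
    then show ?thesis unfolding a_def using nn_integral_eq_integral[OF \<tau>i] \<tau>0 by simp
  qed
  have a0: "0 \<le> a k" for k unfolding a_def by (rule Bochner_Integration.integral_nonneg) (rule \<tau>0)
  have anti: "a l \<le> a k" if "k \<le> l" for k l
    unfolding a_def by (rule integral_mono[OF \<tau>i \<tau>i]) (use that in \<open>auto simp: \<tau>_def\<close>)

  \<comment> \<open>Testing with \<open>w = h(u)\<close> gives the local term as the integral of
    \<open>h'(u) |grad u|^2\<close>. It dominates the integral of
    \<open>|grad w|^2 = h'(u)^2 |grad u|^2\<close> because
    \<open>0 \<le> h' \<le> 1\<close>.\<close>
  have energy: "X0 s \<Omega> (\<lambda>x. smooth_trunc k \<delta> (u x)) \<and>
      (\<exists>G. has_weak_gradient (\<lambda>x. smooth_trunc k \<delta> (u x)) G \<and>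
         (\<integral>\<^sup>+x. ennreal ((norm (G x))\<^sup>2) \<partial>lebesgue) \<le> ennreal (C * a k))" if k: "k > 0" and \<delta>: "\<delta> > 0" for k \<delta>
  proof -
    let ?h = "smooth_trunc k \<delta>" and ?h' = "smooth_trunc_deriv k \<delta>"
    define w where "w x = ?h (u x)" for x
    have "?h 0 = 0" using k \<delta> by (intro smooth_trunc_eq_0) auto
    note comp = X0_compose[OF s(1) dom(3) uX smooth_trunc_has_derivative[OF \<delta>] continuous_on_smooth_trunc_deriv
        _ this Ck_smooth_trunc]
    have wX: "X0 s \<Omega> w" and wg: "AE x in lebesgue. wgrad w x = ?h' (u x) *\<^sub>R g x"
      unfolding w_def[abs_def] g_def using comp smooth_trunc_deriv_bounds by auto
    obtain K where "has_weak_gradient w K" using wX unfolding X0_def by blast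
    then have wK: "has_weak_gradient w (wgrad w)" unfolding wgrad_def by (rule someI[of "has_weak_gradient w"])
    note [measurable] = has_weak_gradient_measurable[OF wK]
    define I1 where "I1 = (LINT x|lebesgue. wgrad u x \<bullet> wgrad w x)"
    define I2 where "I2 = (LINT z|(lebesgue \<Otimes>\<^sub>M lebesgue).
            (u (fst z) - u (snd z)) * (w (fst z) - w (snd z))
            / norm (fst z - snd z) powr (real DIM('a) + 2 * s))"
    define inner_rhs where "inner_rhs x = (LINT y|lebesgue. indicator \<Omega> y *
               (max (u y) 0 powr p * max (u x) 0 powr (p - 1) * w x / norm (x - y) powr \<mu>))" for x
    define rhs where "rhs = (LINT x|lebesgue. indicator \<Omega> x * inner_rhs x)"
    have I: "I1 + I2 = rhs"
      using eq[OF wX] unfolding I1_def I2_def rhs_def inner_rhs_def p_def .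
    have w0: "0 \<le> w x" for x using smooth_trunc_nonneg[OF \<delta>] by (simp add: w_def)
    \<comment> \<open>Only the sign matters, and it comes from monotonicity of the truncation; were
      the integrand not integrable, the integral would be 0.\<close>
    have I2: "0 \<le> I2"
      unfolding I2_def w_def using smooth_trunc_monotone[OF \<delta>]
      by (intro Bochner_Integration.integral_nonneg divide_nonneg_nonneg) auto
    have inner0: "0 \<le> inner_rhs x" for x
      unfolding inner_rhs_def using w0 by (intro Bochner_Integration.integral_nonneg) simp
    have rhs_le: "ennreal rhs \<le> ennreal (C * a k)"
    proof -
      have "ennreal rhs \<le> (\<integral>\<^sup>+x. ennreal (indicator \<Omega> x * inner_rhs x) \<partial>lebesgue)"
        unfolding rhs_def using inner0 by (intro ennreal_integral_le_nn_integral) simp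
      also have "\<dots> \<le> (\<integral>\<^sup>+x. \<integral>\<^sup>+y. ennreal (v y powr p * (if v x > k then v x powr p else 0) / norm (x - y) powr \<mu>) \<partial>lebesgue \<partial>lebesgue)"
      proof (rule nn_integral_mono)
        fix x
        \<comment> \<open>Above the level, \<open>w \<le> u - k \<le> u\<close> raises the power
          \<open>p - 1\<close> to \<open>p\<close>; below it \<open>w = 0\<close>.\<close>
        have vw: "v x powr (p - 1) * w x \<le> (if v x > k then v x powr p else 0)"
        proof (cases "u x > k")
          case True
          then have "v x = u x" "v x > k" "v x > 0" using k by (auto simp: v_def)
          moreover have "w x \<le> u x" using smooth_trunc_le[OF True \<delta>] k by (simp add: w_def)
          ultimately have "v x powr (p - 1) * w x \<le> v x powr (p - 1) * v x" by (intro mult_left_mono) auto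
          also have "\<dots> = v x powr p" using \<open>v x > 0\<close> powr_mult_base[of "v x" "p - 1"] by (simp add: mult.commute)
          finally show ?thesis using \<open>v x > k\<close> by simp
        next
          case False
          then have "w x = 0" using smooth_trunc_eq_0[of "u x" k \<delta>] \<delta> by (simp add: w_def)
          then show ?thesis by simp
        qed
        have "ennreal (indicator \<Omega> x * inner_rhs x) \<le> ennreal (inner_rhs x)"
          using inner0[of x] by (intro ennreal_leI) (simp add: indicator_def)
        also have "\<dots> \<le> (\<integral>\<^sup>+y. ennreal (indicator \<Omega> y * (max (u y) 0 powr p * max (u x) 0 powr (p - 1) * w x / norm (x - y) powr \<mu>)) \<partial>lebesgue)"
          unfolding inner_rhs_def using w0[of x] by (intro ennreal_integral_le_nn_integral) simp
        also have "\<dots> \<le> (\<integral>\<^sup>+y. ennreal (v y powr p * (if v x > k then v x powr p else 0) / norm (x - y) powr \<mu>) \<partial>lebesgue)"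
        proof (rule nn_integral_mono, rule ennreal_leI)
          fix y
          have "indicator \<Omega> y * (v y powr p * v x powr (p - 1) * w x / norm (x - y) powr \<mu>)
              \<le> v y powr p * (v x powr (p - 1) * w x) / norm (x - y) powr \<mu>"
            using w0[of x] by (simp add: indicator_def mult.assoc)
          also have "\<dots> \<le> v y powr p * (if v x > k then v x powr p else 0) / norm (x - y) powr \<mu>"
            by (intro divide_right_mono mult_left_mono vw) auto
          finally show "indicator \<Omega> y * (max (u y) 0 powr p * max (u x) 0 powr (p - 1) * w x / norm (x - y) powr \<mu>)
             \<le> v y powr p * (if v x > k then v x powr p else 0) / norm (x - y) powr \<mu>" by (simp add: v_def)
        qed
        finally show "ennreal (indicator \<Omega> x * inner_rhs x)
          \<le> (\<integral>\<^sup>+y. ennreal (v y powr p * (if v x > k then v x powr p else 0) / norm (x - y) powr \<mu>) \<partial>lebesgue)" .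
      qed
      also have "\<dots> \<le> ennreal C * ennreal (a k)" using tail[of k] k unfolding a_nn by simp
      also have "\<dots> = ennreal (C * a k)" using C a0[of k] by (simp add: ennreal_mult)
      finally show ?thesis .
    qed
    have h'1: "0 \<le> ?h' t" "?h' t \<le> 1" for t by (rule smooth_trunc_deriv_bounds)+
    have h'm[measurable]: "?h' \<in> borel_measurable borel"
      by (rule borel_measurable_continuous_onI[OF continuous_on_smooth_trunc_deriv])
    have e_int: "integrable lebesgue (\<lambda>x. ?h' (u x) * (norm (g x))\<^sup>2)"
    proof (rule Bochner_Integration.integrable_bound)
      show "integrable lebesgue (\<lambda>x. (norm (g x))\<^sup>2)" using gfin by (intro integrableI_bounded) auto
      show "AE x in lebesgue. norm (?h' (u x) * (norm (g x))\<^sup>2) \<le> norm ((norm (g x))\<^sup>2)"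
        using h'1 by (intro AE_I2) (simp add: abs_mult mult_left_le_one_le)
    qed measurable
    have I1: "I1 = (LINT x|lebesgue. ?h' (u x) * (norm (g x))\<^sup>2)"
      unfolding I1_def g_def[symmetric]
    proof (rule integral_cong_AE)
      show "AE x in lebesgue. g x \<bullet> wgrad w x = ?h' (u x) * (norm (g x))\<^sup>2"
        using wg by eventually_elim (simp add: power2_norm_eq_inner)
    qed measurable
    have "(\<integral>\<^sup>+x. ennreal ((norm (wgrad w x))\<^sup>2) \<partial>lebesgue) \<le> (\<integral>\<^sup>+x. ennreal (?h' (u x) * (norm (g x))\<^sup>2) \<partial>lebesgue)"
    proof (rule nn_integral_mono_AE)
      show "AE x in lebesgue. ennreal ((norm (wgrad w x))\<^sup>2) \<le> ennreal (?h' (u x) * (norm (g x))\<^sup>2)"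
        using wg
      proof eventually_elim
        case (elim x)
        have "(?h' (u x))\<^sup>2 \<le> ?h' (u x)" using h'1[of "u x"] by (simp add: power2_eq_square mult_left_le)
        then show ?case by (intro ennreal_leI) (simp add: elim power_mult_distrib mult_right_mono)
      qed
    qed
    also have "\<dots> = ennreal I1" unfolding I1 using h'1 by (intro nn_integral_eq_integral e_int) auto
    also have "\<dots> \<le> ennreal rhs" using I I2 by (intro ennreal_leI) simp
    also note rhs_le
    finally show ?thesis using wX wK unfolding w_def[abs_def] by blast
  qed

  \<comment> \<open>\<open>exp 1\<close> stems from the lower bound for the smooth truncation,
    \<open>S\<close> from the Sobolev inequality, and \<open>2 * C\<close> is a generous form of the
    energy constant.\<close>
  define A where "A = exp 1 powr \<sigma> * (S * (2 * C)) powr q"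
  have A: "A > 0" using S C by (simp add: A_def)
  have step: "a (k + \<delta>) \<le> A * ((k + \<delta>) / \<delta>) powr \<sigma> * a k powr q" if k: "k > 0" and \<delta>: "\<delta> > 0" for k \<delta>
  proof (cases "a k = 0")
    \<comment> \<open>Treated apart because the Sobolev bound is stated for a positive energy bound;
      here monotonicity of the tails suffices.\<close>
    case True
    then show ?thesis using anti[of k "k + \<delta>"] a0[of "k + \<delta>"] \<delta> by simp
  next
    case False
    then have ak: "a k > 0" using a0[of k] by simp
    define w where "w x = smooth_trunc k \<delta> (u x)" for x
    obtain G where wX: "X0 s \<Omega> w" and G: "has_weak_gradient w G"
      and GC: "(\<integral>\<^sup>+x. ennreal ((norm (G x))\<^sup>2) \<partial>lebesgue) \<le> ennreal (C * a k)"
      using energy[OF k \<delta>] unfolding w_def[abs_def] by blast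
    have sob: "(\<integral>\<^sup>+x. ennreal (\<bar>w x\<bar> powr \<sigma>) \<partial>lebesgue) \<le> ennreal ((S * (C * a k)) powr q)"
      by (rule S(2)[OF dom(3) wX G _ GC]) (use C ak in simp)
    define c where "c = (exp 1 * ((k + \<delta>) / \<delta>)) powr \<sigma>"
    have c: "c \<ge> 0" by (simp add: c_def)
    have wm: "w \<in> borel_measurable lebesgue" using wX by (simp add: X0_def)
    have "ennreal (a (k + \<delta>)) = (\<integral>\<^sup>+x. (if v x > k + \<delta> then ennreal (v x powr \<sigma>) else 0) \<partial>lebesgue)" by (simp add: a_nn)
    also have "\<dots> \<le> (\<integral>\<^sup>+x. ennreal c * ennreal (\<bar>w x\<bar> powr \<sigma>) \<partial>lebesgue)"
    proof (rule nn_integral_mono)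
      fix x
      show "(if v x > k + \<delta> then ennreal (v x powr \<sigma>) else 0) \<le> ennreal c * ennreal (\<bar>w x\<bar> powr \<sigma>)"
      proof (cases "v x > k + \<delta>")
        case True
        then have vx: "v x = u x" "u x > k + \<delta>" using k \<delta> by (auto simp: v_def max_def split: if_splits)
        have wx: "(u x - k) * exp (- 1) \<le> w x" using smooth_trunc_ge[of k \<delta> "u x"] vx \<delta> by (simp add: w_def)
        \<comment> \<open>The quotient \<open>t / (t - k)\<close> decreases in \<open>t\<close>, so
          for \<open>t \<ge> k + \<delta>\<close> it is at most its value at
          \<open>k + \<delta>\<close>.\<close>
        have "u x \<le> ((k + \<delta>) / \<delta>) * (u x - k)"
        proof -
          have "k * (k + \<delta>) \<le> k * u x" using vx(2) k by (intro mult_left_mono) auto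
          then show ?thesis using \<delta> by (simp add: field_simps)
        qed
        also have "\<dots> \<le> ((k + \<delta>) / \<delta>) * (exp 1 * w x)"
        proof (rule mult_left_mono)
          have "u x - k = exp 1 * ((u x - k) * exp (- 1))" by (simp add: exp_minus)
          also have "\<dots> \<le> exp 1 * w x" by (rule mult_left_mono[OF wx]) simp
          finally show "u x - k \<le> exp 1 * w x" .
        qed (use k \<delta> in simp)
        finally have "v x \<le> exp 1 * ((k + \<delta>) / \<delta>) * w x" by (simp add: vx(1) mult_ac)
        moreover have "0 \<le> w x" using smooth_trunc_nonneg[OF \<delta>] by (simp add: w_def)
        ultimately have "v x powr \<sigma> \<le> (exp 1 * ((k + \<delta>) / \<delta>) * \<bar>w x\<bar>) powr \<sigma>"
          using \<sigma> v0 by (intro powr_mono2) auto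
        also have "\<dots> = c * \<bar>w x\<bar> powr \<sigma>"
          unfolding c_def by (rule powr_mult)
        finally show ?thesis using True c by (simp add: ennreal_mult[symmetric] ennreal_leI)
      qed simp
    qed
    also have "\<dots> = ennreal c * (\<integral>\<^sup>+x. ennreal (\<bar>w x\<bar> powr \<sigma>) \<partial>lebesgue)"
      by (rule nn_integral_cmult) (use wm in measurable)
    also have "\<dots> \<le> ennreal c * ennreal ((S * (C * a k)) powr q)" by (rule mult_left_mono[OF sob]) simp
    also have "\<dots> = ennreal (c * (S * (C * a k)) powr q)" using c by (simp add: ennreal_mult)
    finally have "a (k + \<delta>) \<le> c * (S * (C * a k)) powr q" using c by simp
    also have "\<dots> \<le> c * (S * (2 * C * a k)) powr q"
      using c S C ak q by (intro mult_left_mono powr_mono2) auto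
    also have "\<dots> = A * ((k + \<delta>) / \<delta>) powr \<sigma> * a k powr q"
      unfolding A_def c_def powr_mult by (simp only: mult_ac)
    finally show ?thesis .
  qed

  \<comment> \<open>At each point the tail integrand vanishes as soon as \<open>m \<ge> v x\<close>,
    and \<open>v^\<sigma>\<close> is an integrable majorant.\<close>
  have "(\<lambda>m. a (real m)) \<longlonglongrightarrow> (LINT (x::'a)|lebesgue. (0::real))"
    unfolding a_def
  proof (rule integral_dominated_convergence[OF _ _ vi])
    show "AE x in lebesgue. (\<lambda>m. \<tau> (real m) x) \<longlonglongrightarrow> 0"
    proof (intro AE_I2 tendsto_eventually)
      fix x
      obtain N :: nat where N: "v x \<le> real N" using real_arch_simple by blast
      show "\<forall>\<^sub>F m in sequentially. \<tau> (real m) x = 0"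
        using eventually_ge_at_top[of N] by eventually_elim (use N in \<open>simp add: \<tau>_def\<close>)
    qed
    show "AE x in lebesgue. norm (\<tau> (real m) x) \<le> v x powr \<sigma>" for m using \<tau>0 by (intro AE_I2) simp
  qed measurable
  then have alim: "(\<lambda>m. a (real m)) \<longlonglongrightarrow> 0" by simp
  have small: "\<exists>K>0. a K < \<epsilon>" if "\<epsilon> > 0" for \<epsilon>
  proof -
    have "\<forall>\<^sub>F m in sequentially. a (real m) < \<epsilon> \<and> m > 0"
      using order_tendstoD(2)[OF alim that] eventually_gt_at_top[of 0] by (rule eventually_conj)
    then obtain m where "a (real m) < \<epsilon>" "m > 0" by (auto dest!: eventually_happens)
    then show ?thesis by (intro exI[of _ "real m"]) simp
  qed
  obtain K where K: "K > 0" "a K = 0" using de_giorgi_iteration[OF a0 anti q \<sigma> A step small] by blast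
  \<comment> \<open>A vanishing tail forces \<open>v \<le> K\<close> almost everywhere, since
    \<open>K > 0\<close> makes \<open>v^\<sigma>\<close> positive wherever
    \<open>v > K\<close>.\<close>
  have "AE x in lebesgue. \<tau> K x = 0"
    using integral_nonneg_eq_0_iff_AE[OF \<tau>i[of K]] \<tau>0 K(2) by (simp add: a_def)
  then have "AE x in lebesgue. \<bar>u x\<bar> \<le> K"
    using vu upos
  proof eventually_elim
    case (elim x)
    then show ?case using K(1) by (auto simp: \<tau>_def split: if_splits)
  qed
  then show ?thesis ..
qed

end
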